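(* Let $G$ be a second countable locally compact group, let $H$ be a closed subgroup of $G$, and let $\Phi$ be an $N$-function that is $\Delta_2$-regular (with respect to $G$ equipped with a left-invariant Haar measure $\mu_G$). Then the following are equivalent: (i) The left regular representation of $H$ on the Orlicz space $L^\Phi(G)$, i.e. $(\lambda_G(h)f)(x)=f(h^{-1}x)$ for $h\in H$, $x\in G$, $f\in L^\Phi(G)$, almost has invariant vectors; (ii) $H$ is amenable.
   Context: All topological groups are assumed separated (Hausdorff). **$N$-functions.** A function $\Phi:\mathbb{R}\to\mathbb{R}$ is an $N$-function if it is even and convex, $\Phi(x)=0\iff x=0$, $\lim_{x\to 0}\Phi(x)/x=0$, and $\lim_{x\to\infty}\Phi(x)/x=\infty$. **$\Delta_2$-conditions.** $\Phi\in\Delta_2(\infty)$ (resp. $\Phi\in\Delta_2(0)$, resp. $\Phi\in\Delta_2$) means that there exist constants $x_0>0$, $K>2$ such that $\Phi(2x)\le K\Phi(x)$ for all $x\ge x_0$ (resp. for all $0\le x\le x_0$, resp. for all $x\ge 0$). **Orlicz space.** For a measure space $(\Omega,\Sigma,\mu)$ put $\rho_\Phi(f)=\int_\Omega \Phi(f)\,d\mu$. The Orlicz space $L^\Phi(\Omega)$ is the real vector space of measurable functions $f:\Omega\to\mathbb{R}$ (functions equal almost everywhere being identified) such that $\rho_\Phi(af)<\infty$ for some $a>0$. It is equipped with the gauge (Luxemburg) norm $\|f\|_{(\Phi)}=\inf\{k>0:\rho_\Phi(f/k)\le 1\}$. $L^\Phi(G)$ denotes the Orlicz space of $G$ with respect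 to a left-invariant Haar measure $\mu_G$. **$\Delta_2$-regularity.** For an Orlicz space $L^\Phi(\Omega,\Sigma,\mu)$, $\Phi$ is called $\Delta_2$-regular if $\Phi\in\Delta_2(\infty)$ when $\mu(\Omega)<\infty$, or $\Phi\in\Delta_2$ when $\mu(\Omega)=\infty$, or $\Phi\in\Delta_2(0)$ when $\mu$ is a counting measure. Here $(\Omega,\mu)=(G,\mu_G)$. **Almost invariant vectors.** Let $V$ be a Banach space with a continuous linear representation $\alpha$ of a locally compact group $K$ by bounded operators on $V$. $V$ (or $\alpha$) almost has invariant vectors if for every compact subset $F\subset K$ and every $\varepsilon>0$ there exists a unit vector $v\in V$ such that $\|\alpha(g)v-v\|\le\varepsilon$ for all $g\in F$. In (i) this is applied with $K=H$, $V=L^\Phi(G)$ with the gauge norm. **Amenability.** A locally compact group $K$ is amenable if there exists a $K$-invariant mean on $L^\infty(K)$ (equivalently, every action of $K$ by continuous affine transformations on a nonempty convex compact subset of a locally convex space has a fixed point). *)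

theory Defs
  imports "HOL-Analysis.Analysis"
begin

section \<open>N-functions and the growth conditions\<close>

definition N_function :: "(real \<Rightarrow> real) \<Rightarrow> bool" where
  "N_function \<Phi> \<longleftrightarrow>
     (\<forall>x. \<Phi> (- x) = \<Phi> x) \<and>
     convex_on UNIV \<Phi> \<and>
     (\<forall>x. \<Phi> x = 0 \<longleftrightarrow> x = 0) \<and>
     ((\<lambda>x. \<Phi> x / x) \<longlongrightarrow> 0) (at 0) \<and>
     filterlim (\<lambda>x. \<Phi> x / x) at_top at_top"

definition Delta2_infinity :: "(real \<Rightarrow> real) \<Rightarrow> bool" where
  "Delta2_infinity \<Phi> \<longleftrightarrow> (\<exists>x0>0. \<exists>K>2. \<forall>x\<ge>x0. \<Phi> (2 * x) \<le> K * \<Phi> x)"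

definition Delta2_zero :: "(real \<Rightarrow> real) \<Rightarrow> bool" where
  "Delta2_zero \<Phi> \<longleftrightarrow> (\<exists>x0>0. \<exists>K>2. \<forall>x. 0 \<le> x \<and> x \<le> x0 \<longrightarrow> \<Phi> (2 * x) \<le> K * \<Phi> x)"

definition Delta2 :: "(real \<Rightarrow> real) \<Rightarrow> bool" where
  "Delta2 \<Phi> \<longleftrightarrow> (\<exists>K>2. \<forall>x\<ge>0. \<Phi> (2 * x) \<le> K * \<Phi> x)"

definition Delta2_regular :: "'a measure \<Rightarrow> (real \<Rightarrow> real) \<Rightarrow> bool" where
  "Delta2_regular M \<Phi> \<longleftrightarrow>
     (emeasure M (space M) < \<infinity> \<and> Delta2_infinity \<Phi>) \<or>
     (emeasure M (space M) = \<infinity> \<and> Delta2 \<Phi>) \<or>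
     (M = count_space (space M) \<and> Delta2_zero \<Phi>)"

section \<open>Orlicz spaces\<close>

definition orlicz_modular :: "'a measure \<Rightarrow> (real \<Rightarrow> real) \<Rightarrow> ('a \<Rightarrow> real) \<Rightarrow> ennreal" where
  "orlicz_modular M \<Phi> f = (\<integral>\<^sup>+ x. ennreal (\<Phi> (f x)) \<partial>M)"

text \<open>As for the integrable functions of the library, elements are functions rather than classes
  modulo almost everywhere equality; the gauge is accordingly a seminorm on this set, vanishing
  exactly on the functions that are zero almost everywhere.\<close>

definition orlicz_space :: "'a measure \<Rightarrow> (real \<Rightarrow> real) \<Rightarrow> ('a \<Rightarrow> real) set" where
  "orlicz_space M \<Phi> =
     {f \<in> borel_measurable M. \<exists>a>0. orlicz_modular M \<Phi> (\<lambda>x. a * f x) < \<infinity>}"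

definition gauge_norm :: "'a measure \<Rightarrow> (real \<Rightarrow> real) \<Rightarrow> ('a \<Rightarrow> real) \<Rightarrow> real" where
  "gauge_norm M \<Phi> f = Inf {k. 0 < k \<and> orlicz_modular M \<Phi> (\<lambda>x. f x / k) \<le> 1}"

section \<open>Locally compact groups\<close>

text \<open>Groups are written additively but are not assumed commutative: the class
  \<^class>\<open>topological_group_add\<close> extends \<^class>\<open>group_add\<close>.\<close>

definition subgroup_add :: "'a::group_add set \<Rightarrow> bool" where
  "subgroup_add H \<longleftrightarrow> 0 \<in> H \<and> (\<forall>x\<in>H. \<forall>y\<in>H. x + y \<in> H) \<and> (\<forall>x\<in>H. - x \<in> H)"

text \<open>Left Haar measures on a closed subgroup \<open>K\<close>, which is a topological group under the subspace
  topology; \<open>K = UNIV\<close> gives the ambient group. The sets of \<^term>\<open>restrict_space borel K\<close> are the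
  Borel sets of the subspace topology. Regularity is not listed, since on a second countable
  locally compact Hausdorff space every Borel measure finite on compact sets is regular.\<close>

definition left_haar_measure ::
  "'a::{topological_group_add, t2_space, second_countable_topology} set \<Rightarrow> 'a measure \<Rightarrow> bool"
where
  "left_haar_measure K \<mu> \<longleftrightarrow>
     sets \<mu> = sets (restrict_space borel K) \<and>
     emeasure \<mu> K \<noteq> 0 \<and>
     (\<forall>C. compact C \<and> C \<subseteq> K \<longrightarrow> emeasure \<mu> C < \<infinity>) \<and>
     (\<forall>k\<in>K. \<forall>A\<in>sets \<mu>. emeasure \<mu> ((\<lambda>x. k + x) ` A) = emeasure \<mu> A)"

definition left_regular :: "'a::group_add \<Rightarrow> ('a \<Rightarrow> real) \<Rightarrow> 'a \<Rightarrow> real" where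
  "left_regular h f = (\<lambda>x. f (- h + x))"

section \<open>Almost invariant vectors\<close>

definition almost_has_invariant_vectors ::
  "'a::topological_space set \<Rightarrow> 'v::minus set \<Rightarrow> ('v \<Rightarrow> real) \<Rightarrow> ('a \<Rightarrow> 'v \<Rightarrow> 'v) \<Rightarrow> bool"
where
  "almost_has_invariant_vectors K V nrm \<alpha> \<longleftrightarrow>
     (\<forall>F. compact F \<and> F \<subseteq> K \<longrightarrow>
       (\<forall>\<epsilon>>0. \<exists>v\<in>V. nrm v = 1 \<and> (\<forall>g\<in>F. nrm (\<alpha> g v - v) \<le> \<epsilon>)))"

section \<open>Amenability\<close>

definition L_infinity :: "'a measure \<Rightarrow> ('a \<Rightarrow> real) set" where
  "L_infinity M = {f \<in> borel_measurable M. \<exists>C. AE x in M. \<bar>f x\<bar> \<le> C}"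

definition mean_on_L_infinity :: "'a measure \<Rightarrow> (('a \<Rightarrow> real) \<Rightarrow> real) \<Rightarrow> bool" where
  "mean_on_L_infinity M m \<longleftrightarrow>
     (\<forall>f\<in>L_infinity M. \<forall>g\<in>L_infinity M. (AE x in M. f x = g x) \<longrightarrow> m f = m g) \<and>
     (\<forall>f\<in>L_infinity M. \<forall>g\<in>L_infinity M. m (\<lambda>x. f x + g x) = m f + m g) \<and>
     (\<forall>c. \<forall>f\<in>L_infinity M. m (\<lambda>x. c * f x) = c * m f) \<and>
     (\<forall>f\<in>L_infinity M. (AE x in M. 0 \<le> f x) \<longrightarrow> 0 \<le> m f) \<and>
     m (\<lambda>x. 1) = 1"

text \<open>Left Haar measures of \<open>K\<close> being unique up to a positive factor, the space of essentially
  bounded functions and the means on it do not depend on the choice of \<open>\<mu>\<close>.\<close>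

definition amenable ::
  "'a::{topological_group_add, t2_space, second_countable_topology} set \<Rightarrow> bool"
where
  "amenable K \<longleftrightarrow>
     (\<exists>\<mu> m. left_haar_measure K \<mu> \<and> mean_on_L_infinity \<mu> m \<and>
        (\<forall>k\<in>K. \<forall>f\<in>L_infinity \<mu>. m (left_regular k f) = m f))"

end

theory Submission
  imports Defs "HOL-Library.Function_Algebras"
begin

text \<open>
  For an N-function, \<open>f \<mapsto> \<Phi> \<circ> f\<close> turns unit vectors of the Orlicz space into probability densities, and
  \<open>\<Delta>\<^sub>2\<close>-regularity makes this correspondence uniformly continuous in both directions. So almost
  invariant vectors exist iff there are densities \<open>\<phi>\<close> in \<open>L\<^sup>1(G)\<close> almost invariant under \<open>H\<close>.

  Given such densities, choose a Borel map \<open>\<sigma> : G \<rightarrow> H\<close> with \<open>\<sigma> (h + x) = h + \<sigma> x\<close>. Pushing a suitably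
  weighted Haar measure of \<open>G\<close> forward along \<open>\<sigma>\<close> gives a Haar measure on \<open>H\<close>, and an ultrafilter
  limit of \<open>u \<mapsto> \<integral> \<phi> (u \<circ> \<sigma>)\<close> is an invariant mean.

  Conversely, let \<open>\<theta>\<close> be a normalised indicator on \<open>H\<close>. The translates of \<open>\<theta> * \<phi>\<close> by \<open>h \<in> H\<close> are
  equicontinuous in \<open>h\<close>, uniformly in \<open>\<phi>\<close>, so invariance under a compact set reduces to a finite one. If
  it failed for all \<open>\<phi>\<close>, a functional would separate the displacements from \<open>0\<close>; evaluated on
  translates of one density and smoothed on the left by a second average \<open>e\<close>, it gives
  bounded continuous functions on \<open>H\<close> on which the mean contradicts the separation.
\<close>

subsection \<open>The Hahn-Banach theorem\<close>

text \<open>\<open>H\<close> may be a null set of the group, so neither side can simply restrict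
  functions to \<open>H\<close>. Functions on \<open>H\<close> reach the group by composition with
  the equivariant map, and functions on the group are averaged against a Haar measure of
  \<open>H\<close>. The main obstacle is that a mean is only finitely additive and invariant under
  single translations: it does not commute with integrals over \<open>H\<close>, and the separation
  argument handles only finitely many group elements. Hence integrals are replaced by finite sums
  with weights of total 1, on which invariance of the mean acts term by term. Smoothing is needed
  twice, for different variables. The average by \<theta> makes translates depend continuously on
  the translating element; the average by e makes the value of the functional depend continuously on
  the element h that moves the fixed density. In both cases the translation is shifted onto the
  kernel, so the only continuity to be proved is that of translating the indicator of a compact set
  in L1 of \<open>H\<close>. The bounds obtained this way involve a function on the group only
  through its norm, hence the uniformity.\<close>

definition sublinear :: "('v::real_vector \<Rightarrow> real) \<Rightarrow> bool" where
  "sublinear p \<longleftrightarrow> (\<forall>x y. p (x + y) \<le> p x + p y) \<and> (\<forall>c\<ge>0. \<forall>x. p (c *\<^sub>R x) = c * p x)"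

text \<open>An inequality for positive scalars is enough: applied to \<open>inverse c\<close> it
  gives the reverse one.\<close>

lemma sublinearI:
  assumes "\<And>x y. p (x + y) \<le> p x + p y" "\<And>c x. c > 0 \<Longrightarrow> p (c *\<^sub>R x) \<le> c * p x" "p 0 = 0"
  shows "sublinear p"
proof -
  have "p (c *\<^sub>R x) = c * p x" if "c \<ge> 0" for c x
  proof (cases "c = 0")
    case False
    with that have c: "c > 0" by simp
    have "p (inverse c *\<^sub>R (c *\<^sub>R x)) \<le> inverse c * p (c *\<^sub>R x)"
      using c by (intro assms(2)) simp
    then have "c * p x \<le> p (c *\<^sub>R x)" using c by (simp add: field_simps)
    with assms(2)[OF c, of x] show ?thesis by simp
  qed (simp add: assms(3))
  with assms(1) show ?thesis unfolding sublinear_def by blast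
qed

lemma sublinear_add: "sublinear p \<Longrightarrow> p (x + y) \<le> p x + p y"
  and sublinear_scale: "sublinear p \<Longrightarrow> c \<ge> 0 \<Longrightarrow> p (c *\<^sub>R x) = c * p x"
  by (auto simp: sublinear_def)

lemma sublinear_zero: "sublinear p \<Longrightarrow> p 0 = 0"
  using sublinear_scale[of p 0 0] by simp

lemma sublinear_ge: "sublinear p \<Longrightarrow> - p (- x) \<le> p x"
  using sublinear_add[of p x "- x"] sublinear_zero[of p] by simp

text \<open>The pointwise infimum of a chain of sublinear functionals below \<open>p\<close> is sublinear, and a
  minimal sublinear functional \<open>q\<close> is additive, because
  \<open>x \<mapsto> INF t\<ge>0. q (x + t y) - t q y\<close> is a sublinear functional below it.\<close>

lemma sublinear_dominates_linear:
  fixes p :: "'v::real_vector \<Rightarrow> real"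
  assumes p: "sublinear p"
  shows "\<exists>l. linear l \<and> (\<forall>x. l x \<le> p x)"
proof -
  define A where "A = {q. sublinear q \<and> (\<forall>x. q x \<le> p x)}"
  \<comment> \<open>The order is reversed, so the maximal element supplied by Zorn's lemma is a
    minimal sublinear functional.\<close>
  define R where "R = (\<lambda>q q' :: 'v \<Rightarrow> real. \<forall>x. q' x \<le> q x)"
  have "partial_order_on A (relation_of R A)"
    by (rule partial_order_on_relation_ofI)
      (auto simp: R_def intro: order_trans intro!: ext order_antisym)
  moreover have "\<exists>u\<in>A. \<forall>a\<in>C. R a u" if C: "C \<in> Chains (relation_of R A)" for C
  proof (cases "C = {}")
    case True
    then show ?thesis using p by (auto simp: A_def)
  next
    case False
    have CA: "C \<subseteq> A" and ch: "\<And>a b. a \<in> C \<Longrightarrow> b \<in> C \<Longrightarrow> R a b \<or> R b a"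
      using C by (auto simp: Chains_def relation_of_def)
    have low: "- p (- x) \<le> q x" if "q \<in> C" for q x
      using that CA sublinear_ge[of q x] by (auto simp: A_def subset_iff) (meson neg_le_iff_le order_trans)
    have bdd: "bdd_below ((\<lambda>q. q x) ` C)" for x
      using low by (auto intro!: bdd_belowI2[where m="- p (- x)"])
    define u where "u = (\<lambda>x. INF q\<in>C. q x)"
    have ule: "u x \<le> q x" if "q \<in> C" for q x
      unfolding u_def using bdd that by (intro cINF_lower) auto
    have uge: "c \<le> u x" if "\<And>q. q \<in> C \<Longrightarrow> c \<le> q x" for c x
      unfolding u_def using that False by (intro cINF_greatest) auto
    have "sublinear u"
    proof (rule sublinearI)
      fix x y
      \<comment> \<open>Two separate infima require \<open>q\<close> and \<open>q'\<close> to vary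
        independently; comparability in the chain supplies one \<open>r\<close> below both.\<close>
      have "u (x + y) - q' y \<le> q x" if q: "q \<in> C" "q' \<in> C" for q q'
      proof -
        obtain r where r: "r \<in> C" "r x \<le> q x" "r y \<le> q' y"
          using ch[OF q] q unfolding R_def by blast
        have "u (x + y) \<le> r x + r y"
          using ule[OF r(1), of "x + y"] r(1) CA sublinear_add[of r x y] by (auto simp: A_def)
        with r show ?thesis by simp
      qed
      then have "u (x + y) - q' y \<le> u x" if "q' \<in> C" for q'
        using that by (intro uge) auto
      then have "u (x + y) - u x \<le> q' y" if "q' \<in> C" for q'
        using that by (simp add: algebra_simps)
      then have "u (x + y) - u x \<le> u y" by (intro uge)
      then show "u (x + y) \<le> u x + u y" by simp
    next
      fix c :: real and x assume c: "c > 0"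
      have "u (c *\<^sub>R x) / c \<le> u x"
      proof (rule uge)
        fix q assume q: "q \<in> C"
        then have "q (c *\<^sub>R x) = c * q x" using CA c by (intro sublinear_scale) (auto simp: A_def)
        with ule[OF q, of "c *\<^sub>R x"] c show "u (c *\<^sub>R x) / c \<le> q x" by (simp add: field_simps)
      qed
      with c show "u (c *\<^sub>R x) \<le> c * u x" by (simp add: field_simps)
    next
      obtain q where q: "q \<in> C" using False by blast
      have "\<And>q. q \<in> C \<Longrightarrow> q 0 = 0" using CA by (auto simp: A_def intro: sublinear_zero)
      with uge[of 0 0] ule[OF q, of 0] q show "u 0 = 0" by fastforce
    qed
    moreover obtain q where "q \<in> C" using False by blast
    moreover have "u x \<le> p x" for x using ule[OF \<open>q \<in> C\<close>, of x] \<open>q \<in> C\<close> CA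
      by (auto simp: A_def subset_iff intro: order_trans)
    ultimately show ?thesis using ule by (intro bexI[of _ u]) (auto simp: A_def R_def)
  qed
  ultimately obtain q where q: "q \<in> A" and qmin: "\<And>a. a \<in> A \<Longrightarrow> R q a \<Longrightarrow> a = q"
    using predicate_Zorn[of A R] by blast
  have sq: "sublinear q" and qp: "\<And>x. q x \<le> p x" using q by (auto simp: A_def)
  have add: "q (x + y) = q x + q y" for x y
  proof -
    define r where "r = (\<lambda>x. INF t\<in>{0..}. q (x + t *\<^sub>R y) - t * q y)"
    have low: "- q (- x) \<le> q (x + t *\<^sub>R y) - t * q y" if "t \<ge> 0" for t x
      using sublinear_add[OF sq, of "x + t *\<^sub>R y" "- x"] sublinear_scale[OF sq that, of y] by simp
    have rle: "r x \<le> q (x + t *\<^sub>R y) - t * q y" if "t \<ge> 0" for t x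
      unfolding r_def using that low by (intro cINF_lower bdd_belowI2[where m="- q (- x)"]) auto
    have rge: "c \<le> r x" if "\<And>t. t \<ge> 0 \<Longrightarrow> c \<le> q (x + t *\<^sub>R y) - t * q y" for c x
      unfolding r_def using that by (intro cINF_greatest) auto
    have rq: "r x \<le> q x" for x using rle[of 0 x] by simp
    have "sublinear r"
    proof (rule sublinearI)
      fix x z
      have "r (x + z) - (q (z + s *\<^sub>R y) - s * q y) \<le> q (x + t *\<^sub>R y) - t * q y"
        if "t \<ge> 0" "s \<ge> 0" for s t
        using rle[of "t + s" "x + z"] that sublinear_add[OF sq, of "x + t *\<^sub>R y" "z + s *\<^sub>R y"]
        by (simp add: algebra_simps)
      then have "r (x + z) - (q (z + s *\<^sub>R y) - s * q y) \<le> r x" if "s \<ge> 0" for s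
        using that by (intro rge)
      then have "r (x + z) - r x \<le> r z" by (intro rge) (simp add: algebra_simps)
      then show "r (x + z) \<le> r x + r z" by simp
    next
      fix c :: real and x assume c: "c > 0"
      have "r (c *\<^sub>R x) / c \<le> r x"
      proof (rule rge)
        fix t :: real assume t: "t \<ge> 0"
        have "r (c *\<^sub>R x) \<le> q (c *\<^sub>R (x + t *\<^sub>R y)) - c * t * q y"
          using rle[of "c * t" "c *\<^sub>R x"] t c by (simp add: scaleR_add_right)
        also have "q (c *\<^sub>R (x + t *\<^sub>R y)) = c * q (x + t *\<^sub>R y)"
          using c by (intro sublinear_scale[OF sq]) simp
        finally show "r (c *\<^sub>R x) / c \<le> q (x + t *\<^sub>R y) - t * q y" using c by (simp add: field_simps)
      qed
      with c show "r (c *\<^sub>R x) \<le> c * r x" by (simp add: field_simps)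
    next
      have "0 \<le> r 0" using low[of _ 0] sublinear_zero[OF sq] by (intro rge) simp
      with rq[of 0] sublinear_zero[OF sq] show "r 0 = 0" by simp
    qed
    then have "r = q" using rq qp by (intro qmin) (auto simp: A_def R_def intro: order_trans)
    with rle[of 1 x] sublinear_add[OF sq, of x y] show ?thesis by simp
  qed
  have neg: "q (- x) = - q x" for x using add[of x "- x"] sublinear_zero[OF sq] by simp
  have "linear q"
  proof (rule linearI)
    fix c :: real and x
    show "q (c *\<^sub>R x) = c *\<^sub>R q x"
    proof (cases "c \<ge> 0")
      case False
      then have "q ((- c) *\<^sub>R x) = (- c) * q x" by (intro sublinear_scale[OF sq]) simp
      with neg[of "c *\<^sub>R x"] show ?thesis by simp
    qed (simp add: sublinear_scale[OF sq])
  qed (rule add)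
  with qp show ?thesis by blast
qed

text \<open>Let \<open>p x\<close> be the infimum of N (x + t c) - t \<delta> over t \<ge> 0 and c
  in \<open>C\<close>. It is sublinear because \<open>C\<close> is convex, and finite because the
  seminorm is at least \<delta> on \<open>C\<close>. A linear \<open>l\<close> below
  \<open>p\<close> satisfies l (- c) \<le> N 0 - \<delta> = - \<delta>. The seminorm laws are asked
  for on \<open>X\<close> only, since an integral norm violates them on functions that are not
  integrable.\<close>

lemma seminorm_separation:
  fixes C :: "'v::real_vector set"
  assumes X: "subspace X"
    and tri: "\<And>x y. x \<in> X \<Longrightarrow> y \<in> X \<Longrightarrow> nrm (x + y) \<le> nrm x + nrm y"
    and hom: "\<And>c x. x \<in> X \<Longrightarrow> nrm (c *\<^sub>R x) = \<bar>c\<bar> * nrm x"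
    and C: "convex C" "C \<noteq> {}" "C \<subseteq> X" and ge: "\<And>x. x \<in> C \<Longrightarrow> \<delta> \<le> nrm x"
  shows "\<exists>l. linear l \<and> (\<forall>x\<in>X. l x \<le> nrm x) \<and> (\<forall>x\<in>C. \<delta> \<le> l x)"
proof -
  \<comment> \<open>A linear projection onto \<open>X\<close> extends the seminorm to the whole
    space.\<close>
  obtain \<pi> :: "'v \<Rightarrow> 'v" where \<pi>: "range \<pi> \<subseteq> X" "linear \<pi>" "\<And>v. v \<in> X \<Longrightarrow> \<pi> v = v"
    using real_vector.linear_exists_left_inverse_on[of id X] X linear_id
    by (auto simp: linear_def)
  define N where "N = (\<lambda>x. nrm (\<pi> x))"
  have Ntri: "N (x + y) \<le> N x + N y" for x y
    unfolding N_def linear_add[OF \<pi>(2)] using \<pi>(1) by (intro tri) auto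
  have Nhom: "N (c *\<^sub>R x) = \<bar>c\<bar> * N x" for c x
    unfolding N_def linear_scale[OF \<pi>(2)] using \<pi>(1) by (intro hom) auto
  have N0: "N 0 = 0" using Nhom[of 0 0] by simp
  have Nneg: "N (- x) = N x" for x using Nhom[of "-1" x] by simp
  define p where "p = (\<lambda>x. INF (t, c)\<in>{0..} \<times> C. N (x + t *\<^sub>R c) - t * \<delta>)"
  have low: "- N x \<le> N (x + t *\<^sub>R c) - t * \<delta>" if "t \<ge> 0" "c \<in> C" for t c x
  proof -
    have "t * \<delta> \<le> t * N c" using that ge C(3) \<pi>(3) by (intro mult_left_mono) (auto simp: N_def)
    also have "\<dots> = N (t *\<^sub>R c)" using that by (simp add: Nhom)
    also have "\<dots> \<le> N (x + t *\<^sub>R c) + N x" using Ntri[of "x + t *\<^sub>R c" "- x"] by (simp add: Nneg)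
    finally show ?thesis by simp
  qed
  have ple: "p x \<le> N (x + t *\<^sub>R c) - t * \<delta>" if "t \<ge> 0" "c \<in> C" for t c x
    unfolding p_def using that low
    by (intro cINF_lower2[where x="(t, c)"] bdd_belowI2[where m="- N x"]) auto
  have pge: "a \<le> p x" if "\<And>t c. t \<ge> 0 \<Longrightarrow> c \<in> C \<Longrightarrow> a \<le> N (x + t *\<^sub>R c) - t * \<delta>" for a x
    unfolding p_def using that C(2) by (intro cINF_greatest) auto
  obtain c0 where c0: "c0 \<in> C" using C(2) by blast
  have pN: "p x \<le> N x" for x using ple[of 0 c0 x] c0 by simp
  have "sublinear p"
  proof (rule sublinearI)
    fix x z
    have *: "p (x + z) - (N (z + s *\<^sub>R d) - s * \<delta>) \<le> N (x + t *\<^sub>R c) - t * \<delta>"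
      if "t \<ge> 0" "s \<ge> 0" "c \<in> C" "d \<in> C" for s t c d
    proof (cases "t + s = 0")
      case True
      with that have "t = 0" "s = 0" by auto
      then show ?thesis using pN[of "x + z"] Ntri[of x z] by simp
    next
      case False
      \<comment> \<open>By convexity t c + s d is (t + s) e with \<open>e\<close> in
        \<open>C\<close>; this normalisation fails only for t + s = 0.\<close>
      define e where "e = (t / (t + s)) *\<^sub>R c + (s / (t + s)) *\<^sub>R d"
      have e: "e \<in> C" unfolding e_def using that False
        by (intro convexD[OF C(1)]) (auto simp: add_divide_distrib[symmetric])
      have te: "(t + s) *\<^sub>R e = t *\<^sub>R c + s *\<^sub>R d"
        unfolding e_def using False by (simp add: scaleR_add_right)
      have "p (x + z) \<le> N ((x + t *\<^sub>R c) + (z + s *\<^sub>R d)) - (t + s) * \<delta>"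
        using ple[of "t + s" e "x + z"] that e unfolding te by (simp add: algebra_simps)
      also have "\<dots> \<le> N (x + t *\<^sub>R c) + N (z + s *\<^sub>R d) - (t + s) * \<delta>"
        using Ntri by simp
      finally show ?thesis by (simp add: algebra_simps)
    qed
    have "p (x + z) - (N (z + s *\<^sub>R d) - s * \<delta>) \<le> p x" if "s \<ge> 0" "d \<in> C" for s d
      using that * by (intro pge) auto
    then have "p (x + z) - p x \<le> p z" by (intro pge) (simp add: algebra_simps)
    then show "p (x + z) \<le> p x + p z" by simp
  next
    fix a :: real and x assume a: "a > 0"
    have "p (a *\<^sub>R x) / a \<le> p x"
    proof (rule pge)
      fix t :: real and c assume t: "t \<ge> 0" and c: "c \<in> C"
      have "p (a *\<^sub>R x) \<le> N (a *\<^sub>R (x + t *\<^sub>R c)) - a * t * \<delta>"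
        using ple[of "a * t" c "a *\<^sub>R x"] t c a by (simp add: scaleR_add_right)
      also have "N (a *\<^sub>R (x + t *\<^sub>R c)) = a * N (x + t *\<^sub>R c)" using a by (simp add: Nhom)
      finally show "p (a *\<^sub>R x) / a \<le> N (x + t *\<^sub>R c) - t * \<delta>" using a by (simp add: field_simps)
    qed
    with a show "p (a *\<^sub>R x) \<le> a * p x" by (simp add: field_simps)
  next
    have "0 \<le> p 0" using low[of _ _ 0] N0 by (intro pge) auto
    with pN[of 0] N0 show "p 0 = 0" by simp
  qed
  then obtain l where l: "linear l" "\<And>x. l x \<le> p x"
    using sublinear_dominates_linear by blast
  have "l x \<le> nrm x" if "x \<in> X" for x
    using order_trans[OF l(2) pN, of x] \<pi>(3)[OF that] by (simp add: N_def)
  moreover have "\<delta> \<le> l c" if "c \<in> C" for c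
    using order_trans[OF l(2)[of "- c"] ple[of 1 c "- c"]] that linear_neg[OF l(1), of c] N0 by simp
  ultimately show ?thesis using l(1) by blast
qed

text \<open>Makes tuples of functions indexed by group elements a real vector space, as the
  separation argument requires.\<close>

instantiation "fun" :: (type, real_vector) real_vector
begin

definition scaleR_fun_def: "c *\<^sub>R f = (\<lambda>x. c *\<^sub>R f x)"

instance
  by standard (simp_all add: scaleR_fun_def fun_eq_iff scaleR_add_right scaleR_add_left)

end

subsection \<open>Orlicz spaces\<close>

locale N_fun =
  fixes \<Phi> :: "real \<Rightarrow> real"
  assumes N: "N_function \<Phi>"
begin

lemma even: "\<Phi> (- x) = \<Phi> x"
  and convex: "convex_on UNIV \<Phi>"
  and eq_0_iff: "\<Phi> x = 0 \<longleftrightarrow> x = 0"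
  using N by (auto simp: N_function_def)

lemma abs: "\<Phi> \<bar>x\<bar> = \<Phi> x"
  by (cases "x \<ge> 0") (auto simp: even)

lemma convexD': "0 \<le> t \<Longrightarrow> t \<le> 1 \<Longrightarrow> \<Phi> ((1 - t) * x + t * y) \<le> (1 - t) * \<Phi> x + t * \<Phi> y"
  using convex_onD[OF convex, of t x y] by simp

lemma zero [simp]: "\<Phi> 0 = 0"
  by (simp add: eq_0_iff)

lemma nonneg [simp]: "0 \<le> \<Phi> x"
  using convexD'[of "1/2" x "- x"] by (simp add: even)

lemma pos: "x \<noteq> 0 \<Longrightarrow> 0 < \<Phi> x"
  using nonneg[of x] eq_0_iff[of x] by linarith

lemma scale: "0 \<le> c \<Longrightarrow> c \<le> 1 \<Longrightarrow> \<Phi> (c * x) \<le> c * \<Phi> x"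
  using convexD'[of c 0 x] by simp

lemma mono: assumes "\<bar>x\<bar> \<le> \<bar>y\<bar>" shows "\<Phi> x \<le> \<Phi> y"
proof (cases "y = 0")
  case False
  have "\<Phi> x = \<Phi> (\<bar>x\<bar> / \<bar>y\<bar> * \<bar>y\<bar>)" using False by (simp add: abs)
  also have "\<dots> \<le> \<bar>x\<bar> / \<bar>y\<bar> * \<Phi> \<bar>y\<bar>" using assms False by (intro scale) auto
  also have "\<dots> \<le> 1 * \<Phi> \<bar>y\<bar>" using assms False by (intro mult_right_mono) auto
  finally show ?thesis by (simp add: abs)
qed (use assms in simp)

text \<open>Convexity with \<Phi> 0 = 0 bounds \<Phi> x and \<Phi> y by their proportional shares of
  \<Phi> (x + y). The monotonicity and the contraction property of the inverse below rest on
  this.\<close>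

lemma superadditive: assumes "0 \<le> x" "0 \<le> y" shows "\<Phi> x + \<Phi> y \<le> \<Phi> (x + y)"
proof (cases "x + y = 0")
  case True
  with assms have "x = 0" "y = 0" by auto
  then show ?thesis by simp
next
  case False
  have "\<Phi> x \<le> x / (x + y) * \<Phi> (x + y)"
    using scale[of "x / (x + y)" "x + y"] assms False by simp
  moreover have "\<Phi> y \<le> y / (x + y) * \<Phi> (x + y)"
    using scale[of "y / (x + y)" "x + y"] assms False by simp
  moreover have "x / (x + y) * \<Phi> (x + y) + y / (x + y) * \<Phi> (x + y) = \<Phi> (x + y)"
    using False by (simp flip: distrib_right add_divide_distrib)
  ultimately show ?thesis by linarith
qed

lemma continuous: "continuous_on UNIV \<Phi>"
  using convex by (intro convex_on_continuous) auto

lemma measurable [measurable (raw)]: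
  "f \<in> borel_measurable M \<Longrightarrow> (\<lambda>x. \<Phi> (f x)) \<in> borel_measurable M"
  by (rule borel_measurable_continuous_on[OF continuous])

lemma unbounded: obtains x where "0 < x" "y \<le> \<Phi> x"
proof -
  have "filterlim (\<lambda>x. \<Phi> x / x) at_top at_top" using N by (simp add: N_function_def)
  then have "eventually (\<lambda>x. 1 \<le> \<Phi> x / x) at_top" by (simp add: filterlim_at_top)
  then have "eventually (\<lambda>x. 1 \<le> \<Phi> x / x \<and> x \<ge> max 1 y) at_top"
    using eventually_ge_at_top by (rule eventually_conj)
  then obtain x where x: "1 \<le> \<Phi> x / x" "x \<ge> 1" "x \<ge> y"
    by (auto dest!: eventually_happens simp: trivial_limit_at_top_linorder)
  then show thesis by (intro that[of x]) (auto simp: field_simps)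
qed

text \<open>Since \<open>b + d = (1 - t) (b / (1 - t)) + t (d / t)\<close>, convexity controls \<open>\<Phi> (b + d)\<close>.\<close>

lemma abs_diff_le:
  assumes t: "0 < t" "t \<le> 1/2"
  shows "\<bar>\<Phi> a - \<Phi> b\<bar> \<le> 2 * t * (\<Phi> (2 * a) + \<Phi> (2 * b)) + t * \<Phi> ((a - b) / t)"
proof -
  have *: "\<Phi> a - \<Phi> b \<le> 2 * t * (\<Phi> (2 * a) + \<Phi> (2 * b)) + t * \<Phi> ((a - b) / t)" for a b
  proof -
    \<comment> \<open>Writing b / (1 - t) as (1 + r) b places it between b and 2 b, so that no
      argument beyond 2 b enters; t \<le> 1/2 gives r \<le> 2 t.\<close>
    define r where "r = t / (1 - t)"
    have r: "0 \<le> r" "r \<le> 1" "r \<le> 2 * t" using t by (auto simp: r_def field_simps)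
    have "1 + r = 1 / (1 - t)" using t by (simp add: r_def field_simps)
    then have "b / (1 - t) = (1 + r) * b" by simp
    then have r1: "b / (1 - t) = (1 - r) * b + r * (2 * b)" by (simp add: algebra_simps)
    have "a = (1 - t) * (b / (1 - t)) + t * ((a - b) / t)" using t by simp
    then have "\<Phi> a \<le> (1 - t) * \<Phi> (b / (1 - t)) + t * \<Phi> ((a - b) / t)"
      using convexD'[of t "b / (1 - t)" "(a - b) / t"] t by simp
    also have "(1 - t) * \<Phi> (b / (1 - t)) \<le> 1 * \<Phi> (b / (1 - t))"
      using t by (intro mult_right_mono) auto
    also have "1 * \<Phi> (b / (1 - t)) \<le> (1 - r) * \<Phi> b + r * \<Phi> (2 * b)"
      unfolding r1 mult_1 using r by (intro convexD')
    also have "\<dots> \<le> \<Phi> b + 2 * t * (\<Phi> (2 * a) + \<Phi> (2 * b))"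
    proof -
      have "(1 - r) * \<Phi> b \<le> 1 * \<Phi> b" using r by (intro mult_right_mono) auto
      moreover have "r * \<Phi> (2 * b) \<le> 2 * t * \<Phi> (2 * b)" using r by (intro mult_right_mono) auto
      moreover have "0 \<le> 2 * t * \<Phi> (2 * a)" using t by simp
      ultimately show ?thesis unfolding distrib_left by linarith
    qed
    finally show ?thesis by simp
  qed
  have "(b - a) / t = - ((a - b) / t)" by (metis minus_diff_eq minus_divide_left)
  then have "\<Phi> ((b - a) / t) = \<Phi> ((a - b) / t)" using even by metis
  with *[of a b] *[of b a] show ?thesis by (simp add: abs_le_iff algebra_simps)
qed

lemma one_plus_scale: "0 \<le> r \<Longrightarrow> r \<le> 1 \<Longrightarrow> \<Phi> ((1 + r) * x) \<le> \<Phi> x + r * \<Phi> (2 * x)"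
proof -
  assume r: "0 \<le> r" "r \<le> 1"
  have "(1 + r) * x = (1 - r) * x + r * (2 * x)" by (simp add: algebra_simps)
  then have "\<Phi> ((1 + r) * x) \<le> (1 - r) * \<Phi> x + r * \<Phi> (2 * x)" using convexD'[OF r] by simp
  moreover have "(1 - r) * \<Phi> x \<le> 1 * \<Phi> x" using r by (intro mult_right_mono) auto
  ultimately show ?thesis by simp
qed

lemma inverse:
  obtains \<Psi> where "mono \<Psi>" "\<And>y. 0 \<le> y \<Longrightarrow> 0 \<le> \<Psi> y" "\<And>y. 0 \<le> y \<Longrightarrow> \<Phi> (\<Psi> y) = y"
proof -
  have ex: "\<exists>x\<ge>0. \<Phi> x = y" if y: "y \<ge> 0" for y
  proof -
    obtain b where b: "0 < b" "y \<le> \<Phi> b" by (rule unbounded)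
    have "\<exists>x. 0 \<le> x \<and> x \<le> b \<and> \<Phi> x = y"
      using b y continuous_on_subset[OF continuous] by (intro IVT') auto
    then show ?thesis by blast
  qed
  then obtain g where g: "\<And>y. y \<ge> 0 \<Longrightarrow> 0 \<le> g y \<and> \<Phi> (g y) = y" by metis
  \<comment> \<open>Clipping at 0 makes \<open>\<Psi>\<close> monotone on the whole line, hence
    Borel measurable.\<close>
  define \<Psi> where "\<Psi> = (\<lambda>y. g (max 0 y))"
  have P: "0 \<le> \<Psi> y" "\<Phi> (\<Psi> y) = max 0 y" for y using g[of "max 0 y"] by (auto simp: \<Psi>_def)
  have "\<Psi> a \<le> \<Psi> b" if "a \<le> b" for a b
  proof (rule ccontr)
    assume n: "\<not> \<Psi> a \<le> \<Psi> b"
    have "\<Phi> (\<Psi> b) + \<Phi> (\<Psi> a - \<Psi> b) \<le> \<Phi> (\<Psi> b + (\<Psi> a - \<Psi> b))"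
      using P(1)[of b] n by (intro superadditive) linarith+
    moreover have "0 < \<Phi> (\<Psi> a - \<Psi> b)" using n by (intro pos) linarith
    ultimately have "\<Phi> (\<Psi> b) < \<Phi> (\<Psi> a)" by simp
    with that show False by (auto simp: P)
  qed
  then have "mono \<Psi>" by (rule monoI)
  with P show thesis by (intro that[of \<Psi>]) auto
qed

text \<open>Superadditivity for \<Psi> a = \<Psi> b + (\<Psi> a - \<Psi> b). Integrated, it bounds
  the modular of a difference of vectors by the L1 distance of their densities.\<close>

lemma inverse_diff:
  assumes mono: "mono \<Psi>" and \<Psi>: "\<And>y. 0 \<le> y \<Longrightarrow> 0 \<le> \<Psi> y" "\<And>y. 0 \<le> y \<Longrightarrow> \<Phi> (\<Psi> y) = y"
    and a: "0 \<le> a" "0 \<le> b"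
  shows "\<Phi> (\<Psi> a - \<Psi> b) \<le> \<bar>a - b\<bar>"
proof -
  have *: "\<Phi> (\<Psi> a - \<Psi> b) \<le> a - b" if "b \<le> a" "0 \<le> b" for a b
    using superadditive[of "\<Psi> b" "\<Psi> a - \<Psi> b"] that monoD[OF mono that(1)] \<Psi> by simp
  show ?thesis
  proof (cases "b \<le> a")
    case False
    then have "\<Phi> (\<Psi> b - \<Psi> a) \<le> b - a" using *[of a b] a by simp
    then show ?thesis using even[of "\<Psi> b - \<Psi> a"] False by simp
  qed (use * a in auto)
qed

text \<open>Growth is asked for along the orbit x, 2 x, 4 x, ... only, so that a condition near
  infinity or near 0 can meet it.\<close>

lemma iterate_doubling:
  assumes "\<And>k. k < n \<Longrightarrow> \<Phi> (2 * (2 ^ k * x)) \<le> K * \<Phi> (2 ^ k * x)" "0 \<le> K"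
  shows "\<Phi> (2 ^ n * x) \<le> K ^ n * \<Phi> x"
  using assms
proof (induction n)
  case (Suc n)
  have "\<Phi> (2 ^ Suc n * x) \<le> K * \<Phi> (2 ^ n * x)" using Suc.prems(1)[of n] by (simp add: mult.assoc)
  also have "\<dots> \<le> K * (K ^ n * \<Phi> x)" using Suc by (intro mult_left_mono) auto
  finally show ?case by (simp add: mult.assoc)
qed simp

text \<open>Covers the compact range of |x| that a growth condition at infinity or at 0 does not
  reach.\<close>

lemma bounded_ratio:
  assumes "0 < a" "a \<le> \<bar>x\<bar>" "\<bar>x\<bar> \<le> b"
  shows "\<Phi> (A * x) \<le> \<Phi> (A * b) / \<Phi> a * \<Phi> x"
proof -
  have "\<Phi> (A * x) \<le> \<Phi> (A * b)" using assms by (intro mono) (auto simp: abs_mult mult_left_mono)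
  moreover have "1 \<le> \<Phi> x / \<Phi> a" using assms mono[of a x] pos[of a] by auto
  ultimately have "\<Phi> (A * x) * 1 \<le> \<Phi> (A * b) * (\<Phi> x / \<Phi> a)" by (intro mult_mono) auto
  then show ?thesis by simp
qed

end

section \<open>The modular under the growth condition\<close>

locale orlicz = N_fun \<Phi> for \<Phi> :: "real \<Rightarrow> real" +
  fixes M :: "'a measure"
  assumes regular: "Delta2_regular M \<Phi>"
begin

abbreviation modular :: "('a \<Rightarrow> real) \<Rightarrow> ennreal" where "modular \<equiv> orlicz_modular M \<Phi>"

lemma modular_mono:
  assumes "\<And>x. x \<in> space M \<Longrightarrow> \<bar>f x\<bar> \<le> \<bar>g x\<bar>" shows "modular f \<le> modular g"
  unfolding orlicz_modular_def using assms by (intro nn_integral_mono ennreal_leI mono)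

lemma modular_scale:
  assumes "0 \<le> c" "c \<le> 1" and [measurable]: "f \<in> borel_measurable M"
  shows "modular (\<lambda>x. c * f x) \<le> ennreal c * modular f"
proof -
  have "modular (\<lambda>x. c * f x) \<le> (\<integral>\<^sup>+ x. ennreal c * ennreal (\<Phi> (f x)) \<partial>M)"
    unfolding orlicz_modular_def using assms
    by (intro nn_integral_mono) (auto simp: ennreal_mult[symmetric] intro!: ennreal_leI scale)
  also have "\<dots> = ennreal c * modular f"
    unfolding orlicz_modular_def by (intro nn_integral_cmult) auto
  finally show ?thesis .
qed

text \<open>The three cases of \<open>\<Delta>\<^sub>2\<close>-regularity enter only through the following estimate. The additive
  error absorbs the region where a function on a space of finite measure is small.\<close>

lemma Delta2_pointwise:
  assumes A: "0 < A" and \<eta>: "0 < \<eta>"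
  obtains K c where "0 \<le> K" "0 \<le> c" "ennreal c * emeasure M (space M) \<le> ennreal \<eta>"
    "\<And>f x. f \<in> borel_measurable M \<Longrightarrow> modular f \<le> 1 \<Longrightarrow> x \<in> space M \<Longrightarrow>
      \<Phi> (A * f x) \<le> K * \<Phi> (f x) + c"
proof -
  obtain n where "A < 2 ^ n" using real_arch_pow[of 2 A] by auto
  then have n: "A \<le> 2 ^ n" by simp
  have An: "\<Phi> (A * x) \<le> \<Phi> (2 ^ n * \<bar>x\<bar>)" for x
    using n A by (intro mono) (auto simp: abs_mult intro!: mult_right_mono)
  from regular consider
      "emeasure M (space M) < \<infinity>" "Delta2_infinity \<Phi>"
    | "Delta2 \<Phi>" | "M = count_space (space M)" "Delta2_zero \<Phi>"
    unfolding Delta2_regular_def by blast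
  then show thesis
  proof cases
    case 1
    obtain x0 K where K: "0 < x0" "2 < K" "\<And>x. x0 \<le> x \<Longrightarrow> \<Phi> (2 * x) \<le> K * \<Phi> x"
      using 1(2) unfolding Delta2_infinity_def by blast
    define m where "m = measure M (space M)"
    have m: "emeasure M (space M) = ennreal m" "0 \<le> m"
      using 1(1) by (auto simp: m_def emeasure_eq_ennreal_measure)
    \<comment> \<open>Since \<Phi> s \<le> s \<Phi> 1 by convexity, this choice makes the additive
      constant \<Phi> s times the total mass at most \<open>\<eta>\<close>.\<close>
    define s where "s = min 1 (\<eta> / ((m + 1) * (\<Phi> 1 + 1)))"
    have s: "0 < s" "s \<le> 1" using \<eta> m(2) by (auto simp: s_def add_nonneg_pos)
    have "\<Phi> s * m \<le> (s * \<Phi> 1) * m" using scale[of s 1] s m by (intro mult_right_mono) auto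
    also have "\<dots> \<le> s * ((m + 1) * (\<Phi> 1 + 1))"
      using s m(2) nonneg[of 1] by (simp add: algebra_simps)
    also have "\<dots> \<le> (\<eta> / ((m + 1) * (\<Phi> 1 + 1))) * ((m + 1) * (\<Phi> 1 + 1))"
      using m(2) by (intro mult_right_mono) (auto simp: s_def)
    also have "\<dots> = \<eta>"
    proof -
      have "(m + 1) * (\<Phi> 1 + 1) \<noteq> 0" using m(2) nonneg[of 1] by (auto simp: add_nonneg_eq_0_iff)
      then show ?thesis by simp
    qed
    finally have c: "\<Phi> s * m \<le> \<eta>" .
    \<comment> \<open>Three ranges arise: up to \<open>x1\<close> the additive constant \<Phi> s
      suffices, from \<open>x0\<close> on the growth condition can be iterated, and in between the
      ratio is bounded.\<close>
    define x1 where "x1 = s / A"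
    have x1: "0 < x1" using s A by (simp add: x1_def)
    define K' where "K' = K ^ n + \<Phi> (A * x0) / \<Phi> x1"
    have K': "K ^ n \<le> K'" "\<Phi> (A * x0) / \<Phi> x1 \<le> K'" "0 \<le> K'" using K by (auto simp: K'_def)
    have pt: "\<Phi> (A * x) \<le> K' * \<Phi> x + \<Phi> s" for x
    proof -
      consider "\<bar>x\<bar> \<le> x1" | "x1 \<le> \<bar>x\<bar>" "\<bar>x\<bar> \<le> x0" | "x0 \<le> \<bar>x\<bar>" by linarith
      then show ?thesis
      proof cases
        case 1
        then have "\<Phi> (A * x) \<le> \<Phi> s"
          using A s by (intro mono) (auto simp: x1_def abs_mult field_simps)
        moreover have "0 \<le> K' * \<Phi> x" using K' by simp
        ultimately show ?thesis by simp
      next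
        case 2
        have "\<Phi> (A * x) \<le> \<Phi> (A * x0) / \<Phi> x1 * \<Phi> x" using x1 2 by (intro bounded_ratio)
        also have "\<dots> \<le> K' * \<Phi> x" using K' by (intro mult_right_mono) auto
        finally show ?thesis using nonneg[of s] by linarith
      next
        case 3
        have "\<Phi> (2 ^ n * \<bar>x\<bar>) \<le> K ^ n * \<Phi> \<bar>x\<bar>"
        proof (rule iterate_doubling)
          fix k
          have "1 * \<bar>x\<bar> \<le> 2 ^ k * \<bar>x\<bar>" by (intro mult_right_mono) auto
          then show "\<Phi> (2 * (2 ^ k * \<bar>x\<bar>)) \<le> K * \<Phi> (2 ^ k * \<bar>x\<bar>)" using 3 by (intro K(3)) linarith
        qed (use K in auto)
        also have "\<dots> \<le> K' * \<Phi> \<bar>x\<bar>" using K' by (intro mult_right_mono) auto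
        finally show ?thesis using An[of x] nonneg[of s] unfolding abs by linarith
      qed
    qed
    show thesis using K'(3) c m(2) pt
      by (intro that[of K' "\<Phi> s"]) (auto simp: m(1) ennreal_mult[symmetric] intro!: ennreal_leI)
  next
    case 2
    then obtain K where K: "2 < K" "\<And>x. 0 \<le> x \<Longrightarrow> \<Phi> (2 * x) \<le> K * \<Phi> x"
      unfolding Delta2_def by blast
    have "\<Phi> (A * x) \<le> K ^ n * \<Phi> x" for x
    proof -
      have "\<Phi> (2 ^ n * \<bar>x\<bar>) \<le> K ^ n * \<Phi> \<bar>x\<bar>"
        using K by (intro iterate_doubling) auto
      with An[of x] show ?thesis unfolding abs by linarith
    qed
    then show thesis using K by (intro that[of "K ^ n" 0]) auto
  next
    case 3
    obtain x0 K where K: "0 < x0" "2 < K" "\<And>x. 0 \<le> x \<Longrightarrow> x \<le> x0 \<Longrightarrow> \<Phi> (2 * x) \<le> K * \<Phi> x"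
      using 3(2) unfolding Delta2_zero_def by blast
    \<comment> \<open>Under counting measure every point has mass 1, so a modular of at most 1
      forces \<Phi> (f x) \<le> 1 < \<Phi> b, hence |f x| \<le> b, at every point.\<close>
    obtain b where b: "0 < b" "2 \<le> \<Phi> b" by (rule unbounded)
    \<comment> \<open>Below \<open>a\<close> all \<open>n\<close> doublings stay within the range of
      the growth condition at 0.\<close>
    define a where "a = x0 / 2 ^ n"
    have a: "0 < a" using K by (simp add: a_def)
    define K' where "K' = K ^ n + \<Phi> (A * b) / \<Phi> a"
    have K': "K ^ n \<le> K'" "\<Phi> (A * b) / \<Phi> a \<le> K'" "0 \<le> K'" using K by (auto simp: K'_def)
    have pt: "\<Phi> (A * x) \<le> K' * \<Phi> x" if "\<bar>x\<bar> \<le> b" for x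
    proof (cases "a \<le> \<bar>x\<bar>")
      case True
      have "\<Phi> (A * x) \<le> \<Phi> (A * b) / \<Phi> a * \<Phi> x" using a True that by (intro bounded_ratio)
      also have "\<dots> \<le> K' * \<Phi> x" using K' by (intro mult_right_mono) auto
      finally show ?thesis .
    next
      case False
      have "\<Phi> (2 ^ n * \<bar>x\<bar>) \<le> K ^ n * \<Phi> \<bar>x\<bar>"
      proof (rule iterate_doubling)
        fix k assume "k < n"
        then have "2 ^ k * \<bar>x\<bar> \<le> 2 ^ n * \<bar>x\<bar>" by (intro mult_right_mono power_increasing) auto
        also have "\<dots> \<le> 2 ^ n * a" using False by (intro mult_left_mono) auto
        also have "\<dots> = x0" by (simp add: a_def)
        finally show "\<Phi> (2 * (2 ^ k * \<bar>x\<bar>)) \<le> K * \<Phi> (2 ^ k * \<bar>x\<bar>)" by (intro K(3)) auto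
      qed (use K in auto)
      also have "\<dots> \<le> K' * \<Phi> \<bar>x\<bar>" using K' by (intro mult_right_mono) auto
      finally show ?thesis using An[of x] unfolding abs by linarith
    qed
    have bd: "\<bar>f x\<bar> \<le> b" if "modular f \<le> 1" "x \<in> space M" for f x
    proof (rule ccontr)
      assume "\<not> \<bar>f x\<bar> \<le> b"
      then have "2 \<le> \<Phi> (f x)" using mono[of b "f x"] b by auto
      then have "2 \<le> ennreal (\<Phi> (f x))" using ennreal_leI by fastforce
      also have "\<dots> = (\<integral>\<^sup>+ y. ennreal (\<Phi> (f x)) * indicator {x} y \<partial>count_space (space M))"
        using that by (simp add: nn_integral_cmult_indicator)
      also have "\<dots> \<le> (\<integral>\<^sup>+ y. ennreal (\<Phi> (f y)) \<partial>count_space (space M))"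
        by (intro nn_integral_mono) (auto simp: indicator_def)
      also have "\<dots> = modular f" unfolding orlicz_modular_def by (subst (2) 3(1)) simp
      also have "\<dots> \<le> 1" by fact
      finally show False by simp
    qed
    show thesis using K' pt bd by (intro that[of K' 0]) auto
  qed
qed

lemma Delta2_modular:
  assumes A: "0 < A" and \<eta>: "0 < \<eta>"
  obtains K where "0 \<le> K" "\<And>f. f \<in> borel_measurable M \<Longrightarrow> modular f \<le> 1 \<Longrightarrow>
      modular (\<lambda>x. A * f x) \<le> ennreal K * modular f + ennreal \<eta>"
proof -
  obtain K c where K: "0 \<le> K" and c: "0 \<le> c" "ennreal c * emeasure M (space M) \<le> ennreal \<eta>"
    and pt: "\<And>f x. f \<in> borel_measurable M \<Longrightarrow> modular f \<le> 1 \<Longrightarrow> x \<in> space M \<Longrightarrow>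
      \<Phi> (A * f x) \<le> K * \<Phi> (f x) + c"
    by (rule Delta2_pointwise[OF A \<eta>]) (rule that)
  have "modular (\<lambda>x. A * f x) \<le> ennreal K * modular f + ennreal \<eta>"
    if [measurable]: "f \<in> borel_measurable M" and f: "modular f \<le> 1" for f
  proof -
    have "modular (\<lambda>x. A * f x) \<le> (\<integral>\<^sup>+ x. ennreal K * ennreal (\<Phi> (f x)) + ennreal c \<partial>M)"
      unfolding orlicz_modular_def
      using pt[OF that] K c
      by (intro nn_integral_mono)
        (auto simp: ennreal_mult[symmetric] ennreal_plus[symmetric] simp del: ennreal_plus intro!: ennreal_leI)
    also have "\<dots> = ennreal K * modular f + ennreal c * emeasure M (space M)"
      unfolding orlicz_modular_def by (subst nn_integral_add) (auto simp: nn_integral_cmult)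
    also have "\<dots> \<le> ennreal K * modular f + ennreal \<eta>" using c by (intro add_left_mono)
    finally show ?thesis .
  qed
  with K show thesis by (rule that)
qed

section \<open>From the modular to the gauge, and between unit vectors and densities\<close>

lemma gauge_le: "0 < k \<Longrightarrow> modular (\<lambda>x. f x / k) \<le> 1 \<Longrightarrow> gauge_norm M \<Phi> f \<le> k"
  unfolding gauge_norm_def by (intro cInf_lower bdd_belowI[of _ 0]) auto

lemma orlicz_space_scale:
  assumes "f \<in> orlicz_space M \<Phi>"
  obtains k where "0 < k" "modular (\<lambda>x. f x / k) \<le> 1"
proof -
  obtain a where f[measurable]: "f \<in> borel_measurable M" and a: "0 < a" "modular (\<lambda>x. a * f x) < \<infinity>"
    using assms by (auto simp: orlicz_space_def)
  obtain R where R: "modular (\<lambda>x. a * f x) = ennreal R" "0 \<le> R"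
    using a(2) by (cases "modular (\<lambda>x. a * f x)") auto
  define c where "c = 1 / (R + 1)"
  have c: "0 < c" "c \<le> 1" "c * R \<le> 1" using R(2) by (auto simp: c_def)
  have "modular (\<lambda>x. f x / (1 / (c * a))) = modular (\<lambda>x. c * (a * f x))" by (simp add: ac_simps)
  also have "\<dots> \<le> ennreal c * modular (\<lambda>x. a * f x)" using c by (intro modular_scale) auto
  also have "\<dots> \<le> 1" using c R by (simp add: ennreal_mult[symmetric])
  finally show thesis using c a by (intro that[of "1 / (c * a)"]) auto
qed

text \<open>A strict bound on the gauge yields an admissible k below \<open>t\<close>, so the
  infimum need not be attained. Membership in the Orlicz space makes the set of admissible k
  nonempty; the infimum of an empty set would carry no information.\<close>

lemma modular_le_1:
  assumes f: "f \<in> orlicz_space M \<Phi>" and t: "gauge_norm M \<Phi> f < t"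
  shows "modular (\<lambda>x. f x / t) \<le> 1"
proof -
  let ?S = "{k. 0 < k \<and> modular (\<lambda>x. f x / k) \<le> 1}"
  have "?S \<noteq> {}" using orlicz_space_scale[OF f] by blast
  then obtain k where k: "0 < k" "modular (\<lambda>x. f x / k) \<le> 1" "k < t"
    using t cInf_lessD[of ?S t] by (auto simp: gauge_norm_def)
  have "modular (\<lambda>x. f x / t) \<le> modular (\<lambda>x. f x / k)"
    using k by (intro modular_mono) (auto simp: abs_div intro!: divide_left_mono)
  with k show ?thesis by simp
qed

text \<open>Supplies the membership that \<open>modular_le_1\<close> demands before a bound on the
  gauge of a displacement can be used.\<close>

lemma orlicz_space_diff:
  assumes f: "f \<in> orlicz_space M \<Phi>" and T: "T \<in> measurable M M" "distr M M T = M"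
  shows "(\<lambda>x. f (T x) - f x) \<in> orlicz_space M \<Phi>"
proof -
  obtain a where f[measurable]: "f \<in> borel_measurable M" and a: "0 < a" "modular (\<lambda>x. a * f x) < \<infinity>"
    using f by (auto simp: orlicz_space_def)
  note T(1)[measurable]
  have eq: "modular (\<lambda>x. a * f (T x)) = modular (\<lambda>x. a * f x)"
    unfolding orlicz_modular_def by (subst (2) T(2)[symmetric], subst nn_integral_distr) auto
  have "\<Phi> (a / 2 * (f (T x) - f x)) \<le> \<Phi> (a * f (T x)) + \<Phi> (a * f x)" for x
  proof -
    have "\<Phi> (a / 2 * (f (T x) - f x)) \<le> 1 / 2 * \<Phi> (a * f (T x)) + 1 / 2 * \<Phi> (- (a * f x))"
      using convexD'[of "1/2" "a * f (T x)" "- (a * f x)"] by (simp add: algebra_simps)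
    then show ?thesis unfolding even using nonneg[of "a * f (T x)"] nonneg[of "a * f x"] by linarith
  qed
  then have "modular (\<lambda>x. a / 2 * (f (T x) - f x)) \<le>
      (\<integral>\<^sup>+ x. ennreal (\<Phi> (a * f (T x))) + ennreal (\<Phi> (a * f x)) \<partial>M)"
    unfolding orlicz_modular_def
    by (intro nn_integral_mono) (auto simp: ennreal_plus[symmetric] simp del: ennreal_plus intro!: ennreal_leI)
  also have "\<dots> = modular (\<lambda>x. a * f (T x)) + modular (\<lambda>x. a * f x)"
    unfolding orlicz_modular_def by (intro nn_integral_add) auto
  also have "\<dots> < \<infinity>" using a unfolding eq by (simp add: ennreal_add_less_top)
  finally have "modular (\<lambda>x. a / 2 * (f (T x) - f x)) < \<infinity>" .
  moreover have "(\<lambda>x. f (T x) - f x) \<in> borel_measurable M" by measurable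
  ultimately show ?thesis using a(1) unfolding orlicz_space_def by (auto intro!: exI[of _ "a / 2"])
qed

text \<open>The density is \<Phi> (v x) / c, where v = f / (1 + s) and c is the modular of v. The
  shrinking is there because gauge 1 directly gives modular at most 1 only for f / k with k > 1.
  Since (1 + s) f has modular above 1, the growth condition keeps c above 1/2. The displacement
  estimate is \<open>abs_diff_le\<close>, integrated.\<close>

lemma unit_vector_to_density:
  assumes \<delta>: "0 < \<delta>"
  obtains \<epsilon> where "0 < \<epsilon>" "\<And>f. f \<in> orlicz_space M \<Phi> \<Longrightarrow> gauge_norm M \<Phi> f = 1 \<Longrightarrow>
    \<exists>\<phi>\<in>borel_measurable M. (\<forall>x. 0 \<le> \<phi> x) \<and> (\<integral>\<^sup>+ x. ennreal (\<phi> x) \<partial>M) = 1 \<and>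
      (\<forall>T\<in>measurable M M. distr M M T = M \<longrightarrow> gauge_norm M \<Phi> (\<lambda>x. f (T x) - f x) \<le> \<epsilon> \<longrightarrow>
        (\<integral>\<^sup>+ x. ennreal \<bar>\<phi> (T x) - \<phi> x\<bar> \<partial>M) \<le> ennreal \<delta>)"
proof -
  obtain K where K: "0 \<le> K" and dbl: "\<And>f. f \<in> borel_measurable M \<Longrightarrow> modular f \<le> 1 \<Longrightarrow>
      modular (\<lambda>x. 2 * f x) \<le> ennreal K * modular f + ennreal 1"
    by (rule Delta2_modular[of 2 1]) (auto intro: that)
  have dbl': "modular (\<lambda>x. 2 * f x) \<le> ennreal (K + 1)"
    if "f \<in> borel_measurable M" "modular f \<le> 1" for f
  proof -
    have "modular (\<lambda>x. 2 * f x) \<le> ennreal K * modular f + ennreal 1" using dbl that by blast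
    also have "\<dots> \<le> ennreal K * 1 + ennreal 1" using that by (intro add_right_mono mult_left_mono) auto
    finally show ?thesis using K by simp
  qed
  \<comment> \<open>Integrating \<open>abs_diff_le\<close> costs 4 t (K + 1) + t, and dividing by c
    > 1/2 at most doubles this; the choice keeps the result within \<open>\<delta>\<close>.\<close>
  define t where "t = min (1/2) (\<delta> / (2 * (4 * (K + 1) + 1)))"
  have p: "0 < 2 * (4 * (K + 1) + 1)" using K by simp
  have t1: "0 < t" using p \<delta> by (simp add: t_def)
  have t2: "t \<le> 1/2" unfolding t_def by (rule min.cobounded1)
  have "t \<le> \<delta> / (2 * (4 * (K + 1) + 1))" unfolding t_def by (rule min.cobounded2)
  then have "t * (2 * (4 * (K + 1) + 1)) \<le> \<delta>" by (rule iffD1[OF pos_le_divide_eq[OF p]])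
  then have "2 * (4 * t * (K + 1) + t) \<le> \<delta>" by (simp add: algebra_simps)
  note t = t1 t2 this
  \<comment> \<open>With 1 + r = (1 + s)^2 below, (1 + r) v equals (1 + s) f, and its modular
    exceeds that of v by at most 3 s (K + 1) = 1/2.\<close>
  define s where "s = 1 / (6 * (K + 1))"
  have s: "0 < s" "s \<le> 1 / 6" "3 * s * (K + 1) = 1 / 2" using K by (auto simp: s_def field_simps)
  define r where "r = 2 * s + s\<^sup>2"
  have "s * s \<le> s * 1" using s by (intro mult_left_mono) auto
  then have r: "0 \<le> r" "r \<le> 3 * s" using s by (auto simp: r_def power2_eq_square)
  have rs: "(1 + r) / (1 + s) = 1 + s" using s by (simp add: r_def field_simps power2_eq_square)
  have "\<exists>\<phi>\<in>borel_measurable M. (\<forall>x. 0 \<le> \<phi> x) \<and> (\<integral>\<^sup>+ x. ennreal (\<phi> x) \<partial>M) = 1 \<and>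
      (\<forall>T\<in>measurable M M. distr M M T = M \<longrightarrow> gauge_norm M \<Phi> (\<lambda>x. f (T x) - f x) \<le> t / 2 \<longrightarrow>
        (\<integral>\<^sup>+ x. ennreal \<bar>\<phi> (T x) - \<phi> x\<bar> \<partial>M) \<le> ennreal \<delta>)"
    if f: "f \<in> orlicz_space M \<Phi>" "gauge_norm M \<Phi> f = 1" for f
  proof -
    have [measurable]: "f \<in> borel_measurable M" using f(1) unfolding orlicz_space_def by blast
    define v where "v = (\<lambda>x. f x / (1 + s))"
    have [measurable]: "v \<in> borel_measurable M" unfolding v_def by measurable
    have v1: "modular v \<le> 1" unfolding v_def using f s by (intro modular_le_1) auto
    have "1 < modular (\<lambda>x. (1 + r) * v x)"
    proof (rule ccontr)
      assume "\<not> 1 < modular (\<lambda>x. (1 + r) * v x)"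
      moreover have "(1 + r) * v x = f x / (1 / (1 + s))" for x
      proof -
        have "(1 + r) * v x = (1 + r) / (1 + s) * f x" by (simp add: v_def)
        then show ?thesis unfolding rs by simp
      qed
      ultimately have "gauge_norm M \<Phi> f \<le> 1 / (1 + s)" using s by (intro gauge_le) auto
      with f s show False by (simp add: field_simps)
    qed
    also have "modular (\<lambda>x. (1 + r) * v x) \<le>
        (\<integral>\<^sup>+ x. ennreal (\<Phi> (v x)) + ennreal r * ennreal (\<Phi> (2 * v x)) \<partial>M)"
      unfolding orlicz_modular_def using r s
      by (intro nn_integral_mono)
        (auto simp: ennreal_mult[symmetric] ennreal_plus[symmetric] simp del: ennreal_plus
          intro!: ennreal_leI one_plus_scale)
    also have "\<dots> = modular v + ennreal r * modular (\<lambda>x. 2 * v x)"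
      unfolding orlicz_modular_def by (subst nn_integral_add) (auto simp: nn_integral_cmult)
    also have "\<dots> \<le> modular v + ennreal (3 * s) * ennreal (K + 1)"
      using r v1 by (intro add_left_mono mult_mono dbl' ennreal_leI) auto
    also have "ennreal (3 * s) * ennreal (K + 1) = ennreal (3 * s * (K + 1))"
      using s K by (intro ennreal_mult[symmetric]) auto
    also have "\<dots> = ennreal (1 / 2)" by (simp only: s(3))
    finally have big: "1 < modular v + ennreal (1 / 2)" .
    obtain c where c: "modular v = ennreal c" "0 \<le> c" using v1 by (cases "modular v") (auto simp: top_unique)
    have c2: "1 / 2 < c"
    proof -
      have "ennreal (c + 1 / 2) = ennreal c + ennreal (1 / 2)" using c(2) by (intro ennreal_plus) auto
      with big c(1) have "ennreal 1 < ennreal (c + 1 / 2)" by (simp only: ennreal_1)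
      then have "1 < c + 1 / 2" by (rule iffD1[OF ennreal_less_iff, rotated]) simp
      then show ?thesis by simp
    qed
    define \<phi> where "\<phi> = (\<lambda>x. \<Phi> (v x) / c)"
    have [measurable]: "\<phi> \<in> borel_measurable M" unfolding \<phi>_def by measurable
    have nn: "0 \<le> \<phi> x" for x unfolding \<phi>_def using c by simp
    have int1: "(\<integral>\<^sup>+ x. ennreal (\<phi> x) \<partial>M) = 1"
    proof -
      have "(\<integral>\<^sup>+ x. ennreal (\<phi> x) \<partial>M) = (\<integral>\<^sup>+ x. ennreal (1 / c) * ennreal (\<Phi> (v x)) \<partial>M)"
        unfolding \<phi>_def using c by (intro nn_integral_cong) (subst ennreal_mult[symmetric]; simp)
      also have "\<dots> = ennreal (1 / c) * ennreal c"
        using c by (subst nn_integral_cmult) (auto simp: orlicz_modular_def)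
      also have "\<dots> = 1" using c2 by (simp add: ennreal_mult[symmetric])
      finally show ?thesis .
    qed
    have "(\<integral>\<^sup>+ x. ennreal \<bar>\<phi> (T x) - \<phi> x\<bar> \<partial>M) \<le> ennreal \<delta>"
      if T: "T \<in> measurable M M" "distr M M T = M" and g: "gauge_norm M \<Phi> (\<lambda>x. f (T x) - f x) \<le> t / 2" for T
    proof -
      note T(1)[measurable]
      have eq: "modular (\<lambda>x. 2 * v (T x)) = modular (\<lambda>x. 2 * v x)"
        unfolding orlicz_modular_def by (subst (2) T(2)[symmetric], subst nn_integral_distr) auto
      have "modular (\<lambda>x. (v (T x) - v x) / t) \<le> modular (\<lambda>x. (f (T x) - f x) / t)"
      proof (rule modular_mono)
        fix x
        have eq: "(v (T x) - v x) / t = 1 / (1 + s) * ((f (T x) - f x) / t)"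
          by (simp add: v_def diff_divide_distrib mult.commute)
        show "\<bar>(v (T x) - v x) / t\<bar> \<le> \<bar>(f (T x) - f x) / t\<bar>"
          unfolding eq abs_mult using s by (intro mult_left_le_one_le) auto
      qed
      also have "\<dots> \<le> 1" using orlicz_space_diff[OF f(1) T] g t by (intro modular_le_1) auto
      finally have m1: "modular (\<lambda>x. (v (T x) - v x) / t) \<le> 1" .
      have "(\<integral>\<^sup>+ x. ennreal \<bar>\<phi> (T x) - \<phi> x\<bar> \<partial>M) \<le>
         (\<integral>\<^sup>+ x. ennreal 2 * (ennreal (2 * t) * (ennreal (\<Phi> (2 * v (T x))) + ennreal (\<Phi> (2 * v x)))
            + ennreal t * ennreal (\<Phi> ((v (T x) - v x) / t))) \<partial>M)"
      proof (rule nn_integral_mono)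
        fix x
        let ?b = "2 * t * (\<Phi> (2 * v (T x)) + \<Phi> (2 * v x)) + t * \<Phi> ((v (T x) - v x) / t)"
        have b: "0 \<le> ?b" using t by simp
        have "\<bar>\<phi> (T x) - \<phi> x\<bar> = \<bar>\<Phi> (v (T x)) - \<Phi> (v x)\<bar> / c"
          using c by (simp add: \<phi>_def diff_divide_distrib[symmetric] abs_div)
        also have "\<dots> \<le> ?b / c" using c(2) by (rule divide_right_mono[OF abs_diff_le[OF t(1,2)]])
        also have "\<dots> \<le> ?b / (1/2)" using c2 b by (intro divide_left_mono) auto
        finally have "ennreal \<bar>\<phi> (T x) - \<phi> x\<bar> \<le> ennreal (2 * ?b)" by (intro ennreal_leI) simp
        also have "\<dots> = ennreal 2 * ennreal ?b" using b by (intro ennreal_mult) auto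
        also have "ennreal ?b = ennreal (2 * t * (\<Phi> (2 * v (T x)) + \<Phi> (2 * v x)))
            + ennreal (t * \<Phi> ((v (T x) - v x) / t))" using t by (intro ennreal_plus) auto
        also have "ennreal (2 * t * (\<Phi> (2 * v (T x)) + \<Phi> (2 * v x))) =
            ennreal (2 * t) * ennreal (\<Phi> (2 * v (T x)) + \<Phi> (2 * v x))"
          using t by (intro ennreal_mult) auto
        also have "ennreal (\<Phi> (2 * v (T x)) + \<Phi> (2 * v x)) =
            ennreal (\<Phi> (2 * v (T x))) + ennreal (\<Phi> (2 * v x))" by (intro ennreal_plus) auto
        also have "ennreal (t * \<Phi> ((v (T x) - v x) / t)) = ennreal t * ennreal (\<Phi> ((v (T x) - v x) / t))"
          using t by (intro ennreal_mult) auto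
        finally show "ennreal \<bar>\<phi> (T x) - \<phi> x\<bar> \<le>
            ennreal 2 * (ennreal (2 * t) * (ennreal (\<Phi> (2 * v (T x))) + ennreal (\<Phi> (2 * v x)))
            + ennreal t * ennreal (\<Phi> ((v (T x) - v x) / t)))" .
      qed
      also have "\<dots> = ennreal 2 * (ennreal (2 * t) * (modular (\<lambda>x. 2 * v (T x)) + modular (\<lambda>x. 2 * v x))
            + ennreal t * modular (\<lambda>x. (v (T x) - v x) / t))"
        unfolding orlicz_modular_def by (simp add: nn_integral_cmult nn_integral_add)
      also have "\<dots> \<le> ennreal 2 * (ennreal (2 * t) * (ennreal (K + 1) + ennreal (K + 1)) + ennreal t * 1)"
        unfolding eq using v1 m1 by (intro mult_left_mono add_mono dbl') auto
      also have "\<dots> = ennreal (2 * (4 * t * (K + 1) + t))"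
        using t K by (simp add: ennreal_mult[symmetric] ennreal_plus[symmetric] numeral_mult_ennreal
           del: ennreal_plus)
      also have "\<dots> \<le> ennreal \<delta>" using t by (intro ennreal_leI)
      finally show ?thesis .
    qed
    with nn int1 show ?thesis by (intro bexI[of _ \<phi>]) auto
  qed
  \<comment> \<open>Half of \<open>t\<close>, because \<open>modular_le_1\<close> needs a strict
    inequality.\<close>
  with t(1) show thesis by (intro that[of "t / 2"]) auto
qed

text \<open>The vector is \<Psi> composed with \<phi>, so \<Phi> (f x) = \<phi> x and the modular is
  exactly 1. By \<open>inverse_diff\<close> a displacement is small in modular, and the growth
  condition with dilation 1 / \<epsilon> turns this into a small gauge.\<close>

lemma density_to_unit_vector:
  assumes \<epsilon>: "0 < \<epsilon>"
  obtains \<delta> where "0 < \<delta>" "\<And>\<phi>. \<phi> \<in> borel_measurable M \<Longrightarrow> (\<forall>x. 0 \<le> \<phi> x) \<Longrightarrow>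
    (\<integral>\<^sup>+ x. ennreal (\<phi> x) \<partial>M) = 1 \<Longrightarrow>
    \<exists>f\<in>orlicz_space M \<Phi>. gauge_norm M \<Phi> f = 1 \<and>
      (\<forall>T\<in>measurable M M. (\<integral>\<^sup>+ x. ennreal \<bar>\<phi> (T x) - \<phi> x\<bar> \<partial>M) \<le> ennreal \<delta> \<longrightarrow>
        gauge_norm M \<Phi> (\<lambda>x. f (T x) - f x) \<le> \<epsilon>)"
proof -
  obtain K where K: "0 \<le> K" and Km: "\<And>f. f \<in> borel_measurable M \<Longrightarrow> modular f \<le> 1 \<Longrightarrow>
      modular (\<lambda>x. 1 / \<epsilon> * f x) \<le> ennreal K * modular f + ennreal (1 / 2)"
    by (rule Delta2_modular[of "1 / \<epsilon>" "1 / 2"]) (use \<epsilon> in \<open>auto intro: that\<close>)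
  obtain \<Psi> where \<Psi>: "mono \<Psi>" "\<And>y. 0 \<le> y \<Longrightarrow> 0 \<le> \<Psi> y" "\<And>y. 0 \<le> y \<Longrightarrow> \<Phi> (\<Psi> y) = y"
    by (rule inverse) (rule that)
  have [measurable]: "\<Psi> \<in> borel_measurable borel" using \<Psi>(1) by (rule borel_measurable_mono)
  \<comment> \<open>K \<delta> \<le> 1/2 and the additive error 1/2 together stay within 1; \<delta>
    \<le> 1 makes the doubling estimate applicable to the displacement.\<close>
  define \<delta> where "\<delta> = 1 / (2 * (K + 1))"
  have \<delta>: "0 < \<delta>" "\<delta> \<le> 1" "K * \<delta> + 1 / 2 \<le> 1" using K by (auto simp: \<delta>_def field_simps)
  have "\<exists>f\<in>orlicz_space M \<Phi>. gauge_norm M \<Phi> f = 1 \<and>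
      (\<forall>T\<in>measurable M M. (\<integral>\<^sup>+ x. ennreal \<bar>\<phi> (T x) - \<phi> x\<bar> \<partial>M) \<le> ennreal \<delta> \<longrightarrow>
        gauge_norm M \<Phi> (\<lambda>x. f (T x) - f x) \<le> \<epsilon>)"
    if [measurable]: "\<phi> \<in> borel_measurable M" and nn': "\<forall>x. 0 \<le> \<phi> x"
      and int1: "(\<integral>\<^sup>+ x. ennreal (\<phi> x) \<partial>M) = 1" for \<phi>
  proof -
    have nn: "0 \<le> \<phi> x" for x using nn' by blast
    define f where "f = (\<lambda>x. \<Psi> (\<phi> x))"
    have [measurable]: "f \<in> borel_measurable M" unfolding f_def by measurable
    have f: "\<Phi> (f x) = \<phi> x" for x unfolding f_def using nn \<Psi> by simp
    have m1: "modular f = 1" unfolding orlicz_modular_def f by (rule int1)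
    have "f \<in> orlicz_space M \<Phi>" unfolding orlicz_space_def using m1 by (auto intro!: exI[of _ 1])
    moreover have "gauge_norm M \<Phi> f = 1"
    proof (rule antisym)
      show "gauge_norm M \<Phi> f \<le> 1" using m1 by (intro gauge_le) auto
      \<comment> \<open>An admissible k < 1 would give, by convexity, modular at most k < 1.\<close>
      have "1 \<le> k" if k: "0 < k" "modular (\<lambda>x. f x / k) \<le> 1" for k
      proof (rule ccontr)
        assume "\<not> 1 \<le> k"
        then have k1: "k < 1" by simp
        have "1 = modular (\<lambda>x. k * (f x / k))" using k m1 by simp
        also have "\<dots> \<le> ennreal k * modular (\<lambda>x. f x / k)" using k k1 by (intro modular_scale) auto
        also have "\<dots> \<le> ennreal k * 1" using k by (intro mult_left_mono) auto
        also have "\<dots> < 1" using k1 k by (simp add: ennreal_less_one_iff)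
        finally show False by simp
      qed
      then show "1 \<le> gauge_norm M \<Phi> f"
        unfolding gauge_norm_def using m1 by (intro cInf_greatest) (auto intro!: exI[of _ 1])
    qed
    moreover have "gauge_norm M \<Phi> (\<lambda>x. f (T x) - f x) \<le> \<epsilon>"
      if [measurable]: "T \<in> measurable M M" and d: "(\<integral>\<^sup>+ x. ennreal \<bar>\<phi> (T x) - \<phi> x\<bar> \<partial>M) \<le> ennreal \<delta>" for T
    proof (rule gauge_le[OF \<epsilon>])
      have "modular (\<lambda>x. f (T x) - f x) \<le> (\<integral>\<^sup>+ x. ennreal \<bar>\<phi> (T x) - \<phi> x\<bar> \<partial>M)"
        unfolding orlicz_modular_def f_def
        by (intro nn_integral_mono ennreal_leI inverse_diff \<Psi> nn)
      also note d
      finally have md: "modular (\<lambda>x. f (T x) - f x) \<le> ennreal \<delta>" .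
      also have "ennreal \<delta> \<le> 1" using \<delta> by simp
      finally have "modular (\<lambda>x. 1 / \<epsilon> * (f (T x) - f x)) \<le>
          ennreal K * modular (\<lambda>x. f (T x) - f x) + ennreal (1 / 2)"
        by (intro Km) auto
      also have "\<dots> \<le> ennreal K * ennreal \<delta> + ennreal (1 / 2)"
        using md by (intro add_right_mono mult_left_mono) auto
      also have "\<dots> = ennreal (K * \<delta> + 1 / 2)"
        using K \<delta> by (simp add: ennreal_mult ennreal_plus)
      also have "\<dots> \<le> 1" using \<delta> by simp
      finally show "modular (\<lambda>x. (f (T x) - f x) / \<epsilon>) \<le> 1" by simp
    qed
    ultimately show ?thesis by blast
  qed
  with \<delta>(1) show thesis by (rule that)
qed

end

subsection \<open>Locally compact groups and invariant Borel measures\<close>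

lemma subgroup_addD:
  assumes "subgroup_add H"
  shows "0 \<in> H" "x \<in> H \<Longrightarrow> y \<in> H \<Longrightarrow> x + y \<in> H" "x \<in> H \<Longrightarrow> - x \<in> H"
  using assms by (auto simp: subgroup_add_def)

lemma subgroup_add_iff: 
  assumes "subgroup_add H" "h \<in> H"
  shows "h + x \<in> H \<longleftrightarrow> x \<in> H"
  by (metis assms subgroup_addD(2,3) minus_add_cancel)

lemma borel_measurable_uminus_group [measurable (raw)]:
  fixes f :: "'b \<Rightarrow> 'a::{topological_group_add, second_countable_topology}"
  assumes [measurable]: "f \<in> borel_measurable M"
  shows "(\<lambda>x. - f x) \<in> borel_measurable M"
  by (rule borel_measurable_continuous_on[OF _ assms]) (intro continuous_intros)

lemma image_add_left_eq_vimage: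
  "(\<lambda>x. g + x) ` A = (\<lambda>x. - g + x) -` (A :: 'a::group_add set)"
  by (auto simp: add.assoc[symmetric] image_iff intro!: bexI[of _ "- g + _"])

lemma compact_image_add_left: "compact C \<Longrightarrow> compact ((\<lambda>x::'a::topological_group_add. g + x) ` C)"
  by (intro compact_continuous_image continuous_intros)

lemma open_image_add_left: "open C \<Longrightarrow> open ((\<lambda>x::'a::topological_group_add. g + x) ` C)"
  unfolding image_add_left_eq_vimage by (intro open_vimage continuous_intros)

definition set_add :: "'a::plus set \<Rightarrow> 'a set \<Rightarrow> 'a set" where
  "set_add A B = (\<lambda>(a, b). a + b) ` (A \<times> B)"

lemma mem_set_add_iff:
  fixes A B :: "'a::group_add set"
  shows "x \<in> set_add A B \<longleftrightarrow> (\<exists>b\<in>B. x - b \<in> A)"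
proof
  assume "x \<in> set_add A B"
  then obtain a b where "a \<in> A" "b \<in> B" "x = a + b" by (auto simp: set_add_def)
  then show "\<exists>b\<in>B. x - b \<in> A" by (intro bexI[of _ b]) simp_all
next
  assume "\<exists>b\<in>B. x - b \<in> A"
  then obtain b where "b \<in> B" "x - b \<in> A" by blast
  then show "x \<in> set_add A B"
    unfolding set_add_def by (intro image_eqI[of _ _ "(x - b, b)"]) simp_all
qed

lemma compact_set_add:
  fixes A B :: "'a::topological_group_add set"
  assumes "compact A" "compact B"
  shows "compact (set_add A B)"
  unfolding set_add_def case_prod_unfold
  by (intro compact_continuous_image compact_Times assms continuous_intros)

text \<open>Projection along a compact factor is a closed map; the set projected is that of all
  pairs (x, b) with b in \<open>B\<close> and x - b in \<open>A\<close>.\<close>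

lemma closed_set_add:
  fixes A B :: "'a::{topological_group_add, t2_space} set"
  assumes A: "closed A" and B: "compact B"
  shows "closed (set_add A B)"
proof -
  let ?S = "UNIV \<times> B" and ?P = "{p :: 'a \<times> 'a. fst p - snd p \<in> A}"
  have "closed ((\<lambda>p::'a \<times> 'a. fst p - snd p) -` A)"
    by (intro closed_vimage A continuous_intros)
  then have "closed ?P" by (simp add: vimage_def)
  then have "closedin (prod_topology euclidean (top_of_set B)) (?S \<inter> ?P)"
    unfolding prod_topology_subtopology(2) prod_topology_euclidean topspace_euclidean
    by (rule closedin_closed_Int)
  moreover have "closed_map (prod_topology euclidean (top_of_set B)) (euclidean :: 'a topology) fst"
    using B by (intro Abstract_Topological_Spaces.closed_map_fst) (simp add: compact_space_subtopology)
  ultimately have "closed (fst ` (?S \<inter> ?P))"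
    unfolding closed_map_def closed_closedin[symmetric] by blast
  moreover have "fst ` (?S \<inter> ?P) = {x. \<exists>b\<in>B. x - b \<in> A}"
  proof (intro set_eqI iffI)
    fix x assume "x \<in> {x. \<exists>b\<in>B. x - b \<in> A}"
    then obtain b where "b \<in> B" "x - b \<in> A" by blast
    then show "x \<in> fst ` (?S \<inter> ?P)" by (intro image_eqI[of _ _ "(x, b)"]) simp_all
  qed auto
  moreover have "{x. \<exists>b\<in>B. x - b \<in> A} = set_add A B"
    by (simp add: set_eq_iff mem_set_add_iff)
  ultimately show ?thesis by simp
qed

section \<open>Compact exhaustions and neighbourhoods\<close>

lemma compact_exhaustion:
  assumes lc: "locally_compact_space (euclidean :: 'a::{t2_space, second_countable_topology} topology)"
  obtains D :: "nat \<Rightarrow> 'a::{t2_space, second_countable_topology} set" where "\<And>n. compact (D n)" "incseq D" "\<And>C. compact C \<Longrightarrow> \<exists>n. C \<subseteq> D n"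
    "(\<Union>n. D n) = UNIV"
proof -
  have "\<exists>U K. open U \<and> compact K \<and> x \<in> U \<and> U \<subseteq> K" for x :: 'a
    using lc unfolding locally_compact_space_def topspace_euclidean open_openin[symmetric] compactin_euclidean_iff
    by blast
  then obtain U K where UK: "\<And>x::'a. open (U x)" "\<And>x. compact (K x)" "\<And>x. x \<in> U x" "\<And>x. U x \<subseteq> K x"
    by metis
  obtain F where F: "F \<subseteq> range U" "countable F" "\<Union> F = (\<Union>(range U))"
    using Lindelof[of "range U"] UK(1) by auto
  obtain I where I: "countable I" "F = U ` I" 
    using F by (metis countable_subset_image)
  have "I \<noteq> {}"
  proof
    assume "I = {}"
    with F(3) I(2) have "(\<Union>x. U x) = {}" by simp
    with UK(3) show False by blast
  qed
  define e where "e = from_nat_into I"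
  have e: "range e = I" unfolding e_def using I \<open>I \<noteq> {}\<close> by (simp add: range_from_nat_into)
  have "(\<Union>n. U (e n)) = (\<Union>x\<in>I. U x)" using e by auto
  also have "\<dots> = (\<Union>x. U x)" using F(3) I(2) by simp
  also have "\<dots> = UNIV" using UK(3) by blast
  finally have cov: "(\<Union>n. U (e n)) = UNIV" .
  define D where "D = (\<lambda>n. \<Union>i\<le>n. K (e i))"
  have inc: "incseq D" unfolding D_def by (auto intro!: incseq_SucI simp: atMost_Suc)
  have comp: "compact (D n)" for n unfolding D_def using UK by auto
  have ex: "\<exists>n. C \<subseteq> D n" if C: "compact C" for C
  proof -
    have CU: "C \<subseteq> (\<Union>n\<in>UNIV. U (e n))" using cov by auto
    obtain T where T: "finite T" "C \<subseteq> (\<Union>n\<in>T. U (e n))"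
      by (rule compactE_image[OF C _ CU]) (rule UK(1))
    obtain m where m: "T \<subseteq> {..m}" using T(1) by (meson finite_nat_iff_bounded_le)
    have "C \<subseteq> D m" using T(2) m UK(4) unfolding D_def by blast
    then show ?thesis by blast
  qed
  have "x \<in> (\<Union>n. D n)" for x using ex[OF finite_imp_compact, of "{x}"] by auto
  then have "(\<Union>n. D n) = UNIV" by blast
  with comp inc ex show thesis by (rule that)
qed

lemma compact_neighbourhood:
  fixes W :: "'a::t2_space set"
  assumes lc: "locally_compact_space (euclidean :: 'a topology)" and W: "open W" "x \<in> W"
  obtains V where "compact V" "V \<subseteq> W" "x \<in> interior V"
proof -
  have "Hausdorff_space (euclidean :: 'a topology)"
    unfolding Hausdorff_space_def disjnt_def open_openin[symmetric] using hausdorff by blast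
  with lc have "regular_space (euclidean :: 'a topology)"
    by (rule locally_compact_Hausdorff_imp_regular_space)
  with lc have "neighbourhood_base_of (compactin euclidean) (euclidean :: 'a topology)"
    by (rule locally_compact_imp_neighbourhood_base)
  then have "\<exists>U V. open U \<and> compact V \<and> x \<in> U \<and> U \<subseteq> V \<and> V \<subseteq> W"
    using W unfolding neighbourhood_base_of open_openin[symmetric] compactin_euclidean_iff by blast
  then obtain U V where "open U" "compact V" "x \<in> U" "U \<subseteq> V" "V \<subseteq> W" by blast
  then show thesis using that[of V] interior_maximal[of U V] by blast
qed

lemma open_eq_Union_compact:
  fixes W :: "'a::{t2_space, second_countable_topology} set"
  assumes lc: "locally_compact_space (euclidean :: 'a topology)" and W: "open W"
  obtains K :: "nat \<Rightarrow> 'a set" where "\<And>n. compact (K n)" "W = (\<Union>n. K n)"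
proof (cases "W = {}")
  case True
  then show thesis using that[of "\<lambda>_. {}"] by simp
next
  case False
  have "\<exists>V. compact V \<and> V \<subseteq> W \<and> x \<in> interior V" if "x \<in> W" for x
    by (rule compact_neighbourhood[OF lc W that]) blast
  then obtain V where V: "\<And>x. x \<in> W \<Longrightarrow> compact (V x) \<and> V x \<subseteq> W \<and> x \<in> interior (V x)"
    by metis
  obtain F where F: "F \<subseteq> (\<lambda>x. interior (V x)) ` W" "countable F"
      "\<Union> F = (\<Union>x\<in>W. interior (V x))"
    using Lindelof[of "(\<lambda>x. interior (V x)) ` W"] by auto
  obtain I where I: "countable I" "I \<subseteq> W" "F = (\<lambda>x. interior (V x)) ` I"
    using F by (metis countable_subset_image)
  have "I \<noteq> {}"
  proof
    assume "I = {}"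
    with F(3) I(3) have "(\<Union>x\<in>W. interior (V x)) = {}" by simp
    with V False show False by blast
  qed
  define e where "e = from_nat_into I"
  have e: "range e = I" unfolding e_def using I \<open>I \<noteq> {}\<close> by (simp add: range_from_nat_into)
  then have eW: "e n \<in> W" for n using I(2) by auto
  have "W \<subseteq> (\<Union>x\<in>W. interior (V x))" using V by blast
  also have "\<dots> = (\<Union>x\<in>I. interior (V x))" using F(3) I(3) by simp
  also have "\<dots> \<subseteq> (\<Union>x\<in>I. V x)" by (rule UN_mono) (simp_all add: interior_subset)
  also have "\<dots> = (\<Union>n. V (e n))" using e by auto
  finally have "W = (\<Union>n. V (e n))" using V[OF eW] by blast
  then show thesis using that[of "\<lambda>n. V (e n)"] V eW by blast
qed

text \<open>The j that move \<open>A\<close> out of \<open>W\<close> form the sum of the complement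
  of \<open>W\<close> and the negatives of \<open>A\<close>, which is closed. Symmetry of
  \<open>U\<close> is arranged because the comparison of indicators translates by j and by -
  j.\<close>

lemma compact_subset_translate:
  fixes W :: "'a::{topological_group_add, t2_space} set"
  assumes A: "compact A" and W: "open W" "A \<subseteq> W"
  obtains U where "open U" "0 \<in> U" "\<And>j. j \<in> U \<Longrightarrow> (\<lambda>x. j + x) ` A \<subseteq> W" "\<And>j. j \<in> U \<Longrightarrow> - j \<in> U"
proof -
  define S where "S = - set_add (- W) (uminus ` A)"
  have S: "j \<in> S \<longleftrightarrow> (\<lambda>x. j + x) ` A \<subseteq> W" for j
    by (auto simp: S_def mem_set_add_iff)
  have "compact (uminus ` A)" using A by (intro compact_continuous_image continuous_intros)
  then have "open S" unfolding S_def by (intro open_Compl closed_set_add closed_Compl W(1))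
  moreover have "open (uminus -` S)" using \<open>open S\<close> by (intro open_vimage continuous_intros)
  moreover have "0 \<in> S" using W(2) by (simp add: S)
  ultimately show thesis by (intro that[of "S \<inter> uminus -` S"]) (simp_all add: S open_Int)
qed

text \<open>The measure lives on the whole group but is invariant under \<open>H\<close> only. This
  covers both a Haar measure of the group and a Haar measure of \<open>H\<close> extended by
  0.\<close>

locale invariant_borel_measure =
  fixes H :: "'a::{topological_group_add, t2_space, second_countable_topology} set"
    and M :: "'a measure"
  assumes locally_compact: "locally_compact_space (euclidean :: 'a topology)"
    and subgroup: "subgroup_add H"
    and sets_M [measurable_cong, simp]: "sets M = sets borel"
    and finite_on_compact: "compact C \<Longrightarrow> emeasure M C < \<infinity>"
    and emeasure_translate:
      "h \<in> H \<Longrightarrow> A \<in> sets borel \<Longrightarrow> emeasure M ((\<lambda>x. h + x) ` A) = emeasure M A"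
begin

lemma space_M [simp]: "space M = UNIV"
  using sets_eq_imp_space_eq[OF sets_M] by simp

lemma sigma_finite_M: "sigma_finite_measure M"
proof -
  obtain D :: "nat \<Rightarrow> 'a set" where "\<And>n. compact (D n)" "(\<Union>n. D n) = UNIV"
    by (rule compact_exhaustion[OF locally_compact]) (rule that)
  then show ?thesis
    using finite_on_compact
    by (intro sigma_finite_measure.intro exI[of _ "range D"])
      (auto simp: borel_compact less_top)
qed

lemma distr_translate:
  assumes "h \<in> H"
  shows "distr M borel (\<lambda>x. h + x) = M"
proof (rule measure_eqI)
  fix A assume "A \<in> sets (distr M borel (\<lambda>x. h + x))"
  then have [measurable]: "A \<in> sets borel" by simp
  have "emeasure (distr M borel (\<lambda>x. h + x)) A = emeasure M ((\<lambda>x. - (- h) + x) -` A)"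
    by (subst emeasure_distr) auto
  also have "\<dots> = emeasure M A"
    unfolding image_add_left_eq_vimage[symmetric]
    using assms subgroup by (intro emeasure_translate) (auto dest: subgroup_addD)
  finally show "emeasure (distr M borel (\<lambda>x. h + x)) A = emeasure M A" .
qed simp

lemma nn_integral_translate:
  assumes "h \<in> H" and [measurable]: "f \<in> borel_measurable borel"
  shows "(\<integral>\<^sup>+ x. f (h + x) \<partial>M) = (\<integral>\<^sup>+ x. f x \<partial>M)"
  by (subst (2) distr_translate[OF assms(1), symmetric], subst nn_integral_distr) auto

lemma integral_translate:
  fixes f :: "'a \<Rightarrow> real"
  assumes "h \<in> H" and [measurable]: "f \<in> borel_measurable borel"
  shows "(\<integral> x. f (h + x) \<partial>M) = (\<integral> x. f x \<partial>M)"
  by (subst (2) distr_translate[OF assms(1), symmetric], subst integral_distr) auto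

lemma integrable_translate:
  fixes f :: "'a \<Rightarrow> real"
  assumes "h \<in> H" and f: "integrable M f"
  shows "integrable M (\<lambda>x. f (h + x))"
proof -
  have "integrable (distr M borel (\<lambda>x. h + x)) f" using f distr_translate[OF assms(1)] by simp
  then show ?thesis by (rule integrable_distr[rotated]) simp
qed

text \<open>The complement of \<open>A\<close> is a countable union of compact sets; removing more
  and more of them from an open neighbourhood of finite measure leaves open sets decreasing to
  \<open>A\<close>.\<close>

lemma compact_outer_regular:
  assumes A: "compact A" and e: "e > 0"
  obtains W where "open W" "A \<subseteq> W" "emeasure M (W - A) < e"
proof -
  have "\<exists>V. compact V \<and> x \<in> interior V" for x :: 'a
    by (rule compact_neighbourhood[OF locally_compact open_UNIV, of x]) auto
  then obtain V :: "'a \<Rightarrow> 'a set" where V: "\<And>x. compact (V x)" "\<And>x. x \<in> interior (V x)" by metis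
  have AU: "A \<subseteq> (\<Union>x\<in>UNIV. interior (V x))" using V(2) by blast
  obtain T where T: "finite T" "A \<subseteq> (\<Union>x\<in>T. interior (V x))"
    by (rule compactE_image[OF A _ AU]) (rule open_interior)
  define O0 where "O0 = (\<Union>x\<in>T. interior (V x))"
  have O0: "open O0" "A \<subseteq> O0" unfolding O0_def using T by auto
  have "emeasure M O0 \<le> emeasure M (\<Union>x\<in>T. V x)"
    unfolding O0_def using interior_subset T V by (intro emeasure_mono) (auto simp: borel_compact)
  also have "\<dots> < \<infinity>" using T V by (intro finite_on_compact) auto
  finally have fin: "emeasure M O0 < \<infinity>" .
  have "open (- A)" using compact_imp_closed[OF A] by (simp add: open_Compl)
  then obtain K where K: "\<And>n::nat. compact (K n)" "- A = (\<Union>n. K n)"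
    by (rule open_eq_Union_compact[OF locally_compact]) (rule that)
  define W where "W = (\<lambda>n. O0 - (\<Union>i\<le>n. K i))"
  have Wo: "open (W n)" for n
    unfolding W_def using O0 K by (auto intro!: open_Diff closed_UN compact_imp_closed)
  have AW: "A \<subseteq> W n" for n unfolding W_def using O0 K(2) by auto
  have meas: "W n - A \<in> sets borel" for n using Wo A by (auto simp: borel_compact)
  have "(\<lambda>n. emeasure M (W n - A)) \<longlonglongrightarrow> emeasure M (\<Inter>n. W n - A)"
  proof (rule Lim_emeasure_decseq)
    show "decseq (\<lambda>n. W n - A)" unfolding W_def decseq_def
      by (intro allI impI Diff_mono UN_mono) auto
    show "emeasure M (W n - A) \<noteq> \<infinity>" for n
    proof -
      have "emeasure M (W n - A) \<le> emeasure M O0"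
        unfolding W_def using O0 by (intro emeasure_mono) auto
      with fin show ?thesis by (auto simp: top_unique)
    qed
  qed (use meas in auto)
  moreover have "(\<Inter>n. W n - A) = {}"
  proof -
    have False if "x \<in> (\<Inter>n. W n - A)" for x
    proof -
      from that have "x \<in> - A" by auto
      then obtain n where "x \<in> K n" using K(2) by auto
      with that show False unfolding W_def by auto
    qed
    then show ?thesis by blast
  qed
  ultimately have "(\<lambda>n. emeasure M (W n - A)) \<longlonglongrightarrow> 0"
    by (simp only: emeasure_empty)
  then have "\<forall>\<^sub>F n in sequentially. emeasure M (W n - A) < e" using e by (intro order_tendstoD(2))
  then obtain n where "emeasure M (W n - A) < e" unfolding eventually_sequentially by blast
  then show thesis using that Wo AW by blast
qed

text \<open>If the translates of \<open>A\<close> by j and by - j both lie in \<open>W\<close>, the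
  two indicators differ only where x or j + x lies in W - A, a set of small measure.\<close>

lemma indicator_translate_continuous:
  assumes A: "compact A" and e: "e > 0"
  obtains U where "open U" "0 \<in> U"
    "\<And>j. j \<in> U \<Longrightarrow> j \<in> H \<Longrightarrow>
      (\<integral>\<^sup>+ x. ennreal \<bar>indicator A (j + x) - indicator A x\<bar> \<partial>M) \<le> ennreal e"
proof -
  have [measurable]: "A \<in> sets borel" using A by (rule borel_compact)
  obtain W where W: "open W" "A \<subseteq> W" "emeasure M (W - A) < ennreal (e / 2)"
    by (rule compact_outer_regular[OF A, of "ennreal (e / 2)"]) (use e in \<open>simp add: that\<close>)+
  have [measurable]: "W \<in> sets borel" using W(1) by simp
  obtain U where U: "open U" "0 \<in> U" "\<And>j. j \<in> U \<Longrightarrow> (\<lambda>x. j + x) ` A \<subseteq> W" "\<And>j. j \<in> U \<Longrightarrow> - j \<in> U"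
    by (rule compact_subset_translate[OF A W(1,2)]) (rule that)
  have "(\<integral>\<^sup>+ x. ennreal \<bar>indicator A (j + x) - indicator A x\<bar> \<partial>M) \<le> ennreal e"
    if j: "j \<in> U" "j \<in> H" for j
  proof -
    have 1: "ennreal \<bar>indicator A (j + x) - indicator A x\<bar> \<le>
        indicator (W - A) x + indicator (W - A) (j + x)" for x
    proof -
      have "x \<in> W" if "j + x \<in> A"
        using U(3)[OF U(4)[OF j(1)]] imageI[OF that, of "\<lambda>x. - j + x"]
        by (auto simp: add.assoc[symmetric])
      moreover have "j + x \<in> W" if "x \<in> A" using U(3)[OF j(1)] that by auto
      ultimately show ?thesis by (auto simp: indicator_def)
    qed
    have "(\<integral>\<^sup>+ x. ennreal \<bar>indicator A (j + x) - indicator A x\<bar> \<partial>M) \<le>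
        (\<integral>\<^sup>+ x. indicator (W - A) x + indicator (W - A) (j + x) \<partial>M)"
      by (intro nn_integral_mono 1)
    also have "\<dots> = emeasure M (W - A) + (\<integral>\<^sup>+ x. indicator (W - A) (j + x) \<partial>M)"
      by (subst nn_integral_add) auto
    also have "\<dots> = emeasure M (W - A) + emeasure M (W - A)"
      by (subst nn_integral_translate[OF j(2)]) auto
    also have "\<dots> \<le> ennreal (e / 2) + ennreal (e / 2)" using W(3) by (intro add_mono) auto
    also have "\<dots> = ennreal e" using e by (subst ennreal_plus[symmetric]) auto
    finally show ?thesis .
  qed
  then show thesis using that U by blast
qed

end

subsection \<open>A Borel section of the coset space and Haar measure on a closed subgroup\<close>

text \<open>A measurable choice of a point in a compact set \<open>C\<close>: run through a countable base and remove
  \<open>B n\<close> whenever something is left. Whether the chosen point lies in \<open>B n\<close> is then decided by step \<open>n\<close>.\<close>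

primrec refine :: "(nat \<Rightarrow> 'a set) \<Rightarrow> 'a set \<Rightarrow> nat \<Rightarrow> 'a set" where
  "refine B C 0 = C"
| "refine B C (Suc n) = (if refine B C n - B n = {} then refine B C n else refine B C n - B n)"

definition pick :: "(nat \<Rightarrow> 'a set) \<Rightarrow> 'a set \<Rightarrow> 'a" where
  "pick B C = (SOME x. x \<in> (\<Inter>n. refine B C n))"

text \<open>Decreasing stages let the finite intersection property produce a common point.\<close>

lemma refine_antimono: "m \<le> n \<Longrightarrow> refine B C n \<subseteq> refine B C m"
  by (rule lift_Suc_antimono_le[of "refine B C"]) auto

lemma pick_in_refine:
  fixes C :: "'a::t2_space set"
  assumes C: "compact C" "C \<noteq> {}" and B: "\<And>n. open (B n)"
  shows "pick B C \<in> refine B C n"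
proof -
  have ne: "refine B C n \<noteq> {}" for n by (induction n) (use C in auto)
  have cl: "closed (refine B C n)" for n
    by (induction n) (use C B in \<open>auto intro: compact_imp_closed closed_Diff\<close>)
  have "C \<inter> \<Inter> (range (refine B C)) \<noteq> {}"
  proof (rule compact_imp_fip[OF C(1)])
    fix F assume F: "finite F" "F \<subseteq> range (refine B C)"
    then obtain I where I: "finite I" "F = refine B C ` I" by (meson finite_subset_image)
    obtain m where m: "I \<subseteq> {..m}" using I(1) by (meson finite_nat_iff_bounded_le)
    have "refine B C m \<subseteq> C \<inter> \<Inter> F"
      using refine_antimono[of 0 m B C] refine_antimono[of _ m B C] m by (auto simp: I(2) subset_iff)
    with ne[of m] show "C \<inter> \<Inter> F \<noteq> {}" by blast
  qed (use cl in auto)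
  then have "\<exists>x. x \<in> (\<Inter>n. refine B C n)" by blast
  then have "pick B C \<in> (\<Inter>n. refine B C n)" unfolding pick_def by (rule someI_ex)
  then show ?thesis by blast
qed

lemma pick_in_iff:
  fixes C :: "'a::t2_space set"
  assumes "compact C" "C \<noteq> {}" and "\<And>n. open (B n)"
  shows "pick B C \<in> B n \<longleftrightarrow> refine B C n - B n = {}"
proof -
  have "pick B C \<in> refine B C m" for m by (rule pick_in_refine[OF assms])
  from this[of n] this[of "Suc n"] show ?thesis by (auto split: if_splits)
qed

text \<open>The induction carries the property that hitting a closed set is a measurable condition
  through the stages: the test made at stage n is itself such a condition, for the complement of
  \<open>B n\<close>.\<close>

lemma measurable_pick:
  fixes C :: "'b \<Rightarrow> 'a::{t2_space, second_countable_topology} set"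
  assumes basis: "topological_basis (range B)"
    and C: "\<And>x. x \<in> space M \<Longrightarrow> compact (C x)" "\<And>x. x \<in> space M \<Longrightarrow> C x \<noteq> {}"
    and hit: "\<And>Z. closed Z \<Longrightarrow> {x \<in> space M. C x \<inter> Z \<noteq> {}} \<in> sets M"
  shows "(\<lambda>x. pick B (C x)) \<in> borel_measurable M"
proof -
  have oB: "open (B n)" for n using basis by (auto intro: topological_basis_open)
  have hitn: "{x \<in> space M. refine B (C x) n \<inter> Z \<noteq> {}} \<in> sets M" if "closed Z" for n Z
    using that
  proof (induction n arbitrary: Z)
    case 0
    then show ?case using hit by simp
  next
    case (Suc n)
    have c: "closed (- B n)" "closed (Z - B n)" using oB Suc.prems by (auto intro: closed_Diff)
    have "{x \<in> space M. refine B (C x) (Suc n) \<inter> Z \<noteq> {}} =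
        ({x \<in> space M. refine B (C x) n \<inter> - B n \<noteq> {}} \<inter> {x \<in> space M. refine B (C x) n \<inter> (Z - B n) \<noteq> {}}) \<union>
        ((space M - {x \<in> space M. refine B (C x) n \<inter> - B n \<noteq> {}}) \<inter> {x \<in> space M. refine B (C x) n \<inter> Z \<noteq> {}})"
      by (auto split: if_splits)
    also have "\<dots> \<in> sets M" using Suc.IH Suc.prems c by (intro sets.Un sets.Int sets.compl_sets) auto
    finally show ?case .
  qed
  have pB: "{x \<in> space M. pick B (C x) \<in> B n} \<in> sets M" for n
  proof -
    have "{x \<in> space M. pick B (C x) \<in> B n} = space M - {x \<in> space M. refine B (C x) n \<inter> - B n \<noteq> {}}"
      using pick_in_iff[where B=B, OF C oB] by (intro set_eqI) (auto simp: Diff_eq)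
    also have "\<dots> \<in> sets M" using hitn[of "- B n"] oB by auto
    finally show ?thesis .
  qed
  show ?thesis
  proof (rule borel_measurableI)
    fix S :: "'a set" assume "open S"
    with basis have "\<exists>F. F \<subseteq> range B \<and> \<Union> F = S"
      unfolding topological_basis_def by blast
    then obtain F where F: "F \<subseteq> range B" "\<Union> F = S" by blast
    have "(\<lambda>x. pick B (C x)) -` S \<inter> space M = (\<Union>n\<in>{n. B n \<in> F}. {x \<in> space M. pick B (C x) \<in> B n})"
      using F by auto
    also have "\<dots> \<in> sets M" using pB by (intro sets.countable_UN') auto
    finally show "(\<lambda>x. pick B (C x)) -` S \<inter> space M \<in> sets M" .
  qed
qed

text \<open>Each coset H + x is represented by a point picked from its part in the first
  \<open>D n\<close> that it meets; this part is compact and depends on the coset alone.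
  Measurability holds because the coset meets a compact Z iff x lies in the closed set H + Z. The
  index \<open>k\<close> is returned as well, to serve as the variable of an invariant
  weight.\<close>

lemma borel_section:
  fixes H :: "'a::{topological_group_add, t2_space, second_countable_topology} set"
  assumes H: "subgroup_add H" "closed H"
    and D: "\<And>n::nat. compact (D n)" "incseq D" "(\<Union>n. D n) = UNIV"
  obtains s :: "'a \<Rightarrow> 'a" and k :: "'a \<Rightarrow> nat" where
    "s \<in> borel_measurable borel" "k \<in> measurable borel (count_space UNIV)"
    "\<And>x. x - s x \<in> H" "\<And>x. s x \<in> D (k x)"
    "\<And>h x. h \<in> H \<Longrightarrow> s (h + x) = s x" "\<And>h x. h \<in> H \<Longrightarrow> k (h + x) = k x"
proof -
  obtain \<B> :: "'a set set" where \<B>: "countable \<B>" "topological_basis \<B>"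
    using ex_countable_basis by blast
  define B where "B = from_nat_into \<B>"
  have "\<B> \<noteq> {}" using \<B>(2) unfolding topological_basis_def by (metis Sup_empty empty_not_UNIV open_UNIV subset_empty)
  then have basis: "topological_basis (range B)" using \<B> by (simp add: B_def range_from_nat_into)
  have oB: "open (B n)" for n using basis by (auto intro: topological_basis_open)
  define R where "R = (\<lambda>x. {y. y - x \<in> H})"
  have Radd: "R (h + x) = R x" if "h \<in> H" for h x
  proof -
    have "y - (h + x) \<in> H \<longleftrightarrow> y - x \<in> H" for y
    proof -
      have e: "y - (h + x) = (y - x) + - h" by (simp add: diff_conv_add_uminus minus_add add.assoc del: add_uminus_conv_diff)
      have e': "y - x = (y - (h + x)) + h" by (simp add: e add.assoc)
      show ?thesis using that subgroup_addD[OF H(1)] e e' by metis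
    qed
    then show ?thesis by (simp add: R_def)
  qed
  have Rcl: "closed (R x)" for x
  proof -
    have "closed ((\<lambda>y. y - x) -` H)" by (intro closed_vimage H continuous_intros)
    then show ?thesis by (simp add: R_def vimage_def)
  qed
  have hitR: "R x \<inter> Z \<noteq> {} \<longleftrightarrow> x \<in> set_add H Z" for x Z
  proof -
    have "y - x \<in> H \<longleftrightarrow> x - y \<in> H" for y
      using subgroup_addD(3)[OF H(1), of "y - x"] subgroup_addD(3)[OF H(1), of "x - y"] by auto
    then show ?thesis by (auto simp: R_def mem_set_add_iff)
  qed
  define k where "k = (\<lambda>x. LEAST n. R x \<inter> D n \<noteq> {})"
  have exk: "\<exists>n. R x \<inter> D n \<noteq> {}" for x
  proof -
    obtain n where "x \<in> D n" using D(3) by blast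
    then have "x \<in> R x \<inter> D n" using subgroup_addD(1)[OF H(1)] by (simp add: R_def)
    then show ?thesis by blast
  qed
  have kD: "R x \<inter> D (k x) \<noteq> {}" for x unfolding k_def by (rule LeastI_ex[OF exk])
  have kadd: "k (h + x) = k x" if "h \<in> H" for h x by (simp add: k_def Radd[OF that])
  have kle: "k x \<le> m \<longleftrightarrow> x \<in> set_add H (D m)" for x m
  proof
    assume "k x \<le> m"
    then have "D (k x) \<subseteq> D m" using D(2) by (simp add: incseqD)
    with kD[of x] show "x \<in> set_add H (D m)" unfolding hitR[symmetric] by blast
  next
    assume "x \<in> set_add H (D m)"
    then show "k x \<le> m" unfolding hitR[symmetric] k_def by (rule Least_le)
  qed
  have kmeas[measurable]: "k \<in> measurable borel (count_space UNIV)"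
  proof (rule measurable_count_space_eq2_countable[THEN iffD2])
    have m: "{x. k x \<le> m} \<in> sets borel" for m
      unfolding kle using closed_set_add[OF H(2) D(1)] by simp
    have "{x. k x = m} \<in> sets borel" for m
    proof (cases m)
      case 0
      then show ?thesis using m[of 0] by simp
    next
      case (Suc l)
      have "{x. k x = m} = {x. k x \<le> m} - {x. k x \<le> l}" using Suc by auto
      also have "\<dots> \<in> sets borel" using m by auto
      finally show ?thesis .
    qed
    then show "k \<in> space borel \<rightarrow> UNIV \<and> (\<forall>a\<in>UNIV. k -` {a} \<inter> space borel \<in> sets borel)"
      by (auto simp: vimage_def)
  qed
  define C where "C = (\<lambda>x. R x \<inter> D (k x))"
  have C: "compact (C x)" "C x \<noteq> {}" for x
    unfolding C_def using kD Rcl D(1) by (auto intro: closed_Int_compact)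
  define s where "s = (\<lambda>x. pick B (C x))"
  have sC: "s x \<in> C x" for x
    unfolding s_def using pick_in_refine[where B=B and n=0, OF C oB] by simp
  have smeas: "s \<in> borel_measurable borel"
    unfolding s_def
  proof (rule measurable_pick[OF basis])
    fix Z :: "'a set" assume Z: "closed Z"
    have "{x \<in> space borel. C x \<inter> Z \<noteq> {}} = (\<Union>m. {x \<in> space borel. k x = m} \<inter> set_add H (D m \<inter> Z))"
      by (auto simp: C_def hitR[symmetric] Int_assoc)
    also have "\<dots> \<in> sets borel"
      using closed_set_add[OF H(2) compact_Int_closed[OF D(1) Z]]
      by (intro sets.countable_UN'' sets.Int) auto
    finally show "{x \<in> space borel. C x \<inter> Z \<noteq> {}} \<in> sets borel" .
  qed (use C in auto)
  show thesis
  proof (rule that[OF smeas kmeas])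
    show "x - s x \<in> H" for x
    proof -
      have "- (s x - x) \<in> H" using sC[of x] subgroup_addD(3)[OF H(1), of "s x - x"] by (simp add: C_def R_def)
      then show ?thesis by simp
    qed
    show "s x \<in> D (k x)" for x using sC[of x] by (simp add: C_def)
    show "s (h + x) = s x" if "h \<in> H" for h x by (simp add: s_def C_def kadd[OF that] Radd[OF that])
  qed (rule kadd)
qed

text \<open>Writing x as (x - s x) + s x gives \<open>\<sigma>\<close>. It commutes with left
  translation by \<open>H\<close>, so every \<open>H\<close>-invariant weight pushes forward to a
  left invariant measure. The last conclusion makes composition with \<open>\<sigma>\<close> respect
  equality almost everywhere; it holds because the weight is positive.\<close>

lemma haar_measure_on_closed_subgroup:
  fixes H :: "'a::{topological_group_add, t2_space, second_countable_topology} set"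
  assumes "invariant_borel_measure H \<mu>" and H: "closed H" and nz: "emeasure \<mu> UNIV \<noteq> 0"
  obtains \<nu> \<sigma> where "left_haar_measure H \<nu>" "\<sigma> \<in> measurable borel (restrict_space borel H)"
    "\<And>h x. h \<in> H \<Longrightarrow> \<sigma> (h + x) = h + \<sigma> x"
    "\<And>P. (AE y in \<nu>. P y) \<Longrightarrow> (AE x in \<mu>. P (\<sigma> x))"
proof -
  interpret invariant_borel_measure H \<mu> by fact
  obtain D :: "nat \<Rightarrow> 'a set" where D: "\<And>n. compact (D n)" "incseq D"
      "\<And>C. compact C \<Longrightarrow> \<exists>n. C \<subseteq> D n" "(\<Union>n. D n) = UNIV"
    by (rule compact_exhaustion[OF locally_compact]) (rule that)
  obtain s k where s[measurable]: "s \<in> borel_measurable borel"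
      and k[measurable]: "k \<in> measurable borel (count_space UNIV)"
      and sk: "\<And>x. x - s x \<in> H" "\<And>x. s x \<in> D (k x)" "\<And>h x. h \<in> H \<Longrightarrow> s (h + x) = s x"
        "\<And>h x. h \<in> H \<Longrightarrow> k (h + x) = k x"
    by (rule borel_section[OF subgroup H D(1,2,4)]) (rule that)
  define \<sigma> where "\<sigma> = (\<lambda>x. x - s x)"
  have \<sigma>H: "\<sigma> x \<in> H" for x by (simp add: \<sigma>_def sk)
  have \<sigma>add: "\<sigma> (h + x) = h + \<sigma> x" if "h \<in> H" for h x
    by (simp add: \<sigma>_def sk(3)[OF that] add_diff_eq)
  have "(\<lambda>x. x + - s x) \<in> borel_measurable borel" by measurable
  then have \<sigma>b[measurable]: "\<sigma> \<in> borel_measurable borel" by (simp add: \<sigma>_def)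
  have \<sigma>m[measurable]: "\<sigma> \<in> measurable borel (restrict_space borel H)"
    using \<sigma>H by (intro measurable_restrict_space2) auto
  define Mn where "Mn = (\<lambda>n. measure \<mu> (set_add (D n) (D n)))"
  \<comment> \<open>\<open>\<sigma> x \<in> C\<close> puts x into C + D (k x), so the new measure of
    \<open>C\<close> is at most the sum of c n times the measure of C + D n. For \<open>C\<close>
    inside D N these sets lie in D j + D j with j = max n N. The denominator controls the terms n >
    N, and the powers of 1/2 make the series converge.\<close>
  define c where "c = (\<lambda>n. (1/2) ^ n / (1 + Mn n))"
  have Mn: "0 \<le> Mn n" "emeasure \<mu> (set_add (D n) (D n)) = ennreal (Mn n)" for n
    using finite_on_compact[OF compact_set_add[OF D(1) D(1)], of n n]
    by (auto simp: Mn_def emeasure_eq_ennreal_measure)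
  have c: "0 < c n" for n using Mn(1)[of n] by (simp add: c_def)
  define w where "w = (\<lambda>x. ennreal (c (k x)))"
  have [measurable]: "w \<in> borel_measurable borel" unfolding w_def by measurable
  have wpos: "w x \<noteq> 0" for x using c[of "k x"] by (simp add: w_def ennreal_eq_0_iff)
  define \<nu> where "\<nu> = distr (density \<mu> w) (restrict_space borel H) \<sigma>"
  have sets_\<nu>: "sets \<nu> = sets (restrict_space borel H)" by (simp add: \<nu>_def)
  have Hb: "H \<in> sets borel" using H by simp
  have set_iff: "A \<in> sets (restrict_space borel H) \<longleftrightarrow> A \<subseteq> H \<and> A \<in> sets borel" for A
    using Hb by (auto simp: sets_restrict_space_iff)
  have em: "emeasure \<nu> A = (\<integral>\<^sup>+ x. w x * indicator A (\<sigma> x) \<partial>\<mu>)" if "A \<in> sets (restrict_space borel H)" for A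
  proof -
    have Ab[measurable]: "A \<in> sets borel" using that set_iff by blast
    have "emeasure \<nu> A = emeasure (density \<mu> w) (\<sigma> -` A)"
      unfolding \<nu>_def using that by (subst emeasure_distr) auto
    also have "\<dots> = (\<integral>\<^sup>+ x. w x * indicator (\<sigma> -` A) x \<partial>\<mu>)"
      using measurable_sets[OF \<sigma>b Ab] by (subst emeasure_density) auto
    also have "\<dots> = (\<integral>\<^sup>+ x. w x * indicator A (\<sigma> x) \<partial>\<mu>)"
      by (intro nn_integral_cong) (auto simp: indicator_def)
    finally show ?thesis .
  qed
  have "left_haar_measure H \<nu>"
    unfolding left_haar_measure_def
  proof (intro conjI allI impI ballI)
    show "sets \<nu> = sets (restrict_space borel H)" by (rule sets_\<nu>)
    show "emeasure \<nu> H \<noteq> 0"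
    proof
      assume "emeasure \<nu> H = 0"
      moreover have "emeasure \<nu> H = (\<integral>\<^sup>+ x. w x \<partial>\<mu>)"
        using Hb \<sigma>H by (subst em) (auto simp: set_iff)
      ultimately have "AE x in \<mu>. w x = 0" by (simp add: nn_integral_0_iff_AE)
      then have "AE x in \<mu>. False" using wpos by (auto elim!: eventually_mono)
      then have "emeasure \<mu> UNIV = 0" using emeasure_eq_0_AE[of "\<lambda>_. True" \<mu>] by simp
      with nz show False by simp
    qed
  next
    fix C assume C: "compact C \<and> C \<subseteq> H"
    then have Cb[measurable]: "C \<in> sets borel" by (simp add: borel_compact)
    obtain N where N: "C \<subseteq> D N" using C D(3) by blast
    have comp: "compact (set_add C (D n))" for n using C D(1) by (intro compact_set_add) auto
    then have [measurable]: "set_add C (D n) \<in> sets borel" for n by (rule borel_compact)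
    have "emeasure \<nu> C = (\<integral>\<^sup>+ x. w x * indicator C (\<sigma> x) \<partial>\<mu>)"
      using C Cb by (intro em) (simp add: set_iff)
    also have "\<dots> \<le> (\<integral>\<^sup>+ x. (\<Sum>n. ennreal (c n) * indicator (set_add C (D n)) x) \<partial>\<mu>)"
    proof (rule nn_integral_mono)
      fix x
      have "w x * indicator C (\<sigma> x) \<le> ennreal (c (k x)) * indicator (set_add C (D (k x))) x"
        using sk(2)[of x] by (auto simp: w_def indicator_def mem_set_add_iff \<sigma>_def)
      also have "\<dots> = sum (\<lambda>n. ennreal (c n) * indicator (set_add C (D n)) x) {k x}"
        by (subst sum.insert) (simp_all only: finite.emptyI empty_iff not_False_eq_True sum.empty add_0_right)
      also have "\<dots> \<le> (\<Sum>n. ennreal (c n) * indicator (set_add C (D n)) x)"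
        by (rule sum_le_suminf) auto
      finally show "w x * indicator C (\<sigma> x) \<le> (\<Sum>n. ennreal (c n) * indicator (set_add C (D n)) x)" .
    qed
    also have "\<dots> = (\<Sum>n. ennreal (c n) * emeasure \<mu> (set_add C (D n)))"
      by (subst nn_integral_suminf) (auto simp: nn_integral_cmult_indicator)
    also have "\<dots> \<le> (\<Sum>n. ennreal ((1/2) ^ n * (1 + Mn N)))"
    proof (intro suminf_le)
      fix n
      define j where "j = max n N"
      have "set_add C (D n) \<subseteq> set_add (D j) (D j)"
        using N incseqD[OF D(2), of N j] incseqD[OF D(2), of n j] by (fastforce simp: j_def set_add_def)
      then have "emeasure \<mu> (set_add C (D n)) \<le> ennreal (Mn j)"
        unfolding Mn(2)[symmetric] using compact_set_add[OF D(1) D(1)] by (intro emeasure_mono) (auto simp: borel_compact)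
      then have "ennreal (c n) * emeasure \<mu> (set_add C (D n)) \<le> ennreal (c n * Mn j)"
        using c[of n] Mn(1)[of j] by (subst ennreal_mult) (auto intro!: mult_left_mono)
      also have "c n * Mn j \<le> (1/2) ^ n * (1 + Mn N)"
      proof (cases "n \<le> N")
        case True
        then have j: "j = N" by (simp add: j_def)
        have "(1/2) ^ n / (1 + Mn n) \<le> (1/2::real) ^ n / 1"
          using Mn(1)[of n] by (intro divide_left_mono) auto
        then show ?thesis unfolding j c_def using Mn(1)[of N] by (intro mult_mono) auto
      next
        case False
        then have j: "j = n" by (simp add: j_def)
        have "c n * Mn n = (1/2) ^ n * (Mn n / (1 + Mn n))" by (simp add: c_def)
        also have "\<dots> \<le> (1/2) ^ n * 1" using Mn(1)[of n] by (intro mult_left_mono) auto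
        also have "\<dots> \<le> (1/2) ^ n * (1 + Mn N)" using Mn(1)[of N] by (intro mult_left_mono) auto
        finally show ?thesis by (simp add: j)
      qed
      then have "ennreal (c n * Mn j) \<le> ennreal ((1/2) ^ n * (1 + Mn N))" by (rule ennreal_leI)
      finally show "ennreal (c n) * emeasure \<mu> (set_add C (D n)) \<le> ennreal ((1/2) ^ n * (1 + Mn N))" .
    qed auto
    also have "\<dots> < \<infinity>"
    proof -
      have "(\<lambda>n. (1/2) ^ n * (1 + Mn N)) sums (1 / (1 - 1/2) * (1 + Mn N))"
        by (intro sums_mult2 geometric_sums) auto
      then show ?thesis using Mn(1)[of N] by (subst suminf_ennreal_eq) auto
    qed
    finally show "emeasure \<nu> C < \<infinity>" .
  next
    fix h A assume h: "h \<in> H" and A: "A \<in> sets \<nu>"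
    have h': "- h \<in> H" using subgroup_addD(3)[OF subgroup h] .
    have A': "A \<subseteq> H" and [measurable]: "A \<in> sets borel" using A by (auto simp: sets_\<nu> set_iff)
    have "(\<lambda>x. h + x) ` A \<in> sets borel"
      unfolding image_add_left_eq_vimage by (rule measurable_sets_borel[of _ borel]) measurable
    moreover have "(\<lambda>x. h + x) ` A \<subseteq> H" using A' h subgroup_addD(2)[OF subgroup] by auto
    ultimately have "emeasure \<nu> ((\<lambda>x. h + x) ` A) = (\<integral>\<^sup>+ x. w x * indicator ((\<lambda>x. h + x) ` A) (\<sigma> x) \<partial>\<mu>)"
      by (intro em) (simp add: set_iff)
    also have "\<dots> = (\<integral>\<^sup>+ x. w (- h + x) * indicator A (\<sigma> (- h + x)) \<partial>\<mu>)"
      unfolding image_add_left_eq_vimage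
      by (intro nn_integral_cong) (auto simp: w_def sk(4)[OF h'] \<sigma>add[OF h'] indicator_def)
    also have "\<dots> = (\<integral>\<^sup>+ x. w x * indicator A (\<sigma> x) \<partial>\<mu>)"
      using h' by (rule nn_integral_translate) measurable
    also have "\<dots> = emeasure \<nu> A" using A by (intro em[symmetric]) (simp add: sets_\<nu>)
    finally show "emeasure \<nu> ((\<lambda>x. h + x) ` A) = emeasure \<nu> A" .
  qed
  moreover have "AE x in \<mu>. P (\<sigma> x)" if "AE y in \<nu>. P y" for P
  proof -
    have "AE x in density \<mu> w. P (\<sigma> x)"
      using that unfolding \<nu>_def by (rule AE_distrD[rotated]) auto
    then show ?thesis using wpos by (subst (asm) AE_density) (auto simp: zero_less_iff_neq_zero)
  qed
  ultimately show thesis using \<sigma>m \<sigma>add by (intro that)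
qed

subsection \<open>From almost invariant densities to an invariant mean\<close>

lemma ultrafilter_exists:
  fixes F0 :: "'a filter"
  assumes "F0 \<noteq> bot"
  obtains U where "U \<le> F0" "U \<noteq> bot" "\<And>P. eventually P U \<or> eventually (\<lambda>x. \<not> P x) U"
proof -
  define A where "A = {F. F \<le> F0 \<and> F \<noteq> bot}"
  define R where "R = (\<lambda>F G :: 'a filter. G \<le> F)"
  have "partial_order_on A (relation_of R A)"
    by (rule partial_order_on_relation_ofI) (auto simp: R_def)
  moreover have "\<exists>u\<in>A. \<forall>a\<in>C. R a u" if C: "C \<in> Chains (relation_of R A)" for C
  proof (cases "C = {}")
    case True
    then show ?thesis using assms by (auto simp: A_def)
  next
    case False
    have CA: "C \<subseteq> A" and ch: "\<And>a b. a \<in> C \<Longrightarrow> b \<in> C \<Longrightarrow> R a b \<or> R b a"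
      using C by (auto simp: Chains_def relation_of_def)
    have ev: "eventually P (Inf C) \<longleftrightarrow> (\<exists>b\<in>C. eventually P b)" for P
      by (rule eventually_Inf_base[OF False]) (use ch in \<open>auto simp: R_def intro: bexI\<close>)
    have "Inf C \<noteq> bot"
      unfolding trivial_limit_def ev using CA by (auto simp: A_def trivial_limit_def)
    moreover obtain b where "b \<in> C" using False by blast
    then have "Inf C \<le> F0" using CA by (auto simp: A_def intro: Inf_lower2)
    ultimately show ?thesis by (intro bexI[of _ "Inf C"]) (auto simp: A_def R_def intro: Inf_lower)
  qed
  ultimately obtain U where U: "U \<in> A" and Umax: "\<And>F. F \<in> A \<Longrightarrow> R U F \<Longrightarrow> F = U"
    using predicate_Zorn[of A R] by blast
  have "eventually P U \<or> eventually (\<lambda>x. \<not> P x) U" for P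
  proof (rule disjCI)
    assume n: "\<not> eventually (\<lambda>x. \<not> P x) U"
    \<comment> \<open>Unless its negation is eventual, \<open>P\<close> can be adjoined without
      losing properness, and maximality absorbs it.\<close>
    let ?V = "inf U (principal {x. P x})"
    have "?V \<noteq> bot" using n by (simp add: trivial_limit_def eventually_inf_principal)
    moreover have "?V \<le> U" by simp
    ultimately have "?V = U" using U by (intro Umax) (auto simp: A_def R_def intro: order_trans[OF inf_le1])
    moreover have "eventually P ?V" by (simp add: eventually_inf_principal)
    ultimately show "eventually P U" by simp
  qed
  with U show thesis by (intro that[of U]) (auto simp: A_def)
qed

lemma ultrafilter_tendsto:
  fixes f :: "'a \<Rightarrow> real"
  assumes "U \<noteq> bot" and ultra: "\<And>P. eventually P U \<or> eventually (\<lambda>x. \<not> P x) U"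
    and bd: "\<And>x. \<bar>f x\<bar> \<le> C"
  shows "\<exists>l. (f \<longlongrightarrow> l) U"
proof -
  have "filtermap f U \<noteq> bot" using assms(1) by (simp add: filtermap_bot_iff)
  moreover have "eventually (\<lambda>y. y \<in> {-C..C}) (filtermap f U)"
    using bd by (simp add: eventually_filtermap abs_le_iff) (metis always_eventually minus_le_iff)
  ultimately obtain l where l: "inf (nhds l) (filtermap f U) \<noteq> bot"
    using compact_Icc[of "-C" C] unfolding compact_filter by blast
  have "(f \<longlongrightarrow> l) U"
  proof (rule topological_tendstoI)
    fix S assume S: "open S" "l \<in> S"
    have "\<not> eventually (\<lambda>x. f x \<notin> S) U"
    proof
      assume "eventually (\<lambda>x. f x \<notin> S) U"
      then have "eventually (\<lambda>y. y \<notin> S) (filtermap f U)" by (simp add: eventually_filtermap)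
      moreover have "eventually (\<lambda>y. y \<in> S) (nhds l)" using S by (rule eventually_nhds_in_open)
      ultimately have "eventually (\<lambda>y. False) (inf (nhds l) (filtermap f U))"
        unfolding eventually_inf by blast
      with l show False by (simp add: trivial_limit_def)
    qed
    with ultra[of "\<lambda>x. f x \<in> S"] show "eventually (\<lambda>x. f x \<in> S) U" by blast
  qed
  then show ?thesis by blast
qed

context invariant_borel_measure
begin

text \<open>Equivariance of \<open>\<sigma>\<close> and invariance of \<open>M\<close> turn a
  translation of \<open>u\<close> by k into the replacement of \<phi> n x by \<phi> n (k + x), whose
  L1 error tends to 0. Convergence for each single \<open>h\<close> is enough, as invariance of a
  mean concerns one translation at a time.\<close>

lemma amenable_of_densities:
  assumes H: "closed H" and nz: "emeasure M UNIV \<noteq> 0"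
    and [measurable]: "\<And>n::nat. \<phi> n \<in> borel_measurable borel" and nn: "\<And>n x. 0 \<le> \<phi> n x"
    and int1: "\<And>n. (\<integral>\<^sup>+ x. ennreal (\<phi> n x) \<partial>M) = 1"
    and ai: "\<And>h. h \<in> H \<Longrightarrow> (\<lambda>n. \<integral>\<^sup>+ x. ennreal \<bar>\<phi> n (h + x) - \<phi> n x\<bar> \<partial>M) \<longlonglongrightarrow> 0"
  shows "amenable H"
proof -
  obtain \<nu> \<sigma> where \<nu>: "left_haar_measure H \<nu>" and \<sigma>: "\<sigma> \<in> measurable borel (restrict_space borel H)"
    and \<sigma>add: "\<And>h x. h \<in> H \<Longrightarrow> \<sigma> (h + x) = h + \<sigma> x"
    and \<sigma>AE: "\<And>P. (AE y in \<nu>. P y) \<Longrightarrow> (AE x in M. P (\<sigma> x))"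
    by (rule haar_measure_on_closed_subgroup[OF invariant_borel_measure_axioms H nz]) (rule that)
  have sets_\<nu>: "sets \<nu> = sets (restrict_space borel H)"
    using \<nu> by (simp add: left_haar_measure_def)
  have u\<sigma>: "(\<lambda>x. u (\<sigma> x)) \<in> borel_measurable borel" if "u \<in> L_infinity \<nu>" for u
  proof -
    have "u \<in> borel_measurable (restrict_space borel H)"
      using that by (simp add: L_infinity_def measurable_cong_sets[OF sets_\<nu> refl])
    then show ?thesis using \<sigma> by (rule measurable_compose[rotated])
  qed
  have bd: "\<exists>C. AE x in M. \<bar>u (\<sigma> x)\<bar> \<le> C" if "u \<in> L_infinity \<nu>" for u
    using that \<sigma>AE by (fastforce simp: L_infinity_def)
  have int\<phi>: "integrable M (\<phi> n)" for n
    by (rule integrableI_nonneg) (auto simp: nn int1)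
  have i\<phi>: "(\<integral>x. \<phi> n x \<partial>M) = 1" for n
    by (subst integral_eq_nn_integral) (auto simp: nn int1)
  have int: "integrable M (\<lambda>x. k x * u (\<sigma> x))" if uk: "u \<in> L_infinity \<nu>" "integrable M k" for k u
  proof -
    obtain C where C: "AE x in M. \<bar>u (\<sigma> x)\<bar> \<le> C" using bd uk(1) by blast
    note [measurable] = u\<sigma>[OF uk(1)]
    have [measurable]: "k \<in> borel_measurable borel" using uk(2) by auto
    show ?thesis
    proof (rule Bochner_Integration.integrable_bound)
      show "integrable M (\<lambda>x. C * k x)" using uk by simp
      show "AE x in M. norm (k x * u (\<sigma> x)) \<le> norm (C * k x)"
        using C by eventually_elim (auto simp: abs_mult mult.commute[of C] intro!: mult_left_mono)
    qed simp
  qed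
  have ibd: "\<bar>\<integral>x. k x * u (\<sigma> x) \<partial>M\<bar> \<le> C * (\<integral>x. \<bar>k x\<bar> \<partial>M)"
    if "u \<in> L_infinity \<nu>" "integrable M k" "AE x in M. \<bar>u (\<sigma> x)\<bar> \<le> C" for u k C
  proof -
    have "\<bar>\<integral>x. k x * u (\<sigma> x) \<partial>M\<bar> \<le> (\<integral>x. \<bar>k x * u (\<sigma> x)\<bar> \<partial>M)" by (rule integral_abs_bound)
    also have "\<dots> \<le> (\<integral>x. C * \<bar>k x\<bar> \<partial>M)"
    proof (rule integral_mono_AE)
      show "integrable M (\<lambda>x. \<bar>k x * u (\<sigma> x)\<bar>)" using int[OF that(1,2)] by simp
      show "AE x in M. \<bar>k x * u (\<sigma> x)\<bar> \<le> C * \<bar>k x\<bar>"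
        using that(3) by eventually_elim (auto simp: abs_mult mult.commute[of C] intro!: mult_left_mono)
    qed (use that in auto)
    finally show ?thesis by simp
  qed
  \<comment> \<open>Finer than \<open>sequentially\<close>, so ordinary limits persist; an
    ultrafilter, so every bounded sequence of integrals converges.\<close>
  obtain U :: "nat filter" where U: "U \<le> sequentially" "U \<noteq> bot"
      "\<And>P. eventually P U \<or> eventually (\<lambda>x. \<not> P x) U"
    by (rule ultrafilter_exists[OF sequentially_bot]) (rule that)
  define I where "I = (\<lambda>u n. \<integral>x. \<phi> n x * u (\<sigma> x) \<partial>M)"
  define m where "m = (\<lambda>u. Lim U (I u))"
  have conv: "(I u \<longlongrightarrow> m u) U" if u: "u \<in> L_infinity \<nu>" for u
  proof -
    obtain C where C: "AE x in M. \<bar>u (\<sigma> x)\<bar> \<le> C" using bd u by blast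
    have "\<bar>I u n\<bar> \<le> C" for n
      using ibd[OF u int\<phi> C, of n] i\<phi>[of n] nn by (simp add: I_def)
    then obtain l where l: "(I u \<longlongrightarrow> l) U"
      using ultrafilter_tendsto[OF U(2,3), of "I u" C] by blast
    then have "m u = l" unfolding m_def using U(2) by (intro tendsto_Lim)
    with l show ?thesis by simp
  qed
  have uniq: "m u = l" if "(I u \<longlongrightarrow> l) U" for u l
    unfolding m_def using U(2) that by (intro tendsto_Lim)
  have "mean_on_L_infinity \<nu> m"
    unfolding mean_on_L_infinity_def
  proof (intro conjI ballI allI impI)
    fix f g assume fg: "f \<in> L_infinity \<nu>" "g \<in> L_infinity \<nu>"
    show "m f = m g" if "AE x in \<nu>. f x = g x"
    proof -
      have "I f n = I g n" for n
        unfolding I_def using \<sigma>AE[OF that] u\<sigma>[OF fg(1)] u\<sigma>[OF fg(2)]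
        by (intro integral_cong_AE) (auto elim!: eventually_mono)
      then have "I f = I g" by blast
      then show ?thesis by (simp add: m_def)
    qed
    have "I (\<lambda>x. f x + g x) = (\<lambda>n. I f n + I g n)"
      unfolding I_def using int[OF fg(1) int\<phi>] int[OF fg(2) int\<phi>] by (simp add: distrib_left)
    then show "m (\<lambda>x. f x + g x) = m f + m g"
      using tendsto_add[OF conv[OF fg(1)] conv[OF fg(2)]] by (intro uniq) simp
  next
    fix c f assume f: "f \<in> L_infinity \<nu>"
    have "I (\<lambda>x. c * f x) = (\<lambda>n. c * I f n)"
      unfolding I_def by (simp add: mult.left_commute)
    then show "m (\<lambda>x. c * f x) = c * m f"
      using tendsto_mult[OF tendsto_const conv[OF f], of c] by (intro uniq) simp
  next
    fix f assume f: "f \<in> L_infinity \<nu>" "AE x in \<nu>. 0 \<le> f x"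
    have "0 \<le> I f n" for n
      unfolding I_def using \<sigma>AE[OF f(2)] nn by (intro integral_nonneg_AE) (auto elim!: eventually_mono)
    then show "0 \<le> m f" using U(2) by (intro tendsto_lowerbound[OF conv[OF f(1)]]) auto
  next
    show "m (\<lambda>x. 1) = 1" by (rule uniq) (simp add: I_def i\<phi>)
  qed
  moreover have "m (left_regular k u) = m u" if k: "k \<in> H" and u: "u \<in> L_infinity \<nu>" for k u
  proof (rule uniq)
    note [measurable] = u\<sigma>[OF u]
    have k': "- k \<in> H" using subgroup_addD(3)[OF subgroup k] .
    obtain C where C: "AE x in M. \<bar>u (\<sigma> x)\<bar> \<le> C" using bd u by blast
    define d where "d = (\<lambda>n. \<integral>x. \<bar>\<phi> n (k + x) - \<phi> n x\<bar> \<partial>M)"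
    have intd: "integrable M (\<lambda>x. \<phi> n (k + x) - \<phi> n x)" for n
      using integrable_translate[OF k int\<phi>] int\<phi> by simp
    have "ennreal (d n) = (\<integral>\<^sup>+ x. ennreal \<bar>\<phi> n (k + x) - \<phi> n x\<bar> \<partial>M)" for n
      unfolding d_def using intd[of n] by (intro nn_integral_eq_integral[symmetric]) auto
    then have "(\<lambda>n. ennreal (d n)) \<longlonglongrightarrow> ennreal 0" using ai[OF k] by simp
    then have "d \<longlonglongrightarrow> 0" by (subst (asm) tendsto_ennreal_iff) (auto simp: d_def)
    then have dU: "((\<lambda>n. C * d n) \<longlongrightarrow> C * 0) U"
      using U(1) by (intro tendsto_intros tendsto_mono[OF U(1)])
    have "I (left_regular k u) n = (\<integral>x. \<phi> n (k + x) * u (\<sigma> x) \<partial>M)" for n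
    proof -
      have "I (left_regular k u) n = (\<integral>x. \<phi> n (k + (- k + x)) * u (\<sigma> (- k + x)) \<partial>M)"
        by (simp add: I_def left_regular_def \<sigma>add[OF k'] add.assoc[symmetric])
      also have "\<dots> = (\<integral>x. \<phi> n (k + x) * u (\<sigma> x) \<partial>M)"
        using k' by (rule integral_translate) measurable
      finally show ?thesis .
    qed
    then have "I (left_regular k u) n - I u n = (\<integral>x. (\<phi> n (k + x) - \<phi> n x) * u (\<sigma> x) \<partial>M)" for n
      using int[OF u integrable_translate[OF k int\<phi>]] int[OF u int\<phi>]
      by (simp add: I_def left_diff_distrib)
    then have le: "norm (I (left_regular k u) n - I u n) \<le> C * d n" for n
      using ibd[OF u intd C, of n] by (simp add: d_def)
    have "((\<lambda>n. I (left_regular k u) n - I u n) \<longlongrightarrow> 0) U"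
      by (rule Lim_null_comparison[OF always_eventually[OF allI[OF le]]]) (use dU in simp)
    from tendsto_add[OF this conv[OF u]] show "(I (left_regular k u) \<longlongrightarrow> m u) U" by simp
  qed
  ultimately show ?thesis unfolding amenable_def using \<nu> by blast
qed

end

subsection \<open>From an invariant mean to almost invariant densities\<close>

text \<open>\<open>N\<close> stands for a Haar measure of \<open>H\<close>, regarded as a measure on
  the whole group concentrated on \<open>H\<close>. With both measures on one type, averaging over
  \<open>H\<close> is integration in v of an expression in v and x.\<close>

locale two_invariant_measures =
  N: invariant_borel_measure H N + M: invariant_borel_measure H M
  for H :: "'a::{topological_group_add, t2_space, second_countable_topology} set" and N M +
  assumes closed_H: "closed H" and N_null: "emeasure N (- H) = 0"
    and N_pos: "open W \<Longrightarrow> 0 \<in> W \<Longrightarrow> emeasure N W \<noteq> 0"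
begin

sublocale sN: sigma_finite_measure N by (rule N.sigma_finite_M)
sublocale sM: sigma_finite_measure M by (rule M.sigma_finite_M)
sublocale NM: pair_sigma_finite N M ..
sublocale NN: pair_sigma_finite N N ..

lemma AE_H: "AE v in N. v \<in> H"
  using closed_H N_null by (intro AE_I[of _ _ "- H"]) auto

text \<open>Boundedness makes the integrand of an average integrable for every x and not merely
  almost every x, so identities between averages hold pointwise.\<close>

definition BI :: "('a \<Rightarrow> real) set" where
  "BI = {f \<in> borel_measurable borel. integrable M f \<and> (\<exists>B. \<forall>x. \<bar>f x\<bar> \<le> B)}"

definition nrm :: "('a \<Rightarrow> real) \<Rightarrow> real" where
  "nrm f = (\<integral>x. \<bar>f x\<bar> \<partial>M)"

lemma BI_measurable: "f \<in> BI \<Longrightarrow> f \<in> borel_measurable borel"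
  and BI_integrable: "f \<in> BI \<Longrightarrow> integrable M f"
  and BI_bounded: "f \<in> BI \<Longrightarrow> \<exists>B. \<forall>x. \<bar>f x\<bar> \<le> B"
  by (auto simp: BI_def)

lemma BI_add: assumes "f \<in> BI" "g \<in> BI" shows "(\<lambda>x. f x + g x) \<in> BI"
proof -
  obtain A B where "\<And>x. \<bar>f x\<bar> \<le> A" "\<And>x. \<bar>g x\<bar> \<le> B" using assms BI_bounded by metis
  then have "\<forall>x. \<bar>f x + g x\<bar> \<le> A + B" by (auto intro: order_trans[OF abs_triangle_ineq] add_mono)
  with assms show ?thesis by (auto simp: BI_def)
qed

lemma BI_cmult: assumes "f \<in> BI" shows "(\<lambda>x. c * f x) \<in> BI"
proof -
  obtain A where "\<And>x. \<bar>f x\<bar> \<le> A" using assms BI_bounded by metis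
  then have "\<forall>x. \<bar>c * f x\<bar> \<le> \<bar>c\<bar> * A" by (auto simp: abs_mult intro: mult_left_mono)
  with assms show ?thesis by (auto simp: BI_def)
qed

lemma BI_zero: "(\<lambda>x. 0) \<in> BI" by (auto simp: BI_def)

lemma BI_diff: "f \<in> BI \<Longrightarrow> g \<in> BI \<Longrightarrow> (\<lambda>x. f x - g x) \<in> BI"
  using BI_add[OF _ BI_cmult[of g "-1"], of f] by simp

lemma BI_sum: "(\<And>i. i \<in> I \<Longrightarrow> f i \<in> BI) \<Longrightarrow> (\<lambda>x. \<Sum>i\<in>I. f i x) \<in> BI"
  by (induction I rule: infinite_finite_induct) (auto simp: BI_zero intro: BI_add)

lemma BI_translate: assumes "h \<in> H" "f \<in> BI" shows "(\<lambda>x. f (h + x)) \<in> BI"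
proof -
  have [measurable]: "f \<in> borel_measurable borel" using assms by (auto simp: BI_def)
  have "(\<lambda>x. f (h + x)) \<in> borel_measurable borel" by measurable
  with assms M.integrable_translate[OF assms(1), of f] show ?thesis by (auto simp: BI_def)
qed

lemma nrm_translate: assumes "h \<in> H" "f \<in> BI" shows "nrm (\<lambda>x. f (h + x)) = nrm f"
proof -
  note [measurable] = BI_measurable[OF assms(2)]
  show ?thesis unfolding nrm_def by (rule M.integral_translate[OF assms(1)]) measurable
qed

lemma nrm_nonneg: "0 \<le> nrm f" by (simp add: nrm_def)

lemma nrm_add: assumes "f \<in> BI" "g \<in> BI" shows "nrm (\<lambda>x. f x + g x) \<le> nrm f + nrm g"
proof -
  have "nrm (\<lambda>x. f x + g x) \<le> (\<integral>x. \<bar>f x\<bar> + \<bar>g x\<bar> \<partial>M)"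
    unfolding nrm_def using assms BI_integrable by (intro integral_mono) auto
  then show ?thesis unfolding nrm_def using assms BI_integrable by simp
qed

lemma nrm_cmult: "nrm (\<lambda>x. c * f x) = \<bar>c\<bar> * nrm f"
  by (simp add: nrm_def abs_mult)

lemma nrm_eq_nn_integral: "f \<in> BI \<Longrightarrow> (\<integral>\<^sup>+ x. ennreal \<bar>f x\<bar> \<partial>M) = ennreal (nrm f)"
  unfolding nrm_def using BI_integrable[of f] by (intro nn_integral_eq_integral) auto

lemma integrable_kernel:
  assumes k: "integrable N k" and f: "f \<in> BI" and [measurable]: "s \<in> borel_measurable borel"
  shows "integrable N (\<lambda>v. k v * f (s v + x))"
proof -
  obtain B where B: "\<And>x. \<bar>f x\<bar> \<le> B" using BI_bounded[OF f] by blast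
  note [measurable] = BI_measurable[OF f]
  have [measurable]: "k \<in> borel_measurable borel" using k by auto
  show ?thesis
  proof (rule Bochner_Integration.integrable_bound)
    show "integrable N (\<lambda>v. B * k v)" using k by simp
    have "\<bar>k v * f (s v + x)\<bar> \<le> \<bar>B * k v\<bar>" for v
      using mult_left_mono[OF order_trans[OF B abs_ge_self], of "\<bar>k v\<bar>" "s v + x"]
      by (simp add: abs_mult mult.commute)
    then show "AE v in N. norm (k v * f (s v + x)) \<le> norm (B * k v)" by simp
  qed simp
qed

text \<open>The norm of an average is at most the average of the norms, by Fubini. At points x with
  a non-integrable slice the Bochner integral is 0 and the bound trivial. Restricting the control of
  \<open>F v\<close> to v in \<open>H\<close> with k v \<noteq> 0 lets the support of
  \<open>k\<close> localise v.\<close>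

lemma minkowski_integral_inequality:
  assumes [measurable]: "k \<in> borel_measurable borel"
    and F[measurable]: "(\<lambda>(v, x). F v x) \<in> borel_measurable (N \<Otimes>\<^sub>M M)"
    and kint: "integrable N k" and g: "g \<in> BI" "\<And>x. g x = (\<integral>v. k v * F v x \<partial>N)"
    and C: "0 \<le> C" "\<And>v. v \<in> H \<Longrightarrow> k v \<noteq> 0 \<Longrightarrow> F v \<in> BI \<and> nrm (F v) \<le> C"
  shows "nrm g \<le> (\<integral>v. \<bar>k v\<bar> \<partial>N) * C"
proof -
  have pt: "ennreal \<bar>g x\<bar> \<le> (\<integral>\<^sup>+ v. ennreal \<bar>k v * F v x\<bar> \<partial>N)" for x
  proof (cases "integrable N (\<lambda>v. k v * F v x)")
    case True
    then show ?thesis using integral_norm_bound_ennreal[OF True] by (simp add: g(2))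
  qed (simp add: g(2) not_integrable_integral_eq)
  have "ennreal (nrm g) = (\<integral>\<^sup>+ x. ennreal \<bar>g x\<bar> \<partial>M)" using g(1) by (simp add: nrm_eq_nn_integral)
  also have "\<dots> \<le> (\<integral>\<^sup>+ x. \<integral>\<^sup>+ v. ennreal \<bar>k v * F v x\<bar> \<partial>N \<partial>M)" by (intro nn_integral_mono pt)
  also have "\<dots> = (\<integral>\<^sup>+ v. \<integral>\<^sup>+ x. ennreal \<bar>k v * F v x\<bar> \<partial>M \<partial>N)"
    by (rule NM.Fubini') measurable
  also have "\<dots> \<le> (\<integral>\<^sup>+ v. ennreal \<bar>k v\<bar> * ennreal C \<partial>N)"
  proof (rule nn_integral_mono_AE)
    show "AE v in N. (\<integral>\<^sup>+ x. ennreal \<bar>k v * F v x\<bar> \<partial>M) \<le> ennreal \<bar>k v\<bar> * ennreal C"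
      using AE_H
    proof eventually_elim
      case (elim v)
      show ?case
      proof (cases "k v = 0")
        case False
        then have Fv: "F v \<in> BI" "nrm (F v) \<le> C" using C elim by auto
        note [measurable] = BI_measurable[OF Fv(1)]
        have "(\<integral>\<^sup>+ x. ennreal \<bar>k v * F v x\<bar> \<partial>M) = (\<integral>\<^sup>+ x. ennreal \<bar>k v\<bar> * ennreal \<bar>F v x\<bar> \<partial>M)"
          by (simp add: abs_mult ennreal_mult)
        also have "\<dots> = ennreal \<bar>k v\<bar> * ennreal (nrm (F v))"
          using nrm_eq_nn_integral[OF Fv(1)] by (subst nn_integral_cmult) auto
        also have "\<dots> \<le> ennreal \<bar>k v\<bar> * ennreal C" using Fv(2) by (intro mult_left_mono ennreal_leI) auto
        finally show ?thesis .
      qed simp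
    qed
  qed
  also have "\<dots> = ennreal (\<integral>v. \<bar>k v\<bar> \<partial>N) * ennreal C"
    using kint by (subst nn_integral_multc) (auto simp: nn_integral_eq_integral)
  finally have "ennreal (nrm g) \<le> ennreal ((\<integral>v. \<bar>k v\<bar> \<partial>N) * C)"
    using C(1) by (simp add: ennreal_mult)
  then show ?thesis using C(1) by (subst (asm) ennreal_le_iff) auto
qed

text \<open>With s = \<open>uminus\<close> this is convolution over \<open>H\<close>: a left
  translation of the result becomes one of the kernel. With s the identity, a left translation of
  \<open>f\<close> becomes one of the kernel. Two forms are used because each of these rules needs
  left invariance of \<open>N\<close> only, and no modular function appears.\<close>

definition avg :: "('a \<Rightarrow> 'a) \<Rightarrow> ('a \<Rightarrow> real) \<Rightarrow> ('a \<Rightarrow> real) \<Rightarrow> 'a \<Rightarrow> real" where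
  "avg s k f x = (\<integral>v. k v * f (s v + x) \<partial>N)"

context
  fixes s :: "'a \<Rightarrow> 'a"
  assumes s[measurable]: "s \<in> borel_measurable borel" and sH: "\<And>v. v \<in> H \<Longrightarrow> s v \<in> H"
begin

lemma avg_BI:
  assumes k: "integrable N k" and f: "f \<in> BI"
  shows "avg s k f \<in> BI"
proof -
  obtain B where B: "\<And>x. \<bar>f x\<bar> \<le> B" using BI_bounded[OF f] by blast
  note [measurable] = BI_measurable[OF f]
  have [measurable]: "k \<in> borel_measurable borel" using k by auto
  have meas: "avg s k f \<in> borel_measurable borel"
    unfolding avg_def by measurable
  have bd: "\<bar>avg s k f x\<bar> \<le> (\<integral>v. B * \<bar>k v\<bar> \<partial>N)" for x
  proof -
    have "\<bar>avg s k f x\<bar> \<le> (\<integral>v. \<bar>k v * f (s v + x)\<bar> \<partial>N)" unfolding avg_def by (rule integral_abs_bound)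
    also have "\<dots> \<le> (\<integral>v. B * \<bar>k v\<bar> \<partial>N)"
    proof (rule integral_mono)
      show "integrable N (\<lambda>v. \<bar>k v * f (s v + x)\<bar>)"
        by (rule integrable_abs[OF integrable_kernel[OF k f s]])
      show "\<bar>k v * f (s v + x)\<bar> \<le> B * \<bar>k v\<bar>" for v
        using B by (simp add: abs_mult mult.commute[of B] mult_left_mono)
    qed (use k in simp)
    finally show ?thesis .
  qed
  have "integrable M (avg s k f)"
  proof (rule integrableI_bounded)
    have "(\<integral>\<^sup>+ x. ennreal (norm (avg s k f x)) \<partial>M) \<le> (\<integral>\<^sup>+ x. \<integral>\<^sup>+ v. ennreal \<bar>k v * f (s v + x)\<bar> \<partial>N \<partial>M)"
      unfolding avg_def using integral_norm_bound_ennreal[OF integrable_kernel[OF k f s]]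
      by (intro nn_integral_mono) simp
    also have "\<dots> = (\<integral>\<^sup>+ v. \<integral>\<^sup>+ x. ennreal \<bar>k v * f (s v + x)\<bar> \<partial>M \<partial>N)"
      by (rule NM.Fubini') measurable
    also have "\<dots> = (\<integral>\<^sup>+ v. ennreal \<bar>k v\<bar> * ennreal (nrm f) \<partial>N)"
    proof (rule nn_integral_cong_AE)
      show "AE v in N. (\<integral>\<^sup>+ x. ennreal \<bar>k v * f (s v + x)\<bar> \<partial>M) = ennreal \<bar>k v\<bar> * ennreal (nrm f)"
        using AE_H
      proof eventually_elim
        case (elim v)
        have "(\<integral>\<^sup>+ x. ennreal \<bar>k v * f (s v + x)\<bar> \<partial>M) = (\<integral>\<^sup>+ x. ennreal \<bar>k v\<bar> * ennreal \<bar>f (s v + x)\<bar> \<partial>M)"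
          by (simp add: abs_mult ennreal_mult)
        also have "\<dots> = ennreal \<bar>k v\<bar> * (\<integral>\<^sup>+ x. ennreal \<bar>f (s v + x)\<bar> \<partial>M)"
          by (rule nn_integral_cmult) measurable
        also have "(\<integral>\<^sup>+ x. ennreal \<bar>f (s v + x)\<bar> \<partial>M) = ennreal (nrm f)"
          using M.nn_integral_translate[OF sH[OF elim], of "\<lambda>x. ennreal \<bar>f x\<bar>"] nrm_eq_nn_integral[OF f] by simp
        finally show ?case .
      qed
    qed
    also have "\<dots> = (\<integral>\<^sup>+ v. ennreal \<bar>k v\<bar> \<partial>N) * ennreal (nrm f)" by (rule nn_integral_multc) measurable
    also have "\<dots> < \<infinity>" using k by (simp add: nn_integral_eq_integral ennreal_mult_less_top)
    finally show "(\<integral>\<^sup>+ x. ennreal (norm (avg s k f x)) \<partial>M) < \<infinity>" .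
  qed (use meas in simp)
  with meas bd show ?thesis unfolding BI_def by blast
qed

lemma nrm_avg_le:
  assumes k: "integrable N k" and f: "f \<in> BI"
  shows "nrm (avg s k f) \<le> (\<integral>v. \<bar>k v\<bar> \<partial>N) * nrm f"
proof (rule minkowski_integral_inequality)
  note [measurable] = BI_measurable[OF f]
  show "(\<lambda>(v, x). f (s v + x)) \<in> borel_measurable (N \<Otimes>\<^sub>M M)" by measurable
  show "k \<in> borel_measurable borel" using k by auto
  show "(\<lambda>x. f (s v + x)) \<in> BI \<and> nrm (\<lambda>x. f (s v + x)) \<le> nrm f" if "v \<in> H" for v
    using BI_translate[OF sH[OF that] f] nrm_translate[OF sH[OF that] f] by simp
qed (use k avg_BI[OF k f] nrm_nonneg in \<open>auto simp: avg_def\<close>)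

lemma avg_diff_kernel:
  assumes "integrable N k" "integrable N k'" and f: "f \<in> BI"
  shows "avg s k f x - avg s k' f x = avg s (\<lambda>v. k v - k' v) f x"
  unfolding avg_def left_diff_distrib
  by (rule Bochner_Integration.integral_diff[symmetric]) (intro integrable_kernel assms s)+

lemma nrm_avg_diff_kernel:
  assumes k: "integrable N k" "integrable N k'" and f: "f \<in> BI"
  shows "nrm (\<lambda>x. avg s k f x - avg s k' f x) \<le> (\<integral>v. \<bar>k v - k' v\<bar> \<partial>N) * nrm f"
  unfolding avg_diff_kernel[OF assms] using k by (intro nrm_avg_le f) auto

end

section \<open>The two averages under translation, and normalised indicators as kernels\<close>

abbreviation "conv \<equiv> avg uminus"
abbreviation "cov \<equiv> avg (\<lambda>v. v)"

lemma uminus_H: "v \<in> H \<Longrightarrow> - v \<in> H"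
  using subgroup_addD(3)[OF N.subgroup] .

lemma add_H: "v \<in> H \<Longrightarrow> w \<in> H \<Longrightarrow> v + w \<in> H"
  using subgroup_addD(2)[OF N.subgroup] .

lemma conv_BI: "integrable N k \<Longrightarrow> f \<in> BI \<Longrightarrow> conv k f \<in> BI"
  by (rule avg_BI) (auto simp: uminus_H)

lemma cov_BI: "integrable N k \<Longrightarrow> f \<in> BI \<Longrightarrow> cov k f \<in> BI"
  by (rule avg_BI) auto

lemma conv_translate:
  assumes g: "g \<in> H" and k: "k \<in> borel_measurable borel" and f: "f \<in> BI"
  shows "conv (\<lambda>u. k (- g + u)) f x = conv k f (- g + x)"
proof -
  note [measurable] = BI_measurable[OF f] k
  have "(\<integral>u. k u * f (- u + (- g + x)) \<partial>N) = (\<integral>u. k (- g + u) * f (- (- g + u) + (- g + x)) \<partial>N)"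
    by (rule N.integral_translate[OF uminus_H[OF g], symmetric]) measurable
  moreover have "- (- g + u) + (- g + x) = - u + x" for u
    by (simp add: minus_add add.assoc)
  ultimately show ?thesis unfolding avg_def by simp
qed

lemma cov_translate:
  assumes g: "g \<in> H" and k: "k \<in> borel_measurable borel" and f: "f \<in> BI"
  shows "cov (\<lambda>v. k (g + v)) f x = cov k (\<lambda>y. f (- g + y)) x"
proof -
  note [measurable] = BI_measurable[OF f] k
  have "(\<integral>v. k v * f (- g + (v + x)) \<partial>N) = (\<integral>v. k (g + v) * f (- g + ((g + v) + x)) \<partial>N)"
    by (rule N.integral_translate[OF g, symmetric]) measurable
  moreover have "- g + ((g + v) + x) = v + x" for v by (simp add: add.assoc)
  ultimately show ?thesis unfolding avg_def by simp
qed

definition unif :: "'a set \<Rightarrow> 'a \<Rightarrow> real" where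
  "unif A x = indicator A x / measure N A"

lemma unif_basic:
  assumes A: "compact A" "emeasure N A \<noteq> 0"
  shows "unif A \<in> borel_measurable borel" "integrable N (unif A)" "0 \<le> unif A x"
    "(\<integral>x. unif A x \<partial>N) = 1" "(\<integral>x. \<bar>unif A x\<bar> \<partial>N) = 1" "0 < measure N A"
proof -
  have [measurable]: "A \<in> sets borel" using A by (simp add: borel_compact)
  have fin: "emeasure N A < \<infinity>" using A N.finite_on_compact by blast
  show pos: "0 < measure N A" using A(2) fin by (simp add: measure_def enn2real_positive_iff zero_less_iff_neq_zero)
  show "unif A \<in> borel_measurable borel" unfolding unif_def by measurable
  show nn: "0 \<le> unif A x" for x by (simp add: unif_def)
  have "integrable N (indicator A :: 'a \<Rightarrow> real)" using fin by (intro integrable_real_indicator) auto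
  then show "integrable N (unif A)" unfolding unif_def by simp
  show "(\<integral>x. unif A x \<partial>N) = 1" unfolding unif_def using pos by simp
  then show "(\<integral>x. \<bar>unif A x\<bar> \<partial>N) = 1" using nn by simp
qed

lemma unif_translate_continuous:
  assumes A: "compact A" "emeasure N A \<noteq> 0" and e: "e > 0"
  obtains U where "open U" "0 \<in> U"
    "\<And>j. j \<in> U \<Longrightarrow> j \<in> H \<Longrightarrow> (\<integral>x. \<bar>unif A (j + x) - unif A x\<bar> \<partial>N) \<le> e"
proof -
  note u = unif_basic[OF A]
  have [measurable]: "A \<in> sets borel" using A by (simp add: borel_compact)
  have e': "e * measure N A > 0" using u(6) e by simp
  obtain U where U: "open U" "0 \<in> U" "\<And>j. j \<in> U \<Longrightarrow> j \<in> H \<Longrightarrow>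
      (\<integral>\<^sup>+ x. ennreal \<bar>indicator A (j + x) - indicator A x\<bar> \<partial>N) \<le> ennreal (e * measure N A)"
    by (rule N.indicator_translate_continuous[OF A(1) e']) (rule that)
  have "(\<integral>x. \<bar>unif A (j + x) - unif A x\<bar> \<partial>N) \<le> e" if j: "j \<in> U" "j \<in> H" for j
  proof -
    have "(\<integral>x. \<bar>unif A (j + x) - unif A x\<bar> \<partial>N) = (\<integral>x. \<bar>indicator A (j + x) - indicator A x\<bar> \<partial>N) / measure N A"
      unfolding unif_def by (simp add: diff_divide_distrib[symmetric])
    also have "(\<integral>x. \<bar>indicator A (j + x) - indicator A x :: real\<bar> \<partial>N) \<le> e * measure N A"
      using U(3)[OF j] e' by (intro integral_real_bounded) auto
    then have "(\<integral>x. \<bar>indicator A (j + x) - indicator A x :: real\<bar> \<partial>N) / measure N A \<le> e"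
      using u(6) by (simp add: pos_divide_le_eq)
    finally show ?thesis .
  qed
  with U(1,2) show thesis by (rule that)
qed

lemma integral_translate_diff:
  fixes k :: "'a \<Rightarrow> real"
  assumes "g \<in> H" and [measurable]: "k \<in> borel_measurable borel"
  shows "(\<integral>v. \<bar>k (a + v) - k (b + v)\<bar> \<partial>N) = (\<integral>v. \<bar>k (a + (g + v)) - k (b + (g + v))\<bar> \<partial>N)"
  by (rule N.integral_translate[OF assms(1), of "\<lambda>v. \<bar>k (a + v) - k (b + v)\<bar>", symmetric]) measurable

text \<open>A left translate of \<open>conv k f\<close> is the convolution with a translated kernel,
  so averaging it over the support of \<open>e\<close> costs only the variation of \<open>k\<close>
  under these translations.\<close>

lemma nrm_cov_conv_diff:
  assumes e: "e \<in> borel_measurable borel" "integrable N e" "\<And>v. 0 \<le> e v" "(\<integral>v. e v \<partial>N) = 1"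
    and k[measurable]: "k \<in> borel_measurable borel" and ki: "integrable N k" and f: "f \<in> BI"
    and \<eta>: "0 \<le> \<eta>" "\<And>v. v \<in> H \<Longrightarrow> e v \<noteq> 0 \<Longrightarrow> (\<integral>u. \<bar>k (v + u) - k u\<bar> \<partial>N) \<le> \<eta>"
  shows "nrm (\<lambda>x. cov e (conv k f) x - conv k f x) \<le> \<eta> * nrm f"
proof -
  note g = conv_BI[OF ki f]
  note [measurable] = BI_measurable[OF g] e(1)
  have "nrm (\<lambda>x. cov e (conv k f) x - conv k f x) \<le> (\<integral>v. \<bar>e v\<bar> \<partial>N) * (\<eta> * nrm f)"
  proof (rule minkowski_integral_inequality[where F="\<lambda>v x. conv k f (v + x) - conv k f x"])
    show "(\<lambda>x. cov e (conv k f) x - conv k f x) \<in> BI" by (intro BI_diff cov_BI e g)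
    show "cov e (conv k f) x - conv k f x = (\<integral>v. e v * (conv k f (v + x) - conv k f x) \<partial>N)" for x
    proof -
      have "integrable N (\<lambda>v. e v * conv k f (v + x))" by (rule integrable_kernel[OF e(2) g]) simp
      then show ?thesis unfolding right_diff_distrib avg_def[of _ e] using e(2,4) by simp
    qed
    fix v assume v: "v \<in> H" "e v \<noteq> 0"
    have kv: "integrable N (\<lambda>u. k (v + u))" by (rule N.integrable_translate[OF v(1) ki])
    have eq: "conv k f (v + x) = conv (\<lambda>u. k (v + u)) f x" for x
      using conv_translate[OF uminus_H[OF v(1)] k f, of x] by simp
    have "nrm (\<lambda>x. conv k f (v + x) - conv k f x) \<le> (\<integral>u. \<bar>k (v + u) - k u\<bar> \<partial>N) * nrm f"
      unfolding eq by (rule nrm_avg_diff_kernel) (auto simp: kv ki f uminus_H)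
    also have "\<dots> \<le> \<eta> * nrm f" using \<eta>(2)[OF v] nrm_nonneg by (intro mult_right_mono)
    finally show "(\<lambda>x. conv k f (v + x) - conv k f x) \<in> BI \<and> nrm (\<lambda>x. conv k f (v + x) - conv k f x) \<le> \<eta> * nrm f"
      using BI_diff[OF BI_translate[OF v(1) g] g] by blast
  qed (use e \<eta>(1) nrm_nonneg in auto)
  then show ?thesis using e by simp
qed

text \<open>Fubini's theorem. The right-hand side is an average of smoothed translates of
  \<open>f\<close>, the form that a Riemann sum approximates.\<close>

lemma cov_conv_swap:
  assumes e: "e \<in> borel_measurable borel" "integrable N e"
    and k: "k \<in> borel_measurable borel" "integrable N k" and f: "f \<in> BI"
  shows "cov e (conv k f) x = (\<integral>u. k u * cov e (\<lambda>y. f (- u + y)) x \<partial>N)"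
proof -
  note [measurable] = BI_measurable[OF f] e(1) k(1)
  obtain B where B: "\<And>x. \<bar>f x\<bar> \<le> B" using BI_bounded[OF f] by blast
  have B0: "0 \<le> B" using B[of 0] by simp
  have "integrable (N \<Otimes>\<^sub>M N) (\<lambda>(v, u). e v * (k u * f (- u + (v + x))))"
  proof (rule integrableI_bounded)
    have "(\<integral>\<^sup>+ p. ennreal (norm (case p of (v, u) \<Rightarrow> e v * (k u * f (- u + (v + x))))) \<partial>(N \<Otimes>\<^sub>M N)) \<le>
        (\<integral>\<^sup>+ p. (case p of (v, u) \<Rightarrow> ennreal \<bar>e v\<bar> * (ennreal B * ennreal \<bar>k u\<bar>)) \<partial>(N \<Otimes>\<^sub>M N))"
    proof (intro nn_integral_mono, clarify)
      fix v u
      have "\<bar>e v * (k u * f (- u + (v + x)))\<bar> \<le> \<bar>e v\<bar> * (B * \<bar>k u\<bar>)"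
        using B by (auto simp: abs_mult mult.commute[of B] intro!: mult_left_mono)
      then show "ennreal (norm (e v * (k u * f (- u + (v + x))))) \<le> ennreal \<bar>e v\<bar> * (ennreal B * ennreal \<bar>k u\<bar>)"
        using B0 by (simp add: ennreal_mult[symmetric] ennreal_leI)
    qed
    also have "\<dots> = (\<integral>\<^sup>+ v. \<integral>\<^sup>+ u. ennreal \<bar>e v\<bar> * (ennreal B * ennreal \<bar>k u\<bar>) \<partial>N \<partial>N)"
      by (subst sN.nn_integral_fst[symmetric]) auto
    also have "\<dots> = (\<integral>\<^sup>+ v. ennreal \<bar>e v\<bar> \<partial>N) * (ennreal B * (\<integral>\<^sup>+ u. ennreal \<bar>k u\<bar> \<partial>N))"
      by (simp add: nn_integral_cmult nn_integral_multc)
    also have "\<dots> < \<infinity>"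
      using e k by (simp add: nn_integral_eq_integral ennreal_mult_less_top)
    finally show "(\<integral>\<^sup>+ p. ennreal (norm (case p of (v, u) \<Rightarrow> e v * (k u * f (- u + (v + x))))) \<partial>(N \<Otimes>\<^sub>M N)) < \<infinity>" .
  qed measurable
  then have "(\<integral>u. \<integral>v. e v * (k u * f (- u + (v + x))) \<partial>N \<partial>N) = (\<integral>v. \<integral>u. e v * (k u * f (- u + (v + x))) \<partial>N \<partial>N)"
    by (rule NN.Fubini_integral)
  moreover have "(\<integral>u. \<integral>v. e v * (k u * f (- u + (v + x))) \<partial>N \<partial>N) =
      (\<integral>u. k u * (\<integral>v. e v * f (- u + (v + x)) \<partial>N) \<partial>N)"
    by (subst mult.left_commute) simp
  ultimately show ?thesis unfolding avg_def by simp
qed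

text \<open>Both translations pass to the kernel, where left invariance merges them into a single
  one by u - t.\<close>

lemma nrm_cov_translate_diff:
  assumes V: "compact V" "emeasure N V \<noteq> 0" and f: "f \<in> BI" and u: "u \<in> H" "t \<in> H"
  shows "nrm (\<lambda>x. cov (unif V) (\<lambda>y. f (- u + y)) x - cov (unif V) (\<lambda>y. f (- t + y)) x)
    \<le> (\<integral>x. \<bar>unif V (u - t + x) - unif V x\<bar> \<partial>N) * nrm f"
proof -
  note v = unif_basic[OF V]
  have E: "cov (unif V) (\<lambda>y. f (- a + y)) x = cov (\<lambda>v. unif V (a + v)) f x" if "a \<in> H" for a x
    using cov_translate[OF that v(1) f] by simp
  have "nrm (\<lambda>x. cov (unif V) (\<lambda>y. f (- u + y)) x - cov (unif V) (\<lambda>y. f (- t + y)) x)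
      \<le> (\<integral>x. \<bar>unif V (u + x) - unif V (t + x)\<bar> \<partial>N) * nrm f"
    unfolding E[OF u(1)] E[OF u(2)]
    using N.integrable_translate[OF u(1) v(2)] N.integrable_translate[OF u(2) v(2)]
    by (intro nrm_avg_diff_kernel f) auto
  also have "(\<integral>x. \<bar>unif V (u + x) - unif V (t + x)\<bar> \<partial>N) = (\<integral>x. \<bar>unif V (u - t + x) - unif V x\<bar> \<partial>N)"
    using integral_translate_diff[OF uminus_H[OF u(2)] v(1), of u t] by (simp add: add.assoc[symmetric])
  finally show ?thesis .
qed

text \<open>A mean is only finitely additive, so the average over \<open>k\<close> is replaced by finite sums whose nodes
  \<open>w\<close> and weights \<open>\<kappa>\<close> serve all translates of \<open>f\<close> at once.\<close>

lemma riemann_sum: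
  assumes V: "compact V" "emeasure N V \<noteq> 0"
    and k: "k \<in> borel_measurable borel" "integrable N k" "\<And>u. 0 \<le> k u" "(\<integral>u. k u \<partial>N) = 1"
    and C: "compact C" "C \<subseteq> H" "\<And>u. k u \<noteq> 0 \<Longrightarrow> u \<in> C" and \<eta>: "0 < \<eta>"
  obtains p :: nat and w \<kappa> where "\<And>j. w j \<in> H" "(\<Sum>j<p. \<kappa> j) = 1"
    "\<And>f. f \<in> BI \<Longrightarrow> nrm (\<lambda>x. cov (unif V) (conv k f) x
        - (\<Sum>j<p. \<kappa> j * cov (unif V) (\<lambda>y. f (- w j + y)) x)) \<le> \<eta> * nrm f"
proof -
  note v = unif_basic[OF V]
  note [measurable] = k(1) v(1)
  obtain U where U: "open U" "0 \<in> U" "\<And>j. j \<in> U \<Longrightarrow> j \<in> H \<Longrightarrow> (\<integral>x. \<bar>unif V (j + x) - unif V x\<bar> \<partial>N) \<le> \<eta>"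
    by (rule unif_translate_continuous[OF V \<eta>]) (rule that)
  have oU: "open {u. u - w \<in> U}" for w
    using open_vimage[OF U(1), of "\<lambda>u. u - w"] by (simp add: vimage_def continuous_intros)
  have "C \<subseteq> (\<Union>w\<in>C. {u. u - w \<in> U})" using U(2) by auto
  then obtain T where T: "T \<subseteq> C" "finite T" "C \<subseteq> (\<Union>w\<in>T. {u. u - w \<in> U})"
    by (rule compactE_image[OF C(1) oU])
  obtain q where q: "bij_betw q {..<card T} T" using ex_bij_betw_nat_finite[OF T(2)] by (auto simp: lessThan_atLeast0)
  define p where "p = card T"
  \<comment> \<open>The default 0 keeps every node in \<open>H\<close>, also from index
    \<open>p\<close> on.\<close>
  define w where "w = (\<lambda>j. if j < p then q j else 0)"
  have wH: "w j \<in> H" for j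
    using q T(1) C(2) subgroup_addD(1)[OF N.subgroup] by (auto simp: w_def p_def bij_betw_def)
  define A where "A = (\<lambda>j. if j < p then {u \<in> C. u - w j \<in> U} else {})"
  have CA: "C = (\<Union>j. A j)"
  proof
    show "C \<subseteq> (\<Union>j. A j)"
    proof
      fix u assume "u \<in> C"
      then obtain t where "t \<in> T" "u - t \<in> U" using T(3) by auto
      moreover obtain j where "j < p" "t = q j"
        using q \<open>t \<in> T\<close> by (auto simp: bij_betw_def p_def)
      ultimately show "u \<in> (\<Union>j. A j)" using \<open>u \<in> C\<close> by (auto simp: A_def w_def)
    qed
  qed (auto simp: A_def split: if_splits)
  have CB: "C \<in> sets borel" using C by (simp add: borel_compact)
  have AB: "A j \<in> sets borel" for j
  proof -
    have "A j = (if j < p then C \<inter> {u. u - w j \<in> U} else {})" by (auto simp: A_def)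
    then show ?thesis using CB oU by auto
  qed
  \<comment> \<open>Disjoint pieces of \<open>C\<close>, each close to its node, so that exactly one
    term of the sum survives at each u in \<open>C\<close>.\<close>
  define P where "P = disjointed A"
  have PB[measurable]: "P j \<in> sets borel" for j
    unfolding P_def using sets.range_disjointed_sets[of A borel] AB by auto
  have CP: "C = (\<Union>j. P j)" unfolding P_def UN_disjointed_eq by (rule CA)
  have PA: "P j \<subseteq> A j" for j unfolding P_def by (rule disjointed_subset)
  have Pdisj: "i = j" if "u \<in> P i" "u \<in> P j" for i j u
    using disjoint_family_disjointed[of A] that unfolding P_def disjoint_family_on_def by blast
  have one: "(\<Sum>j<p. indicator (P j) u * g (w j)) = g (w i)" if "u \<in> P i" for u i and g :: "'a \<Rightarrow> real"
  proof -
    have "i < p" using PA[of i] that by (auto simp: A_def split: if_splits)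
    have "(\<Sum>j<p. indicator (P j) u * g (w j)) = (\<Sum>j<p. if j = i then g (w i) else 0)"
      using that Pdisj by (intro sum.cong) (auto simp: indicator_def)
    with \<open>i < p\<close> show ?thesis by simp
  qed
  define \<kappa> where "\<kappa> = (\<lambda>j. \<integral>u. k u * indicator (P j) u \<partial>N)"
  have kP: "integrable N (\<lambda>u. k u * indicator (P j) u)" for j
    using k(2) by (intro integrable_mult_indicator[of _ N k, unfolded real_scaleR_def, simplified mult.commute]) auto
  show thesis
  proof (rule that[of w \<kappa> p, OF wH])
    have "(\<Sum>j<p. \<kappa> j) = (\<integral>u. (\<Sum>j<p. k u * indicator (P j) u) \<partial>N)"
      unfolding \<kappa>_def using kP by (intro Bochner_Integration.integral_sum[symmetric])
    also have "(\<lambda>u. \<Sum>j<p. k u * indicator (P j) u) = k"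
    proof
      fix u
      show "(\<Sum>j<p. k u * indicator (P j) u) = k u"
      proof (cases "k u = 0")
        case False
        then obtain i where "u \<in> P i" using C(3) CP by blast
        from one[OF this, of "\<lambda>_. 1"] show ?thesis by (simp add: sum_distrib_left[symmetric])
      qed simp
    qed
    finally show "(\<Sum>j<p. \<kappa> j) = 1" using k(4) by simp
  next
    fix f assume f: "f \<in> BI"
    note [measurable] = BI_measurable[OF f]
    define E where "E = (\<lambda>u. cov (unif V) (\<lambda>y. f (- u + y)))"
    have EBI: "E u \<in> BI" if "u \<in> H" for u
      unfolding E_def using that by (intro cov_BI v BI_translate uminus_H f)
    have Em[measurable]: "(\<lambda>(u, x). E u x) \<in> borel_measurable (N \<Otimes>\<^sub>M M)"
      unfolding E_def avg_def by measurable
    have Ex[measurable]: "(\<lambda>x. E u x) \<in> borel_measurable borel" for u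
      unfolding E_def avg_def by measurable
    have Eu[measurable]: "(\<lambda>u. E u x) \<in> borel_measurable borel" for x
      unfolding E_def avg_def by measurable
    have Ed: "nrm (\<lambda>x. E u x - E t x) \<le> \<eta> * nrm f" if u: "u \<in> H" "t \<in> H" "u - t \<in> U" for u t
    proof -
      have ut: "u - t \<in> H" using u add_H[OF u(1) uminus_H[OF u(2)]] by simp
      note nrm_cov_translate_diff[OF V f u(1,2)]
      also have "(\<integral>x. \<bar>unif V (u - t + x) - unif V x\<bar> \<partial>N) * nrm f \<le> \<eta> * nrm f"
        using U(3)[OF u(3) ut] nrm_nonneg by (intro mult_right_mono)
      finally show ?thesis by (simp add: E_def)
    qed
    have kE: "integrable N (\<lambda>u. k u * E u x)" for x
    proof -
      obtain B where B: "\<And>x. \<bar>f x\<bar> \<le> B" using BI_bounded[OF f] by blast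
      have Eb: "\<bar>E u x\<bar> \<le> B" for u
      proof -
        have "\<bar>E u x\<bar> \<le> (\<integral>v. \<bar>unif V v * f (- u + (v + x))\<bar> \<partial>N)"
          unfolding E_def avg_def by (rule integral_abs_bound)
        also have "\<dots> \<le> (\<integral>v. unif V v * B \<partial>N)"
        proof (rule integral_mono')
          show "\<bar>unif V v * f (- u + (v + x))\<bar> \<le> unif V v * B" for v
            using B v(3) by (simp add: abs_mult mult_left_mono)
        qed (use v B[of 0] in \<open>auto intro!: mult_nonneg_nonneg\<close>)
        finally show ?thesis using v by simp
      qed
      show ?thesis
      proof (rule Bochner_Integration.integrable_bound)
        show "integrable N (\<lambda>u. B * k u)" using k by simp
        have "\<bar>k u * E u x\<bar> \<le> \<bar>B * k u\<bar>" for u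
          using mult_left_mono[OF order_trans[OF Eb abs_ge_self], of "\<bar>k u\<bar>" u]
          by (simp add: abs_mult mult.commute)
        then show "AE u in N. norm (k u * E u x) \<le> norm (B * k u)" by simp
      qed simp
    qed
    \<comment> \<open>The error of replacing u by the node of its piece. As \<kappa> j is the
      integral of \<open>k\<close> over P j, the average of this error against \<open>k\<close> is
      the whole difference.\<close>
    define F where "F = (\<lambda>u x. E u x - (\<Sum>j<p. indicator (P j) u * E (w j) x))"
    have FE: "F u = (\<lambda>x. E u x - E (w i) x)" if "u \<in> P i" for u i
      unfolding F_def using one[OF that, of "\<lambda>t. E t _"] by (intro ext) simp
    have "nrm (\<lambda>x. cov (unif V) (conv k f) x - (\<Sum>j<p. \<kappa> j * E (w j) x)) \<le> (\<integral>u. \<bar>k u\<bar> \<partial>N) * (\<eta> * nrm f)"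
    proof (rule minkowski_integral_inequality[where F=F])
      show "(\<lambda>(u, x). F u x) \<in> borel_measurable (N \<Otimes>\<^sub>M M)" unfolding F_def by measurable
      show "(\<lambda>x. cov (unif V) (conv k f) x - (\<Sum>j<p. \<kappa> j * E (w j) x)) \<in> BI"
        by (intro BI_diff cov_BI conv_BI BI_sum BI_cmult EBI wH f v k)
      show "cov (unif V) (conv k f) x - (\<Sum>j<p. \<kappa> j * E (w j) x) = (\<integral>u. k u * F u x \<partial>N)" for x
      proof -
        have "(\<integral>u. k u * F u x \<partial>N) = (\<integral>u. k u * E u x - (\<Sum>j<p. k u * indicator (P j) u * E (w j) x) \<partial>N)"
          by (simp only: F_def right_diff_distrib sum_distrib_left mult.assoc)
        also have "\<dots> = (\<integral>u. k u * E u x \<partial>N) - (\<integral>u. (\<Sum>j<p. k u * indicator (P j) u * E (w j) x) \<partial>N)"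
          using kE kP by (intro Bochner_Integration.integral_diff Bochner_Integration.integrable_sum
              integrable_mult_left) auto
        also have "(\<integral>u. (\<Sum>j<p. k u * indicator (P j) u * E (w j) x) \<partial>N) = (\<Sum>j<p. \<kappa> j * E (w j) x)"
          unfolding \<kappa>_def using kP by (subst Bochner_Integration.integral_sum) auto
        also have "(\<integral>u. k u * E u x \<partial>N) = cov (unif V) (conv k f) x"
          unfolding E_def by (rule cov_conv_swap[symmetric]) (use v k f in auto)
        finally show ?thesis by simp
      qed
      fix u assume u: "u \<in> H" "k u \<noteq> 0"
      then obtain i where i: "u \<in> P i" using C(3) CP by blast
      then have "u - w i \<in> U" using PA[of i] by (auto simp: A_def split: if_splits)
      then show "F u \<in> BI \<and> nrm (F u) \<le> \<eta> * nrm f"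
        unfolding FE[OF i] using u(1) by (intro conjI BI_diff EBI Ed wH)
    qed (use k \<eta> nrm_nonneg in auto)
    then show "nrm (\<lambda>x. cov (unif V) (conv k f) x
        - (\<Sum>j<p. \<kappa> j * cov (unif V) (\<lambda>y. f (- w j + y)) x)) \<le> \<eta> * nrm f"
      using k by (simp add: E_def)
  qed
qed

text \<open>Functions on \<open>H\<close>, carried by the ambient type without any condition off
  \<open>H\<close>. The mean is evaluated on these alone.\<close>

definition BC :: "('a \<Rightarrow> real) set" where
  "BC = {t. continuous_on H t \<and> (\<exists>B. \<forall>x\<in>H. \<bar>t x\<bar> \<le> B)}"

lemma BC_add: assumes "s \<in> BC" "t \<in> BC" shows "(\<lambda>x. s x + t x) \<in> BC"
proof -
  obtain A B where "\<forall>x\<in>H. \<bar>s x\<bar> \<le> A" "\<forall>x\<in>H. \<bar>t x\<bar> \<le> B" using assms by (auto simp: BC_def)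
  then have "\<forall>x\<in>H. \<bar>s x + t x\<bar> \<le> A + B" by (auto intro: order_trans[OF abs_triangle_ineq] add_mono)
  with assms show ?thesis by (auto simp: BC_def intro: continuous_on_add)
qed

lemma BC_cmult: assumes "t \<in> BC" shows "(\<lambda>x. c * t x) \<in> BC"
proof -
  obtain B where "\<forall>x\<in>H. \<bar>t x\<bar> \<le> B" using assms by (auto simp: BC_def)
  then have "\<forall>x\<in>H. \<bar>c * t x\<bar> \<le> \<bar>c\<bar> * B" by (auto simp: abs_mult intro: mult_left_mono)
  with assms show ?thesis by (auto simp: BC_def intro: continuous_on_mult_left)
qed

lemma BC_const: "(\<lambda>x. c) \<in> BC" by (auto simp: BC_def)

lemma BC_translate: assumes k: "k \<in> H" and t: "t \<in> BC" shows "(\<lambda>x. t (k + x)) \<in> BC"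
proof -
  have "continuous_on H (\<lambda>x. t (k + x))"
    by (rule continuous_on_compose2[of H t]) (use k t in \<open>auto simp: BC_def add_H intro!: continuous_intros\<close>)
  moreover obtain B where "\<forall>x\<in>H. \<bar>t x\<bar> \<le> B" using t by (auto simp: BC_def)
  then have "\<forall>x\<in>H. \<bar>t (k + x)\<bar> \<le> B" using k add_H by blast
  ultimately show ?thesis unfolding BC_def by blast
qed

lemma BC_sum: "(\<And>i. i \<in> I \<Longrightarrow> t i \<in> BC) \<Longrightarrow> (\<lambda>x. \<Sum>i\<in>I. t i x) \<in> BC"
  by (induction I rule: infinite_finite_induct) (auto intro: BC_add BC_const)

section \<open>Bounded probability densities and the separation argument\<close>

definition densities :: "('a \<Rightarrow> real) set" where
  "densities = {\<phi> \<in> BI. (\<forall>x. 0 \<le> \<phi> x) \<and> (\<integral>x. \<phi> x \<partial>M) = 1}"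

lemma nrm_density: "\<phi> \<in> densities \<Longrightarrow> nrm \<phi> = 1"
  by (simp add: densities_def nrm_def)

lemma density_BI: "\<phi> \<in> densities \<Longrightarrow> \<phi> \<in> BI"
  by (simp add: densities_def)

lemma density_translate: assumes "h \<in> H" "\<phi> \<in> densities" shows "(\<lambda>x. \<phi> (h + x)) \<in> densities"
  using assms M.integral_translate[OF assms(1), of \<phi>] BI_translate[OF assms(1), of \<phi>]
  by (auto simp: densities_def BI_measurable)

lemma densities_nonempty:
  assumes "emeasure M UNIV \<noteq> 0"
  shows "densities \<noteq> {}"
proof -
  obtain D :: "nat \<Rightarrow> 'a set" where D: "\<And>n. compact (D n)" "(\<Union>n. D n) = UNIV"
    by (rule compact_exhaustion[OF N.locally_compact]) (rule that)
  have "\<exists>n. emeasure M (D n) \<noteq> 0"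
  proof (rule ccontr)
    assume "\<not> (\<exists>n. emeasure M (D n) \<noteq> 0)"
    then have "emeasure M (\<Union>n. D n) = 0" using D(1) by (intro emeasure_UN_eq_0) (auto simp: borel_compact)
    with assms D(2) show False by simp
  qed
  then obtain n where n: "emeasure M (D n) \<noteq> 0" by blast
  have [measurable]: "D n \<in> sets borel" using D by (simp add: borel_compact)
  have fin: "emeasure M (D n) < \<infinity>" using D M.finite_on_compact by blast
  have pos: "0 < measure M (D n)" using n fin by (simp add: measure_def enn2real_positive_iff zero_less_iff_neq_zero)
  define \<phi> where "\<phi> = (\<lambda>x. indicator (D n) x / measure M (D n))"
  have "\<bar>\<phi> x\<bar> \<le> 1 / measure M (D n)" for x
    using pos by (auto simp: \<phi>_def indicator_def)
  moreover have "integrable M (indicator (D n) :: 'a \<Rightarrow> real)" using fin by (intro integrable_real_indicator) auto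
  moreover have "\<phi> \<in> borel_measurable borel" unfolding \<phi>_def by measurable
  ultimately have "\<phi> \<in> BI" unfolding BI_def \<phi>_def by auto
  then have "\<phi> \<in> densities" using pos by (simp add: densities_def) (simp add: \<phi>_def)
  then show ?thesis by blast
qed

lemma conv_density:
  assumes k: "integrable N k" "\<And>u. 0 \<le> k u" "(\<integral>u. k u \<partial>N) = 1" and \<phi>: "\<phi> \<in> densities"
  shows "conv k \<phi> \<in> densities"
proof -
  note B = density_BI[OF \<phi>]
  have nn: "0 \<le> \<phi> x" for x using \<phi> by (simp add: densities_def)
  note [measurable] = BI_measurable[OF B]
  have [measurable]: "k \<in> borel_measurable borel" using k(1) by auto
  note cB = conv_BI[OF k(1) B]
  have c0: "0 \<le> conv k \<phi> x" for x unfolding avg_def using k(2) nn by (intro integral_nonneg_AE) simp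
  have "ennreal (\<integral>x. conv k \<phi> x \<partial>M) = (\<integral>\<^sup>+ x. ennreal (conv k \<phi> x) \<partial>M)"
    using c0 BI_integrable[OF cB] by (intro nn_integral_eq_integral[symmetric]) auto
  also have "\<dots> = (\<integral>\<^sup>+ x. \<integral>\<^sup>+ v. ennreal (k v * \<phi> (- v + x)) \<partial>N \<partial>M)"
    unfolding avg_def using integrable_kernel[OF k(1) B, of uminus] k(2) nn
    by (intro nn_integral_cong nn_integral_eq_integral[symmetric]) auto
  also have "\<dots> = (\<integral>\<^sup>+ v. \<integral>\<^sup>+ x. ennreal (k v * \<phi> (- v + x)) \<partial>M \<partial>N)" by (rule NM.Fubini') measurable
  also have "\<dots> = (\<integral>\<^sup>+ v. ennreal (k v) \<partial>N)"
  proof (rule nn_integral_cong_AE)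
    show "AE v in N. (\<integral>\<^sup>+ x. ennreal (k v * \<phi> (- v + x)) \<partial>M) = ennreal (k v)"
      using AE_H
    proof eventually_elim
      case (elim v)
      have "(\<integral>\<^sup>+ x. ennreal (k v * \<phi> (- v + x)) \<partial>M) = (\<integral>\<^sup>+ x. ennreal (k v) * ennreal (\<phi> (- v + x)) \<partial>M)"
        using k(2) nn by (simp add: ennreal_mult)
      also have "\<dots> = ennreal (k v) * (\<integral>\<^sup>+ x. ennreal (\<phi> (- v + x)) \<partial>M)"
        by (rule nn_integral_cmult) measurable
      also have "(\<integral>\<^sup>+ x. ennreal (\<phi> (- v + x)) \<partial>M) = (\<integral>\<^sup>+ x. ennreal (\<phi> x) \<partial>M)"
        using uminus_H[OF elim] by (rule M.nn_integral_translate) measurable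
      also have "\<dots> = 1" using nrm_eq_nn_integral[OF B] nrm_density[OF \<phi>] nn by simp
      finally show ?case by simp
    qed
  qed
  also have "\<dots> = ennreal 1" using k by (simp add: nn_integral_eq_integral)
  finally have "(\<integral>x. conv k \<phi> x \<partial>M) = 1"
    using c0 by (subst (asm) ennreal_inj) (auto intro: integral_nonneg_AE)
  with cB c0 show ?thesis by (simp add: densities_def)
qed

lemma conv_linear:
  assumes k: "integrable N k" and fg: "f \<in> BI" "g \<in> BI"
  shows "conv k (\<lambda>x. a * f x + b * g x) x = a * conv k f x + b * conv k g x"
proof -
  have "integrable N (\<lambda>v. k v * f (- v + x))" "integrable N (\<lambda>v. k v * g (- v + x))"
    by (rule integrable_kernel; use k fg in simp)+
  then show ?thesis unfolding avg_def
    by (simp add: distrib_left mult.left_commute[of _ a] mult.left_commute[of _ b])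
qed

text \<open>Connects pointwise sums with sums in the vector space of functions, on which linear
  functionals act.\<close>

lemma sum_fun_eq: "(\<lambda>x. \<Sum>j\<in>J. c j * f j x) = (\<Sum>j\<in>J. c j *\<^sub>R (f j :: 'a \<Rightarrow> real))"
  by (induction J rule: infinite_finite_induct)
    (auto simp: fun_eq_iff scaleR_fun_def)

text \<open>The separation argument: a functional \<open>l\<close> separating the tuples of displacements from \<open>0\<close> yields
  the bounded continuous functions \<open>h \<mapsto> l (T h)\<close> on \<open>H\<close>, on which the mean contradicts the
  separation.\<close>

lemma almost_invariant_under_finite_set:
  assumes m_add: "\<And>s t. s \<in> BC \<Longrightarrow> t \<in> BC \<Longrightarrow> m (\<lambda>x. s x + t x) = m s + m t"
    and m_cmult: "\<And>c t. t \<in> BC \<Longrightarrow> m (\<lambda>x. c * t x) = c * m t"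
    and m_nonneg: "\<And>t. t \<in> BC \<Longrightarrow> (\<And>x. x \<in> H \<Longrightarrow> 0 \<le> t x) \<Longrightarrow> 0 \<le> m t"
    and m_one: "m (\<lambda>x. 1) = 1"
    and m_inv: "\<And>k t. k \<in> H \<Longrightarrow> t \<in> BC \<Longrightarrow> m (\<lambda>x. t (k + x)) = m t"
    and M_nz: "emeasure M UNIV \<noteq> 0"
    and U: "compact U" "U \<subseteq> H" "emeasure N U \<noteq> 0"
    and G: "finite G" "G \<subseteq> H" and \<delta>: "0 < \<delta>"
  shows "\<exists>\<phi>\<in>densities. (\<Sum>g\<in>G. nrm (\<lambda>x. conv (\<lambda>u. unif U (- g + u)) \<phi> x - conv (unif U) \<phi> x)) < \<delta>"
proof (rule ccontr)
  assume contr: "\<not> ?thesis"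
  note \<theta> = unif_basic[OF U(1,3)]
  note [measurable] = \<theta>(1)
  \<comment> \<open>Convolving with \<open>k g\<close> is convolving with \<open>unif U\<close> and
    then translating by g. With the translation in the kernel, displacements are visibly linear in
    \<phi>.\<close>
  define k where "k = (\<lambda>g u. unif U (- g + u))"
  have k0: "k 0 = unif U" by (simp add: k_def)
  have km[measurable]: "k g \<in> borel_measurable borel" for g unfolding k_def by measurable
  have k: "integrable N (k g)" "0 \<le> k g u" "(\<integral>u. k g u \<partial>N) = 1" if "g \<in> H" for g u
    unfolding k_def using N.integrable_translate[OF uminus_H[OF that] \<theta>(2)] \<theta>
      N.integral_translate[OF uminus_H[OF that] \<theta>(1)] by auto
  have H0: "0 \<in> H" using subgroup_addD(1)[OF N.subgroup] .
  have GH: "g \<in> H" if "g \<in> insert 0 G" for g using that G H0 by auto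
  \<comment> \<open>All displacements at once, one coordinate for each g in \<open>G\<close>. The
    value 0 off \<open>G\<close> makes the tuple a finite sum of single coordinates.\<close>
  define c where "c = (\<lambda>\<phi> g x. if g \<in> G then conv (k g) \<phi> x - conv (k 0) \<phi> x else 0)"
  define X where "X = {v :: 'a \<Rightarrow> 'a \<Rightarrow> real. \<forall>g\<in>G. v g \<in> BI}"
  define nX where "nX = (\<lambda>v :: 'a \<Rightarrow> 'a \<Rightarrow> real. \<Sum>g\<in>G. nrm (v g))"
  have dBI: "(\<lambda>x. conv (k g) \<phi> x - conv (k g') \<phi> x) \<in> BI" if "g \<in> H" "g' \<in> H" "\<phi> \<in> BI" for g g' \<phi>
    using that k by (intro BI_diff conv_BI)
  have "\<exists>l. linear l \<and> (\<forall>x\<in>X. l x \<le> nX x) \<and> (\<forall>x\<in>c ` densities. \<delta> \<le> l x)"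
  proof (rule seminorm_separation)
    show "subspace X"
      unfolding subspace_def X_def
      by (auto simp: plus_fun_def zero_fun_def scaleR_fun_def BI_zero intro: BI_add BI_cmult)
    show "nX (v + w) \<le> nX v + nX w" if "v \<in> X" "w \<in> X" for v w
      unfolding nX_def sum.distrib[symmetric] using that
      by (intro sum_mono) (auto simp: plus_fun_def X_def intro: nrm_add)
    show "nX (a *\<^sub>R v) = \<bar>a\<bar> * nX v" for a v
      by (simp add: nX_def scaleR_fun_def nrm_cmult sum_distrib_left)
    show "c ` densities \<noteq> {}" using densities_nonempty[OF M_nz] by simp
    show "c ` densities \<subseteq> X"
    proof (clarsimp simp: X_def c_def)
      fix \<phi> g assume "\<phi> \<in> densities" "g \<in> G"
      then show "(\<lambda>x. conv (k g) \<phi> x - conv (k 0) \<phi> x) \<in> BI"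
        using dBI[OF _ H0 density_BI] G(2) by blast
    qed
    show "\<delta> \<le> nX v" if "v \<in> c ` densities" for v
    proof -
      from that obtain \<phi> where \<phi>: "\<phi> \<in> densities" "v = c \<phi>" by blast
      have "nX v = (\<Sum>g\<in>G. nrm (\<lambda>x. conv (\<lambda>u. unif U (- g + u)) \<phi> x - conv (unif U) \<phi> x))"
        unfolding nX_def \<phi>(2) c_def by (intro sum.cong) (simp_all add: k_def)
      with contr \<phi>(1) show ?thesis by force
    qed
    show "convex (c ` densities)"
      unfolding convex_def
    proof (intro ballI allI impI)
      fix v w and a b :: real assume vw: "v \<in> c ` densities" "w \<in> c ` densities" and ab: "0 \<le> a" "0 \<le> b" "a + b = 1"
      obtain \<phi> where \<phi>: "\<phi> \<in> densities" "v = c \<phi>" using vw by blast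
      obtain \<phi>' where \<phi>': "\<phi>' \<in> densities" "w = c \<phi>'" using vw by blast
      note B = density_BI[OF \<phi>(1)] density_BI[OF \<phi>'(1)]
      have "(\<lambda>x. a * \<phi> x + b * \<phi>' x) \<in> densities"
        using \<phi> \<phi>' ab BI_integrable[OF B(1)] BI_integrable[OF B(2)]
        by (auto simp: densities_def intro: BI_add BI_cmult)
      moreover have "a *\<^sub>R v + b *\<^sub>R w = c (\<lambda>x. a * \<phi> x + b * \<phi>' x)"
        unfolding \<phi>(2) \<phi>'(2) using conv_linear[OF k(1) B] G H0
        by (auto simp: fun_eq_iff scaleR_fun_def c_def subset_iff algebra_simps)
      ultimately show "a *\<^sub>R v + b *\<^sub>R w \<in> c ` densities" by blast
    qed
  qed
  then obtain l where l: "linear l" "\<And>v. v \<in> X \<Longrightarrow> l v \<le> nX v" "\<And>\<phi>. \<phi> \<in> densities \<Longrightarrow> \<delta> \<le> l (c \<phi>)"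
    by blast
  \<comment> \<open>Splits \<open>l\<close> into one linear functional per coordinate, each bounded
    by \<open>nrm\<close> on \<open>BI\<close>.\<close>
  define single where "single = (\<lambda>(g :: 'a) (f :: 'a \<Rightarrow> real) g'. if g' = g then f else 0)"
  define L where "L = (\<lambda>g f. l (single g f))"
  have Llin: "linear (L g)" for g
  proof -
    have "linear (single g)"
      by (rule linearI) (auto simp: single_def fun_eq_iff scaleR_fun_def)
    from linear_compose[OF this l(1)] show ?thesis by (simp add: L_def o_def)
  qed
  have Lle: "L g f \<le> nrm f" if g: "g \<in> G" and f: "f \<in> BI" for g f
  proof -
    have "single g f \<in> X" using f BI_zero by (auto simp: single_def X_def zero_fun_def)
    then have "L g f \<le> nX (single g f)" unfolding L_def by (rule l(2))
    also have "\<dots> = (\<Sum>g'\<in>G. if g' = g then nrm f else 0)"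
      unfolding nX_def by (intro sum.cong) (auto simp: single_def nrm_def)
    finally show ?thesis using G(1) g by simp
  qed
  have Ldiff: "L g (\<lambda>x. a x - b x) = L g a - L g b" for g a b
    using linear_diff[OF Llin, of g a b] by (simp add: fun_diff_def)
  have Lsum: "L g (\<lambda>x. \<Sum>j\<in>J. \<kappa> j * f j x) = (\<Sum>j\<in>J. \<kappa> j * L g (f j))" for g and J :: "nat set" and \<kappa> f
    unfolding sum_fun_eq by (simp add: linear_sum[OF Llin] linear_scale[OF Llin])
  have Labs: "\<bar>L g a - L g b\<bar> \<le> nrm (\<lambda>x. a x - b x)" if g: "g \<in> G" and ab: "a \<in> BI" "b \<in> BI" for g a b
  proof -
    have "nrm (\<lambda>x. b x - a x) = nrm (\<lambda>x. a x - b x)" by (simp add: nrm_def abs_minus_commute)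
    then show ?thesis
      using Lle[OF g BI_diff[OF ab]] Lle[OF g BI_diff[OF ab(2,1)]] by (simp add: Ldiff abs_le_iff)
  qed
  have Lc: "l (c \<phi>) = (\<Sum>g\<in>G. L g (conv (k g) \<phi>) - L g (conv (k 0) \<phi>))" for \<phi>
  proof -
    have "c \<phi> = (\<Sum>g\<in>G. single g (\<lambda>x. conv (k g) \<phi> x - conv (k 0) \<phi> x))"
    proof (rule ext)+
      fix g x
      have "(\<Sum>g\<in>G. single g (\<lambda>x. conv (k g) \<phi> x - conv (k 0) \<phi> x)) g x =
          (\<Sum>g'\<in>G. if g' = g then conv (k g) \<phi> x - conv (k 0) \<phi> x else 0)"
        using G(1) by (induction G rule: finite_induct) (auto simp: single_def)
      also have "\<dots> = c \<phi> g x" using G(1) by (simp add: c_def)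
      finally show "c \<phi> g x = (\<Sum>g\<in>G. single g (\<lambda>x. conv (k g) \<phi> x - conv (k 0) \<phi> x)) g x" by simp
    qed
    then have "l (c \<phi>) = (\<Sum>g\<in>G. L g (\<lambda>x. conv (k g) \<phi> x - conv (k 0) \<phi> x))"
      by (simp add: linear_sum[OF l(1)] L_def)
    then show ?thesis unfolding Ldiff .
  qed
  \<comment> \<open>Each g in \<open>G\<close> brings two approximations with error 2 \<eta> each,
    so the total 4 \<eta> card G must stay below \<delta>; the + 1 covers an empty
    \<open>G\<close>.\<close>
  define \<eta> where "\<eta> = \<delta> / (8 * (card G + 1))"
  have \<eta>: "0 < \<eta>" "4 * \<eta> * card G < \<delta>"
  proof -
    show e0: "0 < \<eta>" using \<delta> by (simp add: \<eta>_def)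
    have "8 * \<eta> * (card G + 1) = \<delta>" using \<delta> by (simp add: \<eta>_def field_simps)
    moreover have "4 * \<eta> * card G \<le> 4 * \<eta> * (card G + 1)" using e0 by (intro mult_left_mono) auto
    moreover have "0 < 4 * \<eta> * (card G + 1)" using e0 by simp
    ultimately show "4 * \<eta> * card G < \<delta>" by linarith
  qed
  obtain W0 where W0: "open W0" "0 \<in> W0"
      "\<And>j. j \<in> W0 \<Longrightarrow> j \<in> H \<Longrightarrow> (\<integral>x. \<bar>unif U (j + x) - unif U x\<bar> \<partial>N) \<le> \<eta>"
    by (rule unif_translate_continuous[OF U(1,3) \<eta>(1)]) (rule that)
  \<comment> \<open>Translating \<open>k g\<close> by v amounts to translating \<open>unif U\<close>
    by - g + v + g, so v has to be small after each of these conjugations; 0 accounts for the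
    undisplaced kernel.\<close>
  define W where "W = (\<Inter>g\<in>insert 0 G. (\<lambda>v. - g + v + g) -` W0)"
  have W: "open W" "0 \<in> W"
  proof -
    show "open W" unfolding W_def using G(1) W0(1)
      by (intro open_INT ballI open_vimage continuous_intros) auto
    show "0 \<in> W" using W0(2) by (simp add: W_def)
  qed
  obtain V where V: "compact V" "V \<subseteq> W" "0 \<in> interior V"
    by (rule compact_neighbourhood[OF N.locally_compact W]) (rule that)
  have "emeasure N (interior V) \<le> emeasure N V"
    using V(1) interior_subset by (intro emeasure_mono) (auto simp: borel_compact)
  then have NV: "emeasure N V \<noteq> 0" using N_pos[OF open_interior V(3)] by auto
  note v = unif_basic[OF V(1) NV]
  obtain \<psi> where \<psi>: "\<psi> \<in> densities" using densities_nonempty[OF M_nz] by blast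
  define \<psi>h where "\<psi>h = (\<lambda>h x. \<psi> (- h + x))"
  have \<psi>h: "\<psi>h h \<in> densities" if "h \<in> H" for h
    unfolding \<psi>h_def by (rule density_translate[OF uminus_H[OF that] \<psi>])
  \<comment> \<open>The translation by h passes to the kernel \<open>unif V\<close>, which makes
    \<open>L g (T h)\<close> continuous in h.\<close>
  define T where "T = (\<lambda>h. cov (unif V) (\<psi>h h))"
  have TBI: "T h \<in> BI" if "h \<in> H" for h unfolding T_def by (intro cov_BI v density_BI \<psi>h that)
  have Tnrm: "nrm (T h) \<le> 1" if "h \<in> H" for h
    using nrm_avg_le[of "\<lambda>v. v" "unif V" "\<psi>h h"] v density_BI[OF \<psi>h[OF that]] nrm_density[OF \<psi>h[OF that]]
    by (simp add: T_def)
  have tBC: "(\<lambda>h. L g (T h)) \<in> BC" if g: "g \<in> G" for g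
    unfolding BC_def
  proof (intro CollectI conjI exI ballI)
    fix h assume h: "h \<in> H"
    have "\<bar>L g (T h) - L g (\<lambda>x. 0)\<bar> \<le> nrm (\<lambda>x. T h x - 0)" by (rule Labs[OF g TBI[OF h] BI_zero])
    moreover have "L g (\<lambda>x. 0) = 0" using linear_0[OF Llin, of g] by (simp add: zero_fun_def)
    ultimately show "\<bar>L g (T h)\<bar> \<le> 1" using Tnrm[OF h] by simp
  next
    show "continuous_on H (\<lambda>h. L g (T h))"
      unfolding continuous_on_def
    proof (intro ballI tendstoI)
      fix b and r :: real assume b: "b \<in> H" and r: "0 < r"
      obtain O1 where O1: "open O1" "0 \<in> O1"
          "\<And>j. j \<in> O1 \<Longrightarrow> j \<in> H \<Longrightarrow> (\<integral>x. \<bar>unif V (j + x) - unif V x\<bar> \<partial>N) \<le> r / 2"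
        by (rule unif_translate_continuous[OF V(1) NV half_gt_zero[OF r]]) (rule that)
      have "dist (L g (T a)) (L g (T b)) < r" if a: "a \<in> H" "a - b \<in> O1" for a
      proof -
        have ab: "a - b \<in> H" using add_H[OF a(1) uminus_H[OF b]] by simp
        have "\<bar>L g (T a) - L g (T b)\<bar> \<le> nrm (\<lambda>x. T a x - T b x)" by (rule Labs[OF g TBI[OF a(1)] TBI[OF b]])
        also have "\<dots> \<le> (\<integral>x. \<bar>unif V (a - b + x) - unif V x\<bar> \<partial>N) * nrm \<psi>"
          unfolding T_def \<psi>h_def by (rule nrm_cov_translate_diff[OF V(1) NV density_BI[OF \<psi>] a(1) b])
        also have "\<dots> \<le> r / 2" using O1(3)[OF a(2) ab] nrm_density[OF \<psi>] by simp
        finally show ?thesis using r by (simp add: dist_real_def)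
      qed
      moreover have "open ((\<lambda>a. a - b) -` O1)" using O1(1) by (intro open_vimage continuous_intros)
      moreover have "b \<in> (\<lambda>a. a - b) -` O1" using O1(2) by simp
      ultimately show "\<forall>\<^sub>F a in at b within H. dist (L g (T a)) (L g (T b)) < r"
        unfolding eventually_at_topological by blast
    qed
  qed
  \<comment> \<open>The nodes and weights depend on g but not on h. Translating
    \<open>\<psi>h h\<close> by a node gives \<open>\<psi>h (w j + h)\<close>, so the sum is made of
    values of \<open>T\<close> at translates of h.\<close>
  define Q where "Q = (\<lambda>g (p::nat, w, \<kappa> :: nat \<Rightarrow> real). (\<forall>j. w j \<in> H) \<and> (\<Sum>j<p. \<kappa> j) = 1 \<and>
      (\<forall>h\<in>H. nrm (\<lambda>x. cov (unif V) (conv (k g) (\<psi>h h)) x - (\<Sum>j<p. \<kappa> j * T (w j + h) x)) \<le> \<eta>))"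
  have exQ: "\<exists>q. Q g q" if g: "g \<in> insert 0 G" for g
  proof -
    have C1: "compact ((\<lambda>x. g + x) ` U)" by (rule compact_image_add_left[OF U(1)])
    have C2: "(\<lambda>x. g + x) ` U \<subseteq> H" using U(2) GH[OF g] add_H by auto
    have C3: "u \<in> (\<lambda>x. g + x) ` U" if "k g u \<noteq> 0" for u
      unfolding image_add_left_eq_vimage using that by (auto simp: k_def unif_def indicator_def split: if_splits)
    obtain p w \<kappa> where r: "\<And>j. w j \<in> H" "(\<Sum>j<(p::nat). \<kappa> j) = 1"
      "\<And>f. f \<in> BI \<Longrightarrow> nrm (\<lambda>x. cov (unif V) (conv (k g) f) x
        - (\<Sum>j<p. \<kappa> j * cov (unif V) (\<lambda>y. f (- w j + y)) x)) \<le> \<eta> * nrm f"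
      by (rule riemann_sum[OF V(1) NV km k[OF GH[OF g]] C1 C2 C3 \<eta>(1)]) (assumption | rule that)+
    have "nrm (\<lambda>x. cov (unif V) (conv (k g) (\<psi>h h)) x - (\<Sum>j<p. \<kappa> j * T (w j + h) x)) \<le> \<eta>" if h: "h \<in> H" for h
    proof -
      have "\<psi>h h (- w j + y) = \<psi>h (w j + h) y" for j y
        by (simp only: \<psi>h_def minus_add add.assoc)
      then show ?thesis using r(3)[OF density_BI[OF \<psi>h[OF h]]] nrm_density[OF \<psi>h[OF h]] by (simp add: T_def)
    qed
    with r(1,2) have "Q g (p, w, \<kappa>)" by (simp add: Q_def)
    then show ?thesis ..
  qed
  define q where "q = (\<lambda>g. SOME q. Q g q)"
  have q: "Q g (q g)" if "g \<in> insert 0 G" for g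
    unfolding q_def by (rule someI_ex[OF exQ[OF that]])
  define p w \<kappa> where "p = (\<lambda>g. fst (q g))" and "w = (\<lambda>g. fst (snd (q g)))" and "\<kappa> = (\<lambda>g. snd (snd (q g)))"
  have wH: "\<And>g j. g \<in> insert 0 G \<Longrightarrow> w g j \<in> H"
    and \<kappa>1: "\<And>g. g \<in> insert 0 G \<Longrightarrow> (\<Sum>j<p g. \<kappa> g j) = 1"
    and rs: "\<And>g h. g \<in> insert 0 G \<Longrightarrow> h \<in> H \<Longrightarrow>
      nrm (\<lambda>x. cov (unif V) (conv (k g) (\<psi>h h)) x - (\<Sum>j<p g. \<kappa> g j * T (w g j + h) x)) \<le> \<eta>"
    using q unfolding Q_def p_def w_def \<kappa>_def case_prod_unfold by blast+
  define S where "S = (\<lambda>g g' h. \<Sum>j<p g'. \<kappa> g' j * L g (T (w g' j + h)))"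
  have SBC: "S g g' \<in> BC" if "g \<in> G" "g' \<in> insert 0 G" for g g'
    unfolding S_def using that wH by (intro BC_sum BC_cmult BC_translate[OF _ tBC])
  \<comment> \<open>The weights add up to 1 and the mean is invariant, so every kernel index
    \<open>g'\<close> gives the same value.\<close>
  have mS: "m (S g g') = m (\<lambda>h. L g (T h))" if g: "g \<in> G" "g' \<in> insert 0 G" for g g'
  proof -
    have "m (\<lambda>h. \<Sum>j<q. \<kappa> g' j * L g (T (w g' j + h))) = (\<Sum>j<q. \<kappa> g' j) * m (\<lambda>h. L g (T h))" for q
    proof (induction q)
      case 0
      show ?case using m_cmult[OF BC_const, of 0 1] by simp
    next
      case (Suc q)
      have t: "(\<lambda>h. L g (T (w g' j + h))) \<in> BC" for j by (rule BC_translate[OF wH[OF g(2)] tBC[OF g(1)]])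
      show ?case
        using Suc m_add[OF BC_sum BC_cmult, of "{..<q}" "\<lambda>j h. \<kappa> g' j * L g (T (w g' j + h))"
            "\<lambda>h. L g (T (w g' q + h))" "\<kappa> g' q"] m_cmult[OF t, of "\<kappa> g' q" q]
          m_inv[OF wH[OF g(2)] tBC[OF g(1)], of q] t BC_cmult
        by (simp add: distrib_right)
    qed
    then show ?thesis unfolding S_def using \<kappa>1[OF g(2)] by simp
  qed
  \<comment> \<open>One \<open>\<eta>\<close> pays for the smoothing by \<open>unif V\<close>, the
    other for the Riemann sum.\<close>
  have near: "\<bar>L g (conv (k g') (\<psi>h h)) - S g g' h\<bar> \<le> 2 * \<eta>"
    if g: "g \<in> G" "g' \<in> insert 0 G" and h: "h \<in> H" for g g' h
  proof -
    note kg = k[OF GH[OF g(2)]]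
    note B = density_BI[OF \<psi>h[OF h]]
    note cB = conv_BI[OF kg(1) B]
    note eB = cov_BI[OF v(2) cB]
    have sB: "(\<lambda>x. \<Sum>j<p g'. \<kappa> g' j * T (w g' j + h) x) \<in> BI"
      using wH[OF g(2)] h by (intro BI_sum BI_cmult TBI add_H)
    have "nrm (\<lambda>x. cov (unif V) (conv (k g') (\<psi>h h)) x - conv (k g') (\<psi>h h) x) \<le> \<eta> * nrm (\<psi>h h)"
    proof (rule nrm_cov_conv_diff[OF v(1,2,3,4) km kg(1) B])
      fix y assume y: "y \<in> H" "unif V y \<noteq> 0"
      then have "y \<in> W" using V(2) by (auto simp: unif_def indicator_def split: if_splits)
      then have yW: "- g' + y + g' \<in> W0" using g(2) unfolding W_def by blast
      have yH: "- g' + y + g' \<in> H" using GH[OF g(2)] y(1) by (intro add_H uminus_H)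
      have "(\<integral>u. \<bar>k g' (y + u) - k g' u\<bar> \<partial>N) = (\<integral>u. \<bar>unif U (- g' + y + g' + u) - unif U u\<bar> \<partial>N)"
        using integral_translate_diff[OF GH[OF g(2)] \<theta>(1), of "- g' + y" "- g'"]
        by (simp add: k_def add.assoc)
      also have "\<dots> \<le> \<eta>" by (rule W0(3)[OF yW yH])
      finally show "(\<integral>u. \<bar>k g' (y + u) - k g' u\<bar> \<partial>N) \<le> \<eta>" .
    qed (use \<eta> in simp)
    then have "\<bar>L g (cov (unif V) (conv (k g') (\<psi>h h))) - L g (conv (k g') (\<psi>h h))\<bar> \<le> \<eta>"
      using Labs[OF g(1) eB cB] nrm_density[OF \<psi>h[OF h]] by simp
    moreover have "\<bar>L g (cov (unif V) (conv (k g') (\<psi>h h))) - S g g' h\<bar> \<le> \<eta>"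
      using Labs[OF g(1) eB sB] rs[OF g(2) h] by (simp add: S_def Lsum)
    ultimately show ?thesis by linarith
  qed
  define R where "R = (\<lambda>h. \<Sum>g\<in>G. S g g h + (- 1) * S g 0 h)"
  have RBC: "R \<in> BC" unfolding R_def using SBC by (intro BC_sum BC_add BC_cmult) auto
  have "m (\<lambda>h. \<Sum>g\<in>G'. S g g h + (- 1) * S g 0 h) = 0" if "G' \<subseteq> G" for G'
    using finite_subset[OF that G(1)] that
  proof (induction G' rule: finite_induct)
    case empty
    show ?case using m_cmult[OF BC_const, of 0 1] by simp
  next
    case (insert g G')
    then have g: "g \<in> G" by simp
    have BCg: "(\<lambda>h. S g g h + (- 1) * S g 0 h) \<in> BC" using SBC g by (intro BC_add BC_cmult) auto
    have BCG: "(\<lambda>h. \<Sum>g\<in>G'. S g g h + (- 1) * S g 0 h) \<in> BC"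
      using SBC insert.prems by (intro BC_sum BC_add BC_cmult) auto
    have "m (\<lambda>h. S g g h + (- 1) * S g 0 h) = m (S g g) + (- 1) * m (S g 0)"
      using m_add[OF SBC BC_cmult[OF SBC], of g g g 0 "-1"] m_cmult[OF SBC, of g 0 "-1"] g by simp
    then have "m (\<lambda>h. S g g h + (- 1) * S g 0 h) = 0" using mS g by simp
    then show ?case using m_add[OF BCg BCG] insert by (simp del: minus_mult_left add_uminus_conv_diff mult_minus_left)
  qed
  then have mR: "m R = 0" unfolding R_def by blast
  \<comment> \<open>The separation gives R h \<ge> \<gamma> > 0 throughout \<open>H\<close>, whereas
    the mean of \<open>R\<close> is 0.\<close>
  define \<gamma> where "\<gamma> = \<delta> - 4 * \<eta> * card G"
  have \<gamma>: "0 < \<gamma>" using \<eta>(2) by (simp add: \<gamma>_def)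
  have "0 \<le> m (\<lambda>h. R h + (- \<gamma>) * 1)"
  proof (rule m_nonneg)
    show "(\<lambda>h. R h + (- \<gamma>) * 1) \<in> BC" by (intro BC_add RBC BC_const)
    fix h assume h: "h \<in> H"
    have "\<delta> \<le> (\<Sum>g\<in>G. L g (conv (k g) (\<psi>h h)) - L g (conv (k 0) (\<psi>h h)))"
      using l(3)[OF \<psi>h[OF h]] by (simp add: Lc)
    also have "\<dots> \<le> (\<Sum>g\<in>G. (S g g h + (- 1) * S g 0 h) + 4 * \<eta>)"
    proof (rule sum_mono)
      fix g assume g: "g \<in> G"
      have a: "\<bar>L g (conv (k g) (\<psi>h h)) - S g g h\<bar> \<le> 2 * \<eta>" by (rule near[OF g _ h]) (use g in simp)
      have b: "\<bar>L g (conv (k 0) (\<psi>h h)) - S g 0 h\<bar> \<le> 2 * \<eta>" by (rule near[OF g _ h]) simp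
      from a b show "L g (conv (k g) (\<psi>h h)) - L g (conv (k 0) (\<psi>h h)) \<le> S g g h + (- 1) * S g 0 h + 4 * \<eta>"
        by linarith
    qed
    also have "\<dots> = R h + 4 * \<eta> * card G" unfolding sum.distrib[of _ "\<lambda>_. 4 * \<eta>"] by (simp add: R_def)
    finally show "0 \<le> R h + (- \<gamma>) * 1" by (simp add: \<gamma>_def)
  qed
  also have "m (\<lambda>h. R h + (- \<gamma>) * 1) = m R + m (\<lambda>h. (- \<gamma>) * 1)" by (rule m_add[OF RBC BC_cmult[OF BC_const]])
  also have "m (\<lambda>h. (- \<gamma>) * 1) = (- \<gamma>) * m (\<lambda>h. 1)" by (rule m_cmult[OF BC_const])
  finally show False using mR m_one \<gamma> by simp
qed

text \<open>The finite set must be fixed before the density is chosen. This is possible because the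
  covering of \<open>F\<close> is determined by \<open>unif U\<close> alone.\<close>

lemma almost_invariant_under_compact_set:
  assumes m_add: "\<And>s t. s \<in> BC \<Longrightarrow> t \<in> BC \<Longrightarrow> m (\<lambda>x. s x + t x) = m s + m t"
    and m_cmult: "\<And>c t. t \<in> BC \<Longrightarrow> m (\<lambda>x. c * t x) = c * m t"
    and m_nonneg: "\<And>t. t \<in> BC \<Longrightarrow> (\<And>x. x \<in> H \<Longrightarrow> 0 \<le> t x) \<Longrightarrow> 0 \<le> m t"
    and m_one: "m (\<lambda>x. 1) = 1"
    and m_inv: "\<And>k t. k \<in> H \<Longrightarrow> t \<in> BC \<Longrightarrow> m (\<lambda>x. t (k + x)) = m t"
    and M_nz: "emeasure M UNIV \<noteq> 0"
    and F: "compact F" "F \<subseteq> H" and \<epsilon>: "0 < \<epsilon>"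
  shows "\<exists>\<phi>\<in>densities. \<forall>g\<in>F. nrm (\<lambda>x. \<phi> (- g + x) - \<phi> x) \<le> \<epsilon>"
proof -
  obtain V where V: "compact V" "V \<subseteq> (UNIV :: 'a set)" "0 \<in> interior V"
    by (rule compact_neighbourhood[OF N.locally_compact open_UNIV UNIV_I]) (rule that)
  \<comment> \<open>Intersecting with \<open>H\<close> loses no \<open>N\<close>-measure of
    \<open>V\<close> and keeps the support of each translated kernel, for g in \<open>H\<close>,
    inside \<open>H\<close>.\<close>
  define U where "U = V \<inter> H"
  have U: "compact U" "U \<subseteq> H" unfolding U_def using V(1) closed_H by auto
  have "emeasure N (interior V) \<le> emeasure N U"
  proof (rule emeasure_mono_AE)
    show "AE x in N. x \<in> interior V \<longrightarrow> x \<in> U"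
      using AE_H by eventually_elim (use interior_subset in \<open>auto simp: U_def\<close>)
    show "U \<in> sets N" using U by (simp add: borel_compact)
  qed
  then have NU: "emeasure N U \<noteq> 0" using N_pos[OF open_interior V(3)] by auto
  note \<theta> = unif_basic[OF U(1) NU]
  note [measurable] = \<theta>(1)
  define k where "k = (\<lambda>g u. unif U (- g + u))"
  have k: "integrable N (k g)" if "g \<in> H" for g
    unfolding k_def by (rule N.integrable_translate[OF uminus_H[OF that] \<theta>(2)])
  obtain W where W: "open W" "0 \<in> W"
      "\<And>j. j \<in> W \<Longrightarrow> j \<in> H \<Longrightarrow> (\<integral>x. \<bar>unif U (j + x) - unif U x\<bar> \<partial>N) \<le> \<epsilon> / 2"
    by (rule unif_translate_continuous[OF U(1) NU half_gt_zero[OF \<epsilon>]]) (rule that)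
  have oW: "open {g. - g + g' \<in> W}" for g'
  proof -
    have "open ((\<lambda>g. - g + g') -` W)" using W(1) by (intro open_vimage continuous_intros)
    then show ?thesis by (simp add: vimage_def)
  qed
  have "F \<subseteq> (\<Union>g'\<in>F. {g. - g + g' \<in> W})" using W(2) by auto
  then obtain G where G: "G \<subseteq> F" "finite G" "F \<subseteq> (\<Union>g'\<in>G. {g. - g + g' \<in> W})"
    by (rule compactE_image[OF F(1) oW])
  have GH: "G \<subseteq> H" using G(1) F(2) by blast
  have "\<exists>\<phi>\<in>densities. (\<Sum>g\<in>G. nrm (\<lambda>x. conv (\<lambda>u. unif U (- g + u)) \<phi> x - conv (unif U) \<phi> x)) < \<epsilon> / 2"
    by (rule almost_invariant_under_finite_set[OF m_add m_cmult m_nonneg m_one m_inv M_nz U NU G(2) GH half_gt_zero[OF \<epsilon>]])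
  then obtain \<phi> where \<phi>: "\<phi> \<in> densities"
      "(\<Sum>g\<in>G. nrm (\<lambda>x. conv (k g) \<phi> x - conv (unif U) \<phi> x)) < \<epsilon> / 2"
    by (auto simp: k_def)
  note B = density_BI[OF \<phi>(1)]
  define \<omega> where "\<omega> = conv (unif U) \<phi>"
  have \<omega>: "\<omega> \<in> densities" unfolding \<omega>_def by (rule conv_density[OF \<theta>(2,3,4) \<phi>(1)])
  have "nrm (\<lambda>x. \<omega> (- g + x) - \<omega> x) \<le> \<epsilon>" if g: "g \<in> F" for g
  proof -
    obtain g' where g': "g' \<in> G" "- g + g' \<in> W" using G(3) g by auto
    have gH: "g \<in> H" "g' \<in> H" using g g' F(2) GH by auto
    have eq: "\<omega> (- g + x) = conv (k g) \<phi> x" for x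
      unfolding \<omega>_def k_def by (rule conv_translate[OF gH(1) \<theta>(1) B, symmetric])
    have BI: "conv (k g) \<phi> \<in> BI" "conv (k g') \<phi> \<in> BI" "\<omega> \<in> BI"
      using k gH B \<omega> by (auto intro: conv_BI density_BI)
    have "nrm (\<lambda>x. \<omega> (- g + x) - \<omega> x) =
        nrm (\<lambda>x. (conv (k g) \<phi> x - conv (k g') \<phi> x) + (conv (k g') \<phi> x - \<omega> x))"
      by (simp add: eq)
    also have "\<dots> \<le> nrm (\<lambda>x. conv (k g) \<phi> x - conv (k g') \<phi> x) + nrm (\<lambda>x. conv (k g') \<phi> x - \<omega> x)"
      by (intro nrm_add BI_diff BI)
    also have "nrm (\<lambda>x. conv (k g) \<phi> x - conv (k g') \<phi> x) \<le> (\<integral>u. \<bar>k g u - k g' u\<bar> \<partial>N) * nrm \<phi>"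
      by (rule nrm_avg_diff_kernel) (use k gH B in \<open>auto simp: uminus_H\<close>)
    also have "(\<integral>u. \<bar>k g u - k g' u\<bar> \<partial>N) = (\<integral>u. \<bar>unif U (- g + g' + u) - unif U u\<bar> \<partial>N)"
      using integral_translate_diff[OF gH(2) \<theta>(1), of "- g" "- g'"] by (simp add: k_def add.assoc)
    also have "\<dots> * nrm \<phi> \<le> \<epsilon> / 2"
      using W(3)[OF g'(2) add_H[OF uminus_H[OF gH(1)] gH(2)]] nrm_density[OF \<phi>(1)] by simp
    also have "nrm (\<lambda>x. conv (k g') \<phi> x - \<omega> x) \<le> \<epsilon> / 2"
    proof -
      have "nrm (\<lambda>x. conv (k g') \<phi> x - \<omega> x) \<le> (\<Sum>g\<in>G. nrm (\<lambda>x. conv (k g) \<phi> x - conv (unif U) \<phi> x))"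
        unfolding \<omega>_def by (rule member_le_sum[OF g'(1) _ G(2)]) (rule nrm_nonneg)
      with \<phi>(2) show ?thesis by simp
    qed
    finally show ?thesis by simp
  qed
  with \<omega> show ?thesis by blast
qed

end

text \<open>Amenability provides a Haar measure and a mean on the subspace \<open>H\<close>. Pushing
  that measure forward along the inclusion produces \<open>N\<close>, and functions in
  \<open>BC\<close> are essentially bounded for the original measure, so the mean applies to
  them.\<close>

lemma almost_invariant_densities:
  fixes H :: "'a::{topological_group_add, t2_space, second_countable_topology} set"
  assumes "invariant_borel_measure H M" and H: "closed H" and am: "amenable H"
    and M_nz: "emeasure M UNIV \<noteq> 0" and F: "compact F" "F \<subseteq> H" and \<epsilon>: "0 < \<epsilon>"
  shows "\<exists>\<phi>\<in>borel_measurable borel. (\<forall>x. 0 \<le> \<phi> x) \<and> (\<integral>\<^sup>+ x. ennreal (\<phi> x) \<partial>M) = 1 \<and>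
    (\<forall>g\<in>F. (\<integral>\<^sup>+ x. ennreal \<bar>\<phi> (- g + x) - \<phi> x\<bar> \<partial>M) \<le> ennreal \<epsilon>)"
proof -
  interpret M: invariant_borel_measure H M by fact
  obtain \<nu> m where \<nu>: "left_haar_measure H \<nu>" and m: "mean_on_L_infinity \<nu> m"
    and minv: "\<And>k f. k \<in> H \<Longrightarrow> f \<in> L_infinity \<nu> \<Longrightarrow> m (left_regular k f) = m f"
    using am unfolding amenable_def by blast
  have sets_\<nu>: "sets \<nu> = sets (restrict_space borel H)" and \<nu>H: "emeasure \<nu> H \<noteq> 0"
    and \<nu>C: "\<And>C. compact C \<Longrightarrow> C \<subseteq> H \<Longrightarrow> emeasure \<nu> C < \<infinity>"
    and \<nu>inv: "\<And>k A. k \<in> H \<Longrightarrow> A \<in> sets \<nu> \<Longrightarrow> emeasure \<nu> ((\<lambda>x. k + x) ` A) = emeasure \<nu> A"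
    using \<nu> by (auto simp: left_haar_measure_def)
  have space_\<nu>: "space \<nu> = H" using sets_eq_imp_space_eq[OF sets_\<nu>] by (simp add: space_restrict_space)
  have Hb: "H \<in> sets borel" using H by simp
  have set_iff: "A \<in> sets \<nu> \<longleftrightarrow> A \<subseteq> H \<and> A \<in> sets borel" for A
    using Hb by (auto simp: sets_\<nu> sets_restrict_space_iff)
  have idm: "(\<lambda>x. x) \<in> measurable \<nu> borel"
    by (simp add: measurable_cong_sets[OF sets_\<nu> refl] measurable_restrict_space1)
  define N where "N = distr \<nu> borel (\<lambda>x. x)"
  have N: "emeasure N A = emeasure \<nu> (A \<inter> H)" if "A \<in> sets borel" for A
    unfolding N_def using that idm by (subst emeasure_distr) (auto simp: space_\<nu>)
  have "invariant_borel_measure H N"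
  proof
    show "locally_compact_space (euclidean :: 'a topology)" by (rule M.locally_compact)
    show "subgroup_add H" by (rule M.subgroup)
    show "sets N = sets borel" by (simp add: N_def)
    show "emeasure N C < \<infinity>" if "compact C" for C
      using that H \<nu>C[of "C \<inter> H"] by (simp add: N borel_compact compact_Int_closed)
    fix h A assume h: "h \<in> H" and A: "A \<in> sets (borel :: 'a measure)"
    have "(\<lambda>x. h + x) ` A \<in> sets borel"
      unfolding image_add_left_eq_vimage using A by (intro measurable_sets_borel[of _ borel]) simp_all
    moreover have "(\<lambda>x. h + x) ` A \<inter> H = (\<lambda>x. h + x) ` (A \<inter> H)"
      using subgroup_add_iff[OF M.subgroup h] by auto
    ultimately show "emeasure N ((\<lambda>x. h + x) ` A) = emeasure N A"
      using A Hb \<nu>inv[OF h, of "A \<inter> H"] by (simp add: N set_iff)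
  qed
  then interpret N: invariant_borel_measure H N .
  \<comment> \<open>Countably many translates of \<open>W\<close> by elements of \<open>H\<close>
    cover \<open>H\<close>, by the Lindelof property; were \<open>W\<close> null, \<open>H\<close>
    would be null too.\<close>
  have N_pos: "emeasure N W \<noteq> 0" if W: "open W" "0 \<in> W" for W
  proof
    assume 0: "emeasure N W = 0"
    obtain \<F> where \<F>: "\<F> \<subseteq> (\<lambda>h. (\<lambda>x. h + x) ` W) ` H" "countable \<F>" "\<Union>\<F> = (\<Union>h\<in>H. (\<lambda>x. h + x) ` W)"
      by (rule Lindelof[of "(\<lambda>h. (\<lambda>x. h + x) ` W) ` H"]) (use W(1) open_image_add_left in \<open>auto intro: that\<close>)
    have Z: "A \<in> null_sets N" if A: "A \<in> \<F>" for A
    proof -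
      obtain h where h: "h \<in> H" "A = (\<lambda>x. h + x) ` W" using A \<F>(1) by blast
      have "A \<in> sets N" using open_image_add_left[OF W(1), of h] h(2) by simp
      moreover have "emeasure N A = 0" unfolding h(2) using N.emeasure_translate[OF h(1), of W] W(1) 0 by simp
      ultimately show ?thesis by (rule null_setsI[rotated])
    qed
    have "(\<Union>A\<in>\<F>. A) \<in> null_sets N" by (rule null_sets_UN'[OF \<F>(2) Z])
    then have "\<Union>\<F> \<in> null_sets N" by simp
    moreover have "H \<subseteq> \<Union>\<F>"
      unfolding \<F>(3)
    proof
      fix h assume "h \<in> H"
      then show "h \<in> (\<Union>h\<in>H. (\<lambda>x. h + x) ` W)" using W(2) by (intro UN_I[of h] image_eqI[of _ _ 0]) auto
    qed
    ultimately have "H \<in> null_sets N" using Hb by (intro null_sets_subset[of "\<Union>\<F>" N H]) auto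
    then have "emeasure N H = 0" by blast
    with \<nu>H N[OF Hb] show False by simp
  qed
  interpret two_invariant_measures H N M
    by standard (use H Hb N_pos N[of "- H"] in auto)
  have BCL: "t \<in> L_infinity \<nu>" if t: "t \<in> BC" for t
  proof -
    have "t \<in> borel_measurable \<nu>"
      using t by (simp add: measurable_cong_sets[OF sets_\<nu> refl] BC_def borel_measurable_continuous_on_restrict)
    moreover obtain B where "\<forall>x\<in>H. \<bar>t x\<bar> \<le> B" using t by (auto simp: BC_def)
    then have "AE x in \<nu>. \<bar>t x\<bar> \<le> B" by (intro AE_I2) (simp add: space_\<nu>)
    ultimately show ?thesis by (auto simp: L_infinity_def)
  qed
  have mp: "\<And>f g. f \<in> L_infinity \<nu> \<Longrightarrow> g \<in> L_infinity \<nu> \<Longrightarrow> m (\<lambda>x. f x + g x) = m f + m g"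
    "\<And>c f. f \<in> L_infinity \<nu> \<Longrightarrow> m (\<lambda>x. c * f x) = c * m f"
    "\<And>f. f \<in> L_infinity \<nu> \<Longrightarrow> (AE x in \<nu>. 0 \<le> f x) \<Longrightarrow> 0 \<le> m f" "m (\<lambda>x. 1) = 1"
    using m unfolding mean_on_L_infinity_def by blast+
  have "\<exists>\<phi>\<in>densities. \<forall>g\<in>F. nrm (\<lambda>x. \<phi> (- g + x) - \<phi> x) \<le> \<epsilon>"
  proof (rule almost_invariant_under_compact_set[where m=m])
    show "0 \<le> m t" if "t \<in> BC" "\<And>x. x \<in> H \<Longrightarrow> 0 \<le> t x" for t
      using that(2) by (intro mp(3) BCL that(1) AE_I2) (simp add: space_\<nu>)
    \<comment> \<open>\<open>left_regular\<close> translates by the inverse, so its invariance is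
      used at - k.\<close>
    show "m (\<lambda>x. t (k + x)) = m t" if "k \<in> H" "t \<in> BC" for k t
      using minv[OF uminus_H[OF that(1)] BCL[OF that(2)]] by (simp add: left_regular_def)
  qed (use mp BCL M_nz F \<epsilon> in auto)
  then obtain \<phi> where \<phi>: "\<phi> \<in> densities" "\<And>g. g \<in> F \<Longrightarrow> nrm (\<lambda>x. \<phi> (- g + x) - \<phi> x) \<le> \<epsilon>" by blast
  note B = density_BI[OF \<phi>(1)]
  have nn: "0 \<le> \<phi> x" for x using \<phi>(1) by (simp add: densities_def)
  have "(\<integral>\<^sup>+ x. ennreal (\<phi> x) \<partial>M) = 1"
    using nrm_eq_nn_integral[OF B] nrm_density[OF \<phi>(1)] nn by simp
  moreover have "(\<integral>\<^sup>+ x. ennreal \<bar>\<phi> (- g + x) - \<phi> x\<bar> \<partial>M) \<le> ennreal \<epsilon>" if g: "g \<in> F" for g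
  proof -
    have "- g \<in> H" using uminus_H g F(2) by blast
    then have "(\<lambda>x. \<phi> (- g + x) - \<phi> x) \<in> BI" by (intro BI_diff BI_translate B)
    then show ?thesis using \<phi>(2)[OF g] by (subst nrm_eq_nn_integral) (auto intro: ennreal_leI)
  qed
  ultimately show ?thesis using nn BI_measurable[OF B] by blast
qed

theorem theorem1:
  fixes H :: "'a::{topological_group_add, t2_space, second_countable_topology} set"
    and \<mu>\<^sub>G :: "'a measure"
    and \<Phi> :: "real \<Rightarrow> real"
  assumes "locally_compact_space (euclidean :: 'a topology)"
    and "subgroup_add H" and "closed H"
    and "left_haar_measure UNIV \<mu>\<^sub>G"
    and "N_function \<Phi>" and "Delta2_regular \<mu>\<^sub>G \<Phi>"
  shows "almost_has_invariant_vectors H (orlicz_space \<mu>\<^sub>G \<Phi>) (gauge_norm \<mu>\<^sub>G \<Phi>) left_regular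
    \<longleftrightarrow> amenable H"
proof -
  have nz: "emeasure \<mu>\<^sub>G UNIV \<noteq> 0" using assms(4) by (simp add: left_haar_measure_def)
  have sets_G: "sets \<mu>\<^sub>G = sets borel"
    using assms(4) by (simp add: left_haar_measure_def sets_restrict_space)
  have haar: "\<And>C. compact C \<Longrightarrow> emeasure \<mu>\<^sub>G C < \<infinity>"
    "\<And>k A. A \<in> sets borel \<Longrightarrow> emeasure \<mu>\<^sub>G ((\<lambda>x. k + x) ` A) = emeasure \<mu>\<^sub>G A"
    using assms(4) unfolding left_haar_measure_def sets_G[symmetric] by blast+
  interpret G: invariant_borel_measure H \<mu>\<^sub>G
    by (rule invariant_borel_measure.intro[OF assms(1,2) sets_G haar])
  interpret orlicz \<Phi> \<mu>\<^sub>G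
    by standard (use assms in auto)
  have uH: "- h \<in> H" if "h \<in> H" for h using subgroup_addD(3)[OF assms(2) that] .
  have T: "(\<lambda>x. - g + x) \<in> measurable \<mu>\<^sub>G \<mu>\<^sub>G" "distr \<mu>\<^sub>G \<mu>\<^sub>G (\<lambda>x. - g + x) = \<mu>\<^sub>G" if "g \<in> H" for g
  proof -
    show "(\<lambda>x. - g + x) \<in> measurable \<mu>\<^sub>G \<mu>\<^sub>G" by measurable
    have "distr \<mu>\<^sub>G \<mu>\<^sub>G (\<lambda>x. - g + x) = distr \<mu>\<^sub>G borel (\<lambda>x. - g + x)" by (intro distr_cong) auto
    then show "distr \<mu>\<^sub>G \<mu>\<^sub>G (\<lambda>x. - g + x) = \<mu>\<^sub>G" using G.distr_translate[OF uH[OF that]] by simp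
  qed
  have lr: "left_regular g f - f = (\<lambda>x. f (- g + x) - f x)" for g f
    by (simp add: left_regular_def fun_diff_def)
  show ?thesis
  proof
    assume inv: "almost_has_invariant_vectors H (orlicz_space \<mu>\<^sub>G \<Phi>) (gauge_norm \<mu>\<^sub>G \<Phi>) left_regular"
    obtain D :: "nat \<Rightarrow> 'a set" where D: "\<And>n. compact (D n)" "incseq D" "\<And>C. compact C \<Longrightarrow> \<exists>n. C \<subseteq> D n"
      by (rule compact_exhaustion[OF assms(1)]) (rule that)
    \<comment> \<open>Every element of \<open>H\<close> lies in D n for all large n, so one sequence
      built from these sets becomes almost invariant at each element.\<close>
    have "\<exists>\<phi>\<in>borel_measurable borel. (\<forall>x. 0 \<le> \<phi> x) \<and> (\<integral>\<^sup>+ x. ennreal (\<phi> x) \<partial>\<mu>\<^sub>G) = 1 \<and>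
        (\<forall>g\<in>D n \<inter> H. (\<integral>\<^sup>+ x. ennreal \<bar>\<phi> (- g + x) - \<phi> x\<bar> \<partial>\<mu>\<^sub>G) \<le> ennreal (inverse (real (Suc n))))" for n
    proof -
      obtain \<epsilon> where \<epsilon>: "0 < \<epsilon>" "\<And>f. f \<in> orlicz_space \<mu>\<^sub>G \<Phi> \<Longrightarrow> gauge_norm \<mu>\<^sub>G \<Phi> f = 1 \<Longrightarrow>
        \<exists>\<phi>\<in>borel_measurable \<mu>\<^sub>G. (\<forall>x. 0 \<le> \<phi> x) \<and> (\<integral>\<^sup>+ x. ennreal (\<phi> x) \<partial>\<mu>\<^sub>G) = 1 \<and>
          (\<forall>T\<in>measurable \<mu>\<^sub>G \<mu>\<^sub>G. distr \<mu>\<^sub>G \<mu>\<^sub>G T = \<mu>\<^sub>G \<longrightarrow> gauge_norm \<mu>\<^sub>G \<Phi> (\<lambda>x. f (T x) - f x) \<le> \<epsilon> \<longrightarrow>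
            (\<integral>\<^sup>+ x. ennreal \<bar>\<phi> (T x) - \<phi> x\<bar> \<partial>\<mu>\<^sub>G) \<le> ennreal (inverse (real (Suc n))))"
        by (rule unit_vector_to_density[of "inverse (real (Suc n))"]) (simp, rule that)
      have DH: "compact (D n \<inter> H) \<and> D n \<inter> H \<subseteq> H" using D(1) assms(3) by auto
      obtain f where f: "f \<in> orlicz_space \<mu>\<^sub>G \<Phi>" "gauge_norm \<mu>\<^sub>G \<Phi> f = 1"
          "\<And>g. g \<in> D n \<inter> H \<Longrightarrow> gauge_norm \<mu>\<^sub>G \<Phi> (\<lambda>x. f (- g + x) - f x) \<le> \<epsilon>"
        using inv[unfolded almost_has_invariant_vectors_def lr, rule_format, OF DH \<epsilon>(1)] by auto
      obtain \<phi> where \<phi>: "\<phi> \<in> borel_measurable \<mu>\<^sub>G" "\<forall>x. 0 \<le> \<phi> x" "(\<integral>\<^sup>+ x. ennreal (\<phi> x) \<partial>\<mu>\<^sub>G) = 1"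
        "\<And>T. T \<in> measurable \<mu>\<^sub>G \<mu>\<^sub>G \<Longrightarrow> distr \<mu>\<^sub>G \<mu>\<^sub>G T = \<mu>\<^sub>G \<Longrightarrow> gauge_norm \<mu>\<^sub>G \<Phi> (\<lambda>x. f (T x) - f x) \<le> \<epsilon> \<Longrightarrow>
            (\<integral>\<^sup>+ x. ennreal \<bar>\<phi> (T x) - \<phi> x\<bar> \<partial>\<mu>\<^sub>G) \<le> ennreal (inverse (real (Suc n)))"
        using \<epsilon>(2)[OF f(1,2)] by blast
      have "\<phi> \<in> borel_measurable borel" using \<phi>(1) by (simp add: measurable_cong_sets[OF G.sets_M refl])
      moreover have "(\<integral>\<^sup>+ x. ennreal \<bar>\<phi> (- g + x) - \<phi> x\<bar> \<partial>\<mu>\<^sub>G) \<le> ennreal (inverse (real (Suc n)))"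
        if "g \<in> D n \<inter> H" for g
        using \<phi>(4)[of "\<lambda>x. - g + x"] T[of g] f(3)[OF that] that by blast
      ultimately show ?thesis using \<phi>(2,3) by blast
    qed
    then obtain \<phi> where \<phi>: "\<And>n. \<phi> n \<in> borel_measurable borel" "\<And>n x. 0 \<le> \<phi> n x"
      "\<And>n. (\<integral>\<^sup>+ x. ennreal (\<phi> n x) \<partial>\<mu>\<^sub>G) = 1"
      "\<And>n g. g \<in> D n \<inter> H \<Longrightarrow> (\<integral>\<^sup>+ x. ennreal \<bar>\<phi> n (- g + x) - \<phi> n x\<bar> \<partial>\<mu>\<^sub>G) \<le> ennreal (inverse (real (Suc n)))"
      by metis
    show "amenable H"
    proof (rule G.amenable_of_densities[OF assms(3) nz \<phi>(1,2,3)])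
      fix h assume h: "h \<in> H"
      obtain n0 where n0: "{- h} \<subseteq> D n0" using D(3)[of "{- h}"] by auto
      have lim: "(\<lambda>n. ennreal (inverse (real (Suc n)))) \<longlonglongrightarrow> 0"
        using tendsto_ennrealI[OF LIMSEQ_inverse_real_of_nat] by simp
      have "\<forall>\<^sub>F n in sequentially. (\<integral>\<^sup>+ x. ennreal \<bar>\<phi> n (h + x) - \<phi> n x\<bar> \<partial>\<mu>\<^sub>G) \<le> ennreal (inverse (real (Suc n)))"
        using eventually_ge_at_top[of n0]
      proof eventually_elim
        case (elim n)
        \<comment> \<open>\<open>left_regular g\<close> evaluates at - g + x, so the translate by h
          is the displacement for g = - h.\<close>
        have "- h \<in> D n \<inter> H" using n0 incseqD[OF D(2) elim] uH[OF h] by blast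
        from \<phi>(4)[OF this] show ?case by simp
      qed
      then show "(\<lambda>n. \<integral>\<^sup>+ x. ennreal \<bar>\<phi> n (h + x) - \<phi> n x\<bar> \<partial>\<mu>\<^sub>G) \<longlonglongrightarrow> 0"
        by (intro tendsto_sandwich[OF _ _ tendsto_const lim]) auto
    qed
  next
    assume am: "amenable H"
    show "almost_has_invariant_vectors H (orlicz_space \<mu>\<^sub>G \<Phi>) (gauge_norm \<mu>\<^sub>G \<Phi>) left_regular"
      unfolding almost_has_invariant_vectors_def lr
    proof (intro allI impI)
      fix F and \<epsilon> :: real assume F: "compact F \<and> F \<subseteq> H" and \<epsilon>: "0 < \<epsilon>"
      obtain \<delta> where \<delta>: "0 < \<delta>" "\<And>\<phi>. \<phi> \<in> borel_measurable \<mu>\<^sub>G \<Longrightarrow> (\<forall>x. 0 \<le> \<phi> x) \<Longrightarrow>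
        (\<integral>\<^sup>+ x. ennreal (\<phi> x) \<partial>\<mu>\<^sub>G) = 1 \<Longrightarrow>
        \<exists>f\<in>orlicz_space \<mu>\<^sub>G \<Phi>. gauge_norm \<mu>\<^sub>G \<Phi> f = 1 \<and>
          (\<forall>T\<in>measurable \<mu>\<^sub>G \<mu>\<^sub>G. (\<integral>\<^sup>+ x. ennreal \<bar>\<phi> (T x) - \<phi> x\<bar> \<partial>\<mu>\<^sub>G) \<le> ennreal \<delta> \<longrightarrow>
            gauge_norm \<mu>\<^sub>G \<Phi> (\<lambda>x. f (T x) - f x) \<le> \<epsilon>)"
        by (rule density_to_unit_vector[OF \<epsilon>]) (rule that)
      obtain \<phi> where \<phi>: "\<phi> \<in> borel_measurable borel" "\<forall>x. 0 \<le> \<phi> x" "(\<integral>\<^sup>+ x. ennreal (\<phi> x) \<partial>\<mu>\<^sub>G) = 1"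
          "\<And>g. g \<in> F \<Longrightarrow> (\<integral>\<^sup>+ x. ennreal \<bar>\<phi> (- g + x) - \<phi> x\<bar> \<partial>\<mu>\<^sub>G) \<le> ennreal \<delta>"
        using almost_invariant_densities[OF G.invariant_borel_measure_axioms assms(3) am nz _ _ \<delta>(1), of F] F by blast
      have \<phi>m: "\<phi> \<in> borel_measurable \<mu>\<^sub>G" using \<phi>(1) by (simp add: measurable_cong_sets[OF G.sets_M refl])
      obtain f where f: "f \<in> orlicz_space \<mu>\<^sub>G \<Phi>" "gauge_norm \<mu>\<^sub>G \<Phi> f = 1"
          "\<And>T. T \<in> measurable \<mu>\<^sub>G \<mu>\<^sub>G \<Longrightarrow> (\<integral>\<^sup>+ x. ennreal \<bar>\<phi> (T x) - \<phi> x\<bar> \<partial>\<mu>\<^sub>G) \<le> ennreal \<delta> \<Longrightarrow>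
            gauge_norm \<mu>\<^sub>G \<Phi> (\<lambda>x. f (T x) - f x) \<le> \<epsilon>"
        using \<delta>(2)[OF \<phi>m \<phi>(2,3)] by blast
      have "gauge_norm \<mu>\<^sub>G \<Phi> (\<lambda>x. f (- g + x) - f x) \<le> \<epsilon>" if "g \<in> F" for g
        using f(3)[OF T(1) \<phi>(4)[OF that]] that F by blast
      with f(1,2) show "\<exists>v\<in>orlicz_space \<mu>\<^sub>G \<Phi>. gauge_norm \<mu>\<^sub>G \<Phi> v = 1 \<and>
          (\<forall>g\<in>F. gauge_norm \<mu>\<^sub>G \<Phi> (\<lambda>x. v (- g + x) - v x) \<le> \<epsilon>)" by blast
    qed
  qed
qed

end
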